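(* Let $E$ be an arbitrary directed graph and $K$ a field with involution. The following are equivalent: (1) $E$ is row-finite, no-exit, and every infinite path of $E$ ends in a sink or a cycle; (2) $L_K(E)$ is locally Baer; (3) $L_K(E)$ is graded locally Baer. If $K$ is positive definite, these are also equivalent to (4) $L_K(E)$ is a graded locally Baer $*$-ring. Consequently, the following are equivalent: (1') $E$ is finite and no-exit; (2') $L_K(E)$ is a Baer ring; (3') $L_K(E)$ is a graded Baer ring; and, if $K$ is positive definite, (4') $L_K(E)$ is a graded Baer $*$-ring.
   Context: Directed graph $E=(E^0,E^1,s,r)$ of arbitrary cardinality. A vertex $v$ is regular if $s^{-1}(v)$ is nonempty and finite, a sink if $s^{-1}(v)=\emptyset$. $E$ is row-finite if every vertex is regular or a sink, and finite if row-finite with $E^0$ finite. A path is $e_1\cdots e_n$ with $r(e_i)=s(e_{i+1})$; a cycle is a closed path ($s(e_1)=r(e_n)$, $n\ge1$) with $s(e_i)\ne s(e_j)$ for $i\ne j$. $E$ is no-exit if every vertex visited by a cycle emits exactly one edge. An infinite path $e_1e_2\cdots$ ends in a sink or a cycle if some tail $e_ne_{n+1}\cdots$ either contains no cycles and no vertex on it emits an edge other than the next edge of the path, or equals $ccc\cdots$ for a cycle $c$. $L_K(E)$: free $K$-algebra on $E^0\cup E^1\cup\{e^*\}$ modulo $vw=\delta_{v,w}v$; $s(e)e=er(e)=e$; $r(e)e^*=e^*s(e)=e^*$; $e^*f=\delta_{e,f}r(e)$; $v=\sum_{e\in s^{-1}(v)}ee^*$ for regular $v$; $\mathbb Z$-graded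 with $\deg(ab^* )=|a|-|b|$; $*$-algebra via $(\sum k_ia_ib_i^* )^*=\sum k_i^*b_ia_i^*$. $K$ positive definite: $\sum k_ik_i^*=0\Rightarrow$ all $k_i=0$. A unital ring is Baer if the right annihilator of every subset is generated by an idempotent; graded Baer if unital and the right annihilator of every set of homogeneous elements is generated by a homogeneous idempotent; a graded Baer $*$-ring if the right annihilator of every set of homogeneous elements is generated by a homogeneous projection ($p=p^2=p^*$). Locally Baer: $eAe$ Baer for every idempotent $e$; graded locally Baer: $eAe$ graded Baer for every homogeneous idempotent $e$; graded locally Baer $*$-ring: $pAp$ a graded Baer $*$-ring for every homogeneous projection $p$. *)

theory Defs
  imports Main
begin

record ('v,'e) dgraph =
  verts :: "'v set"
  edges :: "'e set"
  src   :: "'e \<Rightarrow> 'v"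
  rng   :: "'e \<Rightarrow> 'v"

definition wf_graph :: "('v,'e) dgraph \<Rightarrow> bool" where
  "wf_graph E \<longleftrightarrow> (\<forall>e\<in>edges E. src E e \<in> verts E \<and> rng E e \<in> verts E)"

definition emits :: "('v,'e) dgraph \<Rightarrow> 'v \<Rightarrow> 'e set" where
  "emits E v = {e \<in> edges E. src E e = v}"

definition regular_vertex :: "('v,'e) dgraph \<Rightarrow> 'v \<Rightarrow> bool" where
  "regular_vertex E v \<longleftrightarrow> emits E v \<noteq> {} \<and> finite (emits E v)"

definition sink :: "('v,'e) dgraph \<Rightarrow> 'v \<Rightarrow> bool" where
  "sink E v \<longleftrightarrow> emits E v = {}"

definition row_finite :: "('v,'e) dgraph \<Rightarrow> bool" where
  "row_finite E \<longleftrightarrow> (\<forall>v\<in>verts E. regular_vertex E v \<or> sink E v)"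

definition finite_graph :: "('v,'e) dgraph \<Rightarrow> bool" where
  "finite_graph E \<longleftrightarrow> row_finite E \<and> finite (verts E)"

definition is_path :: "('v,'e) dgraph \<Rightarrow> 'e list \<Rightarrow> bool" where
  "is_path E p \<longleftrightarrow> p \<noteq> [] \<and> set p \<subseteq> edges E \<and>
     (\<forall>i. Suc i < length p \<longrightarrow> rng E (p ! i) = src E (p ! Suc i))"

definition is_cycle :: "('v,'e) dgraph \<Rightarrow> 'e list \<Rightarrow> bool" where
  "is_cycle E c \<longleftrightarrow> is_path E c \<and> src E (hd c) = rng E (last c) \<and>
     inj_on (\<lambda>i. src E (c ! i)) {..<length c}"

definition no_exit :: "('v,'e) dgraph \<Rightarrow> bool" where
  "no_exit E \<longleftrightarrow> (\<forall>c. is_cycle E c \<longrightarrow> (\<forall>i<length c. card (emits E (src E (c ! i))) = 1))"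

definition is_inf_path :: "('v,'e) dgraph \<Rightarrow> (nat \<Rightarrow> 'e) \<Rightarrow> bool" where
  "is_inf_path E p \<longleftrightarrow> (\<forall>i. p i \<in> edges E \<and> rng E (p i) = src E (p (Suc i)))"

definition ends_in_sink_or_cycle :: "('v,'e) dgraph \<Rightarrow> (nat \<Rightarrow> 'e) \<Rightarrow> bool" where
  "ends_in_sink_or_cycle E p \<longleftrightarrow> (\<exists>n.
     ((\<forall>i j. n \<le> i \<longrightarrow> i \<le> j \<longrightarrow> \<not> is_cycle E (map p [i..<Suc j])) \<and>
      (\<forall>i\<ge>n. emits E (src E (p i)) = {p i}))
   \<or> (\<exists>c. is_cycle E c \<and> (\<forall>i. p (n + i) = c ! (i mod length c))))"

definition graph_cond :: "('v,'e) dgraph \<Rightarrow> bool" where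
  "graph_cond E \<longleftrightarrow> row_finite E \<and> no_exit E \<and>
     (\<forall>p. is_inf_path E p \<longrightarrow> ends_in_sink_or_cycle E p)"

definition field_involution :: "('k::field \<Rightarrow> 'k) \<Rightarrow> bool" where
  "field_involution \<sigma> \<longleftrightarrow> (\<forall>a b. \<sigma> (a + b) = \<sigma> a + \<sigma> b \<and> \<sigma> (a * b) = \<sigma> a * \<sigma> b) \<and>
     (\<forall>a. \<sigma> (\<sigma> a) = a)"

definition positive_definite :: "('k::field \<Rightarrow> 'k) \<Rightarrow> bool" where
  "positive_definite \<sigma> \<longleftrightarrow> (\<forall>ks. (\<Sum>k\<leftarrow>ks. k * \<sigma> k) = 0 \<longrightarrow> (\<forall>k\<in>set ks. k = 0))"

text \<open>Generators: vertices, real edges and ghost edges. The free (non-unital) K-algebra is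
  realised as finitely supported functions on nonempty words, with convolution product.\<close>

datatype ('v,'e) gen = Vt 'v | Ed 'e | Gh 'e

type_synonym ('v,'e,'k) fa = "('v,'e) gen list \<Rightarrow> 'k"

definition gen_ok :: "('v,'e) dgraph \<Rightarrow> ('v,'e) gen \<Rightarrow> bool" where
  "gen_ok E x = (case x of Vt v \<Rightarrow> v \<in> verts E | Ed e \<Rightarrow> e \<in> edges E | Gh e \<Rightarrow> e \<in> edges E)"

definition fa_zero :: "('v,'e,'k::comm_ring_1) fa" where
  "fa_zero = (\<lambda>_. 0)"

definition fa_mono :: "('v,'e) gen list \<Rightarrow> ('v,'e,'k::comm_ring_1) fa" where
  "fa_mono w = (\<lambda>u. if u = w then 1 else 0)"

definition fa_add :: "('v,'e,'k::comm_ring_1) fa \<Rightarrow> ('v,'e,'k) fa \<Rightarrow> ('v,'e,'k) fa" where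
  "fa_add f g = (\<lambda>w. f w + g w)"

definition fa_diff :: "('v,'e,'k::comm_ring_1) fa \<Rightarrow> ('v,'e,'k) fa \<Rightarrow> ('v,'e,'k) fa" where
  "fa_diff f g = (\<lambda>w. f w - g w)"

definition fa_smult :: "'k::comm_ring_1 \<Rightarrow> ('v,'e,'k) fa \<Rightarrow> ('v,'e,'k) fa" where
  "fa_smult c f = (\<lambda>w. c * f w)"

definition fa_mult :: "('v,'e,'k::comm_ring_1) fa \<Rightarrow> ('v,'e,'k) fa \<Rightarrow> ('v,'e,'k) fa" where
  "fa_mult f g = (\<lambda>w. \<Sum>i\<le>length w. f (take i w) * g (drop i w))"

definition FA :: "('v,'e) dgraph \<Rightarrow> ('v,'e,'k::comm_ring_1) fa set" where
  "FA E = {f. finite {w. f w \<noteq> 0} \<and> f [] = 0 \<and>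
              (\<forall>w. f w \<noteq> 0 \<longrightarrow> set w \<subseteq> Collect (gen_ok E))}"

definition lrels :: "('v,'e) dgraph \<Rightarrow> ('v,'e,'k::comm_ring_1) fa set" where
  "lrels E =
     {fa_diff (fa_mono [Vt v, Vt w]) (if v = w then fa_mono [Vt v] else fa_zero) | v w.
        v \<in> verts E \<and> w \<in> verts E}
   \<union> {fa_diff (fa_mono [Vt (src E e), Ed e]) (fa_mono [Ed e]) | e. e \<in> edges E}
   \<union> {fa_diff (fa_mono [Ed e, Vt (rng E e)]) (fa_mono [Ed e]) | e. e \<in> edges E}
   \<union> {fa_diff (fa_mono [Vt (rng E e), Gh e]) (fa_mono [Gh e]) | e. e \<in> edges E}
   \<union> {fa_diff (fa_mono [Gh e, Vt (src E e)]) (fa_mono [Gh e]) | e. e \<in> edges E}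
   \<union> {fa_diff (fa_mono [Gh e, Ed f]) (if e = f then fa_mono [Vt (rng E e)] else fa_zero) | e f.
        e \<in> edges E \<and> f \<in> edges E}
   \<union> {fa_diff (fa_mono [Vt v]) (\<lambda>w. \<Sum>e\<in>emits E v. fa_mono [Ed e, Gh e] w) | v.
        v \<in> verts E \<and> regular_vertex E v}"

inductive_set lideal :: "('v,'e) dgraph \<Rightarrow> ('v,'e,'k::comm_ring_1) fa set" for E where
  zero: "fa_zero \<in> lideal E"
| gen: "\<rho> \<in> lrels E \<Longrightarrow> set u \<subseteq> Collect (gen_ok E) \<Longrightarrow> set w \<subseteq> Collect (gen_ok E) \<Longrightarrow>
        fa_smult c (fa_mult (fa_mult (fa_mono u) \<rho>) (fa_mono w)) \<in> lideal E"
| add: "a \<in> lideal E \<Longrightarrow> b \<in> lideal E \<Longrightarrow> fa_add a b \<in> lideal E"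

definition lequiv :: "('v,'e) dgraph \<Rightarrow> (('v,'e,'k::comm_ring_1) fa \<times> ('v,'e,'k) fa) set" where
  "lequiv E = {(f, g). f \<in> FA E \<and> g \<in> FA E \<and> fa_diff f g \<in> lideal E}"

definition LPA :: "('v,'e) dgraph \<Rightarrow> ('v,'e,'k::comm_ring_1) fa set set" where
  "LPA E = FA E // lequiv E"

definition lclass :: "('v,'e) dgraph \<Rightarrow> ('v,'e,'k::comm_ring_1) fa \<Rightarrow> ('v,'e,'k) fa set" where
  "lclass E f = lequiv E `` {f}"

definition lmult :: "('v,'e) dgraph \<Rightarrow> ('v,'e,'k::comm_ring_1) fa set \<Rightarrow> ('v,'e,'k) fa set \<Rightarrow> ('v,'e,'k) fa set" where
  "lmult E X Y = (\<Union>f\<in>X. \<Union>g\<in>Y. lclass E (fa_mult f g))"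

definition lzero :: "('v,'e) dgraph \<Rightarrow> ('v,'e,'k::comm_ring_1) fa set" where
  "lzero E = lclass E fa_zero"

fun gswap :: "('v,'e) gen \<Rightarrow> ('v,'e) gen" where
  "gswap (Vt v) = Vt v" | "gswap (Ed e) = Gh e" | "gswap (Gh e) = Ed e"

text \<open>(k x1...xn)^* = k^* xn^* ... x1^*, which agrees with (k a b^*)^* = k^* b a^*.\<close>
definition fa_star :: "('k::comm_ring_1 \<Rightarrow> 'k) \<Rightarrow> ('v,'e,'k) fa \<Rightarrow> ('v,'e,'k) fa" where
  "fa_star \<sigma> f = (\<lambda>w. \<sigma> (f (rev (map gswap w))))"

definition lstar :: "('v,'e) dgraph \<Rightarrow> ('k::comm_ring_1 \<Rightarrow> 'k) \<Rightarrow> ('v,'e,'k) fa set \<Rightarrow> ('v,'e,'k) fa set" where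
  "lstar E \<sigma> X = (\<Union>f\<in>X. lclass E (fa_star \<sigma> f))"

fun gdeg :: "('v,'e) gen \<Rightarrow> int" where
  "gdeg (Vt v) = 0" | "gdeg (Ed e) = 1" | "gdeg (Gh e) = -1"

definition wdeg :: "('v,'e) gen list \<Rightarrow> int" where
  "wdeg w = (\<Sum>x\<leftarrow>w. gdeg x)"

definition lhomog :: "('v,'e) dgraph \<Rightarrow> ('v,'e,'k::comm_ring_1) fa set \<Rightarrow> bool" where
  "lhomog E X \<longleftrightarrow> (\<exists>n. \<exists>f\<in>X. \<forall>w. f w \<noteq> 0 \<longrightarrow> wdeg w = n)"

definition rann :: "'a set \<Rightarrow> ('a \<Rightarrow> 'a \<Rightarrow> 'a) \<Rightarrow> 'a \<Rightarrow> 'a set \<Rightarrow> 'a set" where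
  "rann C m z S = {y \<in> C. \<forall>x\<in>S. m x y = z}"

definition has_unit :: "'a set \<Rightarrow> ('a \<Rightarrow> 'a \<Rightarrow> 'a) \<Rightarrow> bool" where
  "has_unit C m \<longleftrightarrow> (\<exists>u\<in>C. \<forall>x\<in>C. m u x = x \<and> m x u = x)"

definition baer :: "'a set \<Rightarrow> ('a \<Rightarrow> 'a \<Rightarrow> 'a) \<Rightarrow> 'a \<Rightarrow> bool" where
  "baer C m z \<longleftrightarrow> has_unit C m \<and>
     (\<forall>S\<subseteq>C. \<exists>p\<in>C. m p p = p \<and> rann C m z S = m p ` C)"

definition gr_baer :: "'a set \<Rightarrow> ('a \<Rightarrow> 'a \<Rightarrow> 'a) \<Rightarrow> 'a \<Rightarrow> ('a \<Rightarrow> bool) \<Rightarrow> bool" where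
  "gr_baer C m z H \<longleftrightarrow> has_unit C m \<and>
     (\<forall>S\<subseteq>C. (\<forall>x\<in>S. H x) \<longrightarrow> (\<exists>p\<in>C. H p \<and> m p p = p \<and> rann C m z S = m p ` C))"

definition gr_baer_star :: "'a set \<Rightarrow> ('a \<Rightarrow> 'a \<Rightarrow> 'a) \<Rightarrow> 'a \<Rightarrow> ('a \<Rightarrow> 'a) \<Rightarrow> ('a \<Rightarrow> bool) \<Rightarrow> bool" where
  "gr_baer_star C m z st H \<longleftrightarrow>
     (\<forall>S\<subseteq>C. (\<forall>x\<in>S. H x) \<longrightarrow> (\<exists>p\<in>C. H p \<and> m p p = p \<and> st p = p \<and> rann C m z S = m p ` C))"

definition corner :: "'a set \<Rightarrow> ('a \<Rightarrow> 'a \<Rightarrow> 'a) \<Rightarrow> 'a \<Rightarrow> 'a set" where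
  "corner C m e = (\<lambda>x. m (m e x) e) ` C"

definition locally_baer :: "'a set \<Rightarrow> ('a \<Rightarrow> 'a \<Rightarrow> 'a) \<Rightarrow> 'a \<Rightarrow> bool" where
  "locally_baer C m z \<longleftrightarrow> (\<forall>e\<in>C. m e e = e \<longrightarrow> baer (corner C m e) m z)"

definition gr_locally_baer :: "'a set \<Rightarrow> ('a \<Rightarrow> 'a \<Rightarrow> 'a) \<Rightarrow> 'a \<Rightarrow> ('a \<Rightarrow> bool) \<Rightarrow> bool" where
  "gr_locally_baer C m z H \<longleftrightarrow> (\<forall>e\<in>C. H e \<longrightarrow> m e e = e \<longrightarrow> gr_baer (corner C m e) m z H)"

definition gr_locally_baer_star ::
  "'a set \<Rightarrow> ('a \<Rightarrow> 'a \<Rightarrow> 'a) \<Rightarrow> 'a \<Rightarrow> ('a \<Rightarrow> 'a) \<Rightarrow> ('a \<Rightarrow> bool) \<Rightarrow> bool" where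
  "gr_locally_baer_star C m z st H \<longleftrightarrow>
     (\<forall>p\<in>C. H p \<longrightarrow> m p p = p \<longrightarrow> st p = p \<longrightarrow> gr_baer_star (corner C m p) m z st H)"

end

theory Submission
  imports Defs
begin

text \<open>
  Call a vertex linear if everything reachable from it emits at most one edge: sinks, vertices on
  cycles without exit, and starting points of unbranched infinite paths.  Under the graph condition
  Koenig's lemma writes every vertex as a finite orthogonal sum of idempotents \<open>m m\<^sup>*\<close> with
  \<open>m\<^sup>* m\<close> a linear vertex.  Between linear vertices the homogeneous components of the algebra are at
  most one-dimensional and spanned by unitaries, so the corners there are \<open>K\<close> or \<open>K[x, 1/x]\<close> and
  admit division with remainder.  The annihilator of a set is then generated by an idempotent, by
  induction on the number of summands: subtract the multiples of an element of minimal width from all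
  others to clear one coordinate, and split off a single rank-one idempotent for that element.

  Conversely, if the graph condition fails, there are infinitely many paths \<open>t i\<close> from one vertex
  with \<open>(t i)\<^sup>* t j = 0\<close> for distinct \<open>i\<close> and \<open>j\<close>, such that every element \<open>x\<close> of the algebra acts on
  almost all of them by the same scalar.  No idempotent can then separate the even from the odd indices.
\<close>

section \<open>Paths and linear vertices\<close>

text \<open>All versions of the theorem share one argument. A generator of an annihilator is sought
  as an idempotent p such that \<open>p * t = t\<close> holds exactly for those t with
  \<open>u * t = t\<close> that S kills; this elementwise form passes to corners. The summands m of
  a frame act as coordinates: for y starting at a linear vertex, \<open>y * u\<close> is determined
  by the finitely many products \<open>y * m\<close>, each between two linear vertices. Two
  obstacles shape the forward direction. The set S has no structure, so a division with remainder
  would leave it; it is replaced by all admissible elements that kill whatever S kills. And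
  splitting off an element y needs a right inverse of y. Only there do the versions part: without
  grading a common left factor is removed first, a homogeneous y has an invertible coordinate, and
  for projections the inverse must be a multiple of \<open>st y\<close>, which is where positive
  definiteness enters. The converse starts from the weakest common consequence: homogeneous sets in
  corners at vertices, with any idempotent as generator.\<close>

fun endv :: "('v,'e) dgraph \<Rightarrow> 'v \<Rightarrow> 'e list \<Rightarrow> 'v" where
  "endv E v [] = v"
| "endv E v (e # es) = endv E (rng E e) es"

fun vpath :: "('v,'e) dgraph \<Rightarrow> 'v \<Rightarrow> 'e list \<Rightarrow> bool" where
  "vpath E v [] \<longleftrightarrow> v \<in> verts E"
| "vpath E v (e # es) \<longleftrightarrow> e \<in> edges E \<and> src E e = v \<and> vpath E (rng E e) es"

lemma endv_append [simp]: "endv E v (a @ b) = endv E (endv E v a) b"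
  by (induction a arbitrary: v) auto

lemma wf_graph_src [simp]: "wf_graph E \<Longrightarrow> e \<in> edges E \<Longrightarrow> src E e \<in> verts E"
  and wf_graph_rng [simp]: "wf_graph E \<Longrightarrow> e \<in> edges E \<Longrightarrow> rng E e \<in> verts E"
  by (auto simp: wf_graph_def)

lemma vpath_start: "wf_graph E \<Longrightarrow> vpath E v a \<Longrightarrow> v \<in> verts E"
  by (cases a) auto

lemma vpath_end: "vpath E v a \<Longrightarrow> endv E v a \<in> verts E"
  by (induction a arbitrary: v) auto

lemma vpath_append:
  "wf_graph E \<Longrightarrow> vpath E v (a @ b) \<longleftrightarrow> vpath E v a \<and> vpath E (endv E v a) b"
  by (induction a arbitrary: v) (auto dest: vpath_start)

definition linear_vertex :: "('v,'e) dgraph \<Rightarrow> 'v \<Rightarrow> bool" where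
  "linear_vertex E w \<longleftrightarrow> w \<in> verts E \<and>
     (\<forall>a. vpath E w a \<longrightarrow> (\<forall>e\<in>emits E (endv E w a). \<forall>f\<in>emits E (endv E w a). e = f))"

lemma linear_vertex_end:
  assumes "wf_graph E" "linear_vertex E w" "vpath E w a"
  shows "linear_vertex E (endv E w a)"
  unfolding linear_vertex_def
proof (intro conjI allI impI)
  show "endv E w a \<in> verts E" using assms(3) by (rule vpath_end)
  fix b assume "vpath E (endv E w a) b"
  hence "vpath E w (a @ b)" using assms by (simp add: vpath_append)
  thus "\<forall>e\<in>emits E (endv E (endv E w a) b). \<forall>f\<in>emits E (endv E (endv E w a) b). e = f"
    using assms(2) by (metis linear_vertex_def endv_append)
qed

lemma linear_vertex_emits:
  assumes "linear_vertex E w" "e \<in> edges E" "src E e = w" shows "emits E w = {e}"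
proof -
  have "e \<in> emits E w" using assms by (simp add: emits_def)
  moreover have "vpath E w []" using assms by (simp add: linear_vertex_def)
  hence "\<forall>e\<in>emits E w. \<forall>f\<in>emits E w. e = f"
    using assms(1) unfolding linear_vertex_def by (metis endv.simps(1))
  ultimately show ?thesis by blast
qed

text \<open>A linear vertex leaves no choice at any step, so two paths from it differ only in where
  they stop.\<close>

lemma linear_vertex_unique_path:
  assumes "wf_graph E" "linear_vertex E w" "vpath E w a" "vpath E w b" "length a \<le> length b"
  shows "\<exists>c. b = a @ c"
  using assms
proof (induction a arbitrary: w b)
  case (Cons e a)
  then obtain f b' where b: "b = f # b'" by (cases b) auto
  have "emits E w = {e}" "emits E w = {f}"
    using linear_vertex_emits Cons.prems b by fastforce+
  hence fe: "f = e" by auto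
  have "linear_vertex E (rng E e)"
    using linear_vertex_end[OF Cons.prems(1,2), of "[e]"] Cons.prems by auto
  then obtain c where "b' = a @ c" using Cons.IH[of "rng E e" b'] Cons.prems b fe by auto
  thus ?case using b fe by auto
qed simp

text \<open>The offset i lets the path start anywhere on the cycle: at 0 to read off successors
  around c, at a vertex with an exit to build the path family of the converse.\<close>

lemma inf_path_mod_cycle:
  assumes "is_cycle E c"
  shows "is_inf_path E (\<lambda>k. c ! ((i + k) mod length c))"
proof -
  let ?l = "length c"
  have c: "c \<noteq> []" "set c \<subseteq> edges E" "\<And>i. Suc i < ?l \<Longrightarrow> rng E (c ! i) = src E (c ! Suc i)"
    "src E (hd c) = rng E (last c)"
    using assms by (auto simp: is_cycle_def is_path_def)
  have lt: "j mod ?l < ?l" for j using c(1) by simp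
  have step: "rng E (c ! (j mod ?l)) = src E (c ! (Suc j mod ?l))" for j
  proof (cases "Suc (j mod ?l) = ?l")
    case True
    hence "Suc j mod ?l = 0" by (simp add: mod_Suc)
    moreover have "j mod ?l = ?l - 1" using True by simp
    ultimately show ?thesis using c(1,4) by (simp add: hd_conv_nth last_conv_nth)
  next
    case False
    hence "Suc (j mod ?l) < ?l" using lt[of j] by linarith
    thus ?thesis using c(3) False by (simp add: mod_Suc)
  qed
  show ?thesis
    unfolding is_inf_path_def using lt c(2) step by (metis add_Suc_right nth_mem subsetD)
qed

text \<open>The shortest stretch between equal sources is a cycle, and without exits the path must
  go around it forever.\<close>

lemma no_exit_repeat_ends_in_cycle:
  assumes "no_exit E" "is_inf_path E p" "i < j" "src E (p i) = src E (p j)"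
  shows "ends_in_sink_or_cycle E p"
proof -
  \<comment> \<open>\<open>Q d\<close> says that d is a return time at some position. The least one
    is taken over all positions, so a repeated source inside the stretch would itself be a smaller
    return time.\<close>
  define Q where "Q d \<longleftrightarrow> d > 0 \<and> (\<exists>i. src E (p i) = src E (p (i + d)))" for d
  have "Q (j - i)" using assms by (auto simp: Q_def intro!: exI[of _ i])
  define d where "d = (LEAST d. Q d)"
  have Qd: "Q d" unfolding d_def by (rule LeastI) fact
  have dmin: "\<not> Q d'" if "d' < d" for d' using that not_less_Least unfolding d_def by blast
  from Qd obtain n where n: "d > 0" "src E (p n) = src E (p (n + d))" by (auto simp: Q_def)
  have p: "p i \<in> edges E" "rng E (p i) = src E (p (Suc i))" for i
    using assms(2) by (auto simp: is_inf_path_def)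
  define c where "c = map p [n..<n+d]"
  have lc: "length c = d" and nthc: "\<And>i. i < d \<Longrightarrow> c ! i = p (n + i)" by (auto simp: c_def)
  have cne: "c \<noteq> []" using n(1) lc by auto
  have inj: "inj_on (\<lambda>i. src E (c ! i)) {..<length c}"
  proof (rule linorder_inj_onI')
    fix a b assume ab: "a \<in> {..<length c}" "b \<in> {..<length c}" "a < b"
    show "src E (c ! a) \<noteq> src E (c ! b)"
    proof
      assume "src E (c ! a) = src E (c ! b)"
      hence "src E (p (n + a)) = src E (p ((n + a) + (b - a)))" using ab lc nthc by auto
      hence "Q (b - a)" using ab unfolding Q_def by (intro conjI exI[of _ "n + a"]) auto
      moreover have "b - a < d" using ab lc by auto
      ultimately show False using dmin by blast
    qed
  qed
  have cyc: "is_cycle E c"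
    unfolding is_cycle_def
  proof (intro conjI)
    show "is_path E c" unfolding is_path_def using cne p lc nthc by (auto simp: c_def)
    have "last c = p (n + d - 1)" using lc nthc[of "d-1"] n(1) cne by (simp add: last_conv_nth)
    moreover have "hd c = p n" using lc nthc[of 0] n(1) cne by (simp add: hd_conv_nth)
    ultimately show "src E (hd c) = rng E (last c)" using n p(2)[of "n+d-1"] by auto
  qed fact
  have one: "card (emits E (src E (c ! k))) = 1" if "k < d" for k
    using assms(1) cyc that lc by (auto simp: no_exit_def)
  have infc: "is_inf_path E (\<lambda>k. c ! ((0 + k) mod length c))" by (rule inf_path_mod_cycle) fact
  have "p (n + k) = c ! (k mod d)" for k
  proof (induction k)
    case 0 thus ?case using nthc[of 0] n by simp
  next
    case (Suc k)
    have "src E (p (n + Suc k)) = rng E (p (n + k))" using p by simp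
    also have "\<dots> = src E (c ! (Suc k mod d))"
      using infc Suc lc by (auto simp: is_inf_path_def)
    finally have s: "src E (p (n + Suc k)) = src E (c ! (Suc k mod d))" .
    have "p (n + Suc k) \<in> emits E (src E (c ! (Suc k mod d)))"
      using s p by (auto simp: emits_def)
    moreover have "c ! (Suc k mod d) \<in> emits E (src E (c ! (Suc k mod d)))"
      using cyc n(1) lc by (auto simp: emits_def is_cycle_def is_path_def)
    ultimately show ?case using one[of "Suc k mod d"] n(1) by (metis card_1_singletonE mod_less_divisor singletonD)
  qed
  thus ?thesis unfolding ends_in_sink_or_cycle_def using cyc lc by metis
qed

text \<open>Pigeonhole: with finitely many vertices every infinite path repeats one. This reduces
  the unital case to the general graph condition.\<close>

lemma finite_no_exit_graph_cond:
  assumes "wf_graph E" "finite_graph E" "no_exit E"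
  shows "graph_cond E"
  unfolding graph_cond_def
proof (intro conjI allI impI)
  show "row_finite E" using assms by (simp add: finite_graph_def)
  fix p assume p: "is_inf_path E p"
  have "finite (verts E)" using assms by (simp add: finite_graph_def)
  moreover have "range (\<lambda>i. src E (p i)) \<subseteq> verts E"
    using p assms(1) by (auto simp: is_inf_path_def)
  ultimately have "\<not> inj (\<lambda>i. src E (p i))" using finite_imageD infinite_UNIV_nat finite_subset by blast
  then obtain i j where "i < j" "src E (p i) = src E (p j)" unfolding inj_def by (metis linorder_neqE_nat)
  thus "ends_in_sink_or_cycle E p" using no_exit_repeat_ends_in_cycle assms p by blast
qed fact

lemma vpath_follows_tail:
  assumes "\<And>i. emits E (src E (p i)) = {p i}" "\<And>i. rng E (p i) = src E (p (Suc i))"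
    "vpath E (src E (p n)) a"
  shows "endv E (src E (p n)) a = src E (p (n + length a))"
  using assms(3)
proof (induction a arbitrary: n)
  case (Cons e a)
  hence "e \<in> emits E (src E (p n))" by (auto simp: emits_def)
  hence "e = p n" using assms(1) by simp
  thus ?case using Cons assms(2)[of n] by auto
qed simp

text \<open>Koenig's lemma for the tree of paths that stop when they reach a linear vertex.\<close>

lemma graph_cond_wf:
  assumes "wf_graph E" "graph_cond E"
  shows "wf {(rng E e, src E e) | e. e \<in> edges E \<and> \<not> linear_vertex E (src E e)}" (is "wf ?R")
proof (rule ccontr)
  assume "\<not> wf ?R"
  then obtain f where f: "\<And>i. (f (Suc i), f i) \<in> ?R" unfolding wf_iff_no_infinite_down_chain by blast
  hence "\<forall>i. \<exists>e. e \<in> edges E \<and> \<not> linear_vertex E (src E e) \<and> f (Suc i) = rng E e \<and> f i = src E e"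
    by blast
  then obtain p where p: "\<And>i. p i \<in> edges E" "\<And>i. \<not> linear_vertex E (src E (p i))"
    "\<And>i. f (Suc i) = rng E (p i)" "\<And>i. f i = src E (p i)" by metis
  have rs: "rng E (p i) = src E (p (Suc i))" for i using p(3,4) by metis
  have "is_inf_path E p" using p rs by (auto simp: is_inf_path_def)
  hence "ends_in_sink_or_cycle E p" using assms(2) by (simp add: graph_cond_def)
  \<comment> \<open>On a tail ccc... the no-exit condition yields what the other alternative states
    outright: from some n on, each vertex emits only the next edge of p.\<close>
  moreover have "\<exists>n. \<forall>i\<ge>n. emits E (src E (p i)) = {p i}"
    if c: "is_cycle E c" "\<forall>i. p (n + i) = c ! (i mod length c)" for c n
  proof -
    have "emits E (src E (p i)) = {p i}" if "n \<le> i" for i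
    proof -
      have "p i = c ! ((i - n) mod length c)" using c(2) that by (metis le_add_diff_inverse)
      moreover have "(i - n) mod length c < length c" using c(1) by (auto simp: is_cycle_def is_path_def)
      ultimately have "card (emits E (src E (p i))) = 1"
        using assms(2) c(1) by (auto simp: graph_cond_def no_exit_def)
      moreover have "p i \<in> emits E (src E (p i))" using p by (auto simp: emits_def)
      ultimately show ?thesis by (metis card_1_singletonE singletonD)
    qed
    thus ?thesis by blast
  qed
  ultimately obtain n where n: "\<And>i. i \<ge> n \<Longrightarrow> emits E (src E (p i)) = {p i}"
    unfolding ends_in_sink_or_cycle_def by blast
  \<comment> \<open>Only the tail itself is reachable from \<open>src E (p n)\<close>, so this
    vertex is linear, although p was built from edges with non-linear sources.\<close>
  have "linear_vertex E (src E (p n))"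
    unfolding linear_vertex_def
  proof (intro conjI allI impI)
    show "src E (p n) \<in> verts E" using p assms(1) by simp
    fix a assume a: "vpath E (src E (p n)) a"
    have "endv E (src E (p n)) a = src E (p (n + length a))"
      using vpath_follows_tail[of E "\<lambda>i. p (n + i)" 0 a] n rs a by simp
    thus "\<forall>e\<in>emits E (endv E (src E (p n)) a). \<forall>f\<in>emits E (endv E (src E (p n)) a). e = f"
      using n by simp
  qed
  thus False using p(2) by blast
qed

lemma linear_vertexI_sink:
  assumes "sink E v" "v \<in> verts E" shows "linear_vertex E v"
proof -
  have "a = []" if "vpath E v a" for a using that assms by (cases a) (auto simp: sink_def emits_def)
  thus ?thesis using assms unfolding linear_vertex_def sink_def by fastforce
qed

section \<open>Algebras with the Leavitt relations\<close>

lemma field_involution_simps: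
  assumes "field_involution \<sigma>"
  shows "\<sigma> (a + b) = \<sigma> a + \<sigma> b" "\<sigma> (a * b) = \<sigma> a * \<sigma> b" "\<sigma> (\<sigma> a) = a" "\<sigma> 0 = 0" "\<sigma> 1 = 1" "\<sigma> (a - b) = \<sigma> a - \<sigma> b"
    "\<sigma> (sum f S) = (\<Sum>i\<in>S. \<sigma> (f i))"
proof -
  show add: "\<sigma> (a + b) = \<sigma> a + \<sigma> b" and mult: "\<sigma> (a * b) = \<sigma> a * \<sigma> b" and inv: "\<sigma> (\<sigma> a) = a" for a b
    using assms by (auto simp: field_involution_def)
  have "\<sigma> 0 + \<sigma> 0 = \<sigma> 0 + 0" using add[of 0 0] by (simp only: add_0_right)
  thus z: "\<sigma> 0 = 0" by (simp only: add_left_cancel)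
  \<comment> \<open>Since \<open>\<sigma> 1 = \<sigma> 1 * \<sigma> (\<sigma> 1) = \<sigma> (1 *
    \<sigma> 1) = \<sigma> (\<sigma> 1) = 1\<close>.\<close>
  show "\<sigma> 1 = 1" by (metis inv mult mult.right_neutral mult_1)
  have "\<sigma> (a - b) + \<sigma> b = \<sigma> a" by (simp add: add[symmetric])
  thus "\<sigma> (a - b) = \<sigma> a - \<sigma> b" by (simp add: eq_diff_eq)
  show "\<sigma> (sum f S) = (\<Sum>i\<in>S. \<sigma> (f i))"
    by (induction S rule: infinite_finite_induct) (auto simp: z add)
qed

text \<open>An interface over a ring type without unit, so that products can be simplified with the
  library rules. The grading enters through the projections \<open>cmp n\<close> onto the
  components. Ring elements need not be finite sums of components; that is proved later for the span
  of the monomials only. Ghost edges are the images \<open>st (ed e)\<close>, which halves the list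
  of relations. \<open>vt_nonzero\<close> is the one axiom that does not follow from a defining
  relation and calls for a faithful action.\<close>

locale leavitt =
  fixes E :: "('v,'e) dgraph" and \<sigma> :: "'k::field \<Rightarrow> 'k"
    and sc :: "'k \<Rightarrow> 'a::ring \<Rightarrow> 'a" (infixr "\<cdot>" 75)
    and st :: "'a \<Rightarrow> 'a"
    and cmp :: "int \<Rightarrow> 'a \<Rightarrow> 'a"
    and vt :: "'v \<Rightarrow> 'a" and ed :: "'e \<Rightarrow> 'a"
  assumes wf: "wf_graph E" and involution: "field_involution \<sigma>"
    and sc_add_right: "c \<cdot> (x + y) = c \<cdot> x + c \<cdot> y"
    and sc_add_left: "(c + d) \<cdot> x = c \<cdot> x + d \<cdot> x"
    and sc_sc: "c \<cdot> d \<cdot> x = (c * d) \<cdot> x"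
    and sc_one: "1 \<cdot> x = x"
    and sc_mult_left: "(c \<cdot> x) * y = c \<cdot> (x * y)"
    and sc_mult_right: "x * (c \<cdot> y) = c \<cdot> (x * y)"
    and st_add: "st (x + y) = st x + st y"
    and st_mult: "st (x * y) = st y * st x"
    and st_st: "st (st x) = x"
    and st_sc: "st (c \<cdot> x) = \<sigma> c \<cdot> st x"
    and cmp_add: "cmp n (x + y) = cmp n x + cmp n y"
    and cmp_sc: "cmp n (c \<cdot> x) = c \<cdot> cmp n x"
    and cmp_cmp: "cmp m (cmp n x) = (if m = n then cmp n x else 0)"
    and cmp_mult: "cmp n (cmp k x * y) = cmp k x * cmp (n - k) y"
    and cmp_st: "cmp n (st x) = st (cmp (- n) x)"
    and cmp_vt: "cmp 0 (vt v) = vt v"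
    and cmp_ed: "cmp 1 (ed e) = ed e"
    and st_vt: "st (vt v) = vt v"
    and vt_vt: "v \<in> verts E \<Longrightarrow> w \<in> verts E \<Longrightarrow> vt v * vt w = (if v = w then vt v else 0)"
    and src_ed: "e \<in> edges E \<Longrightarrow> vt (src E e) * ed e = ed e"
    and ed_rng: "e \<in> edges E \<Longrightarrow> ed e * vt (rng E e) = ed e"
    and ghost_ed: "e \<in> edges E \<Longrightarrow> f \<in> edges E \<Longrightarrow>
      st (ed e) * ed f = (if e = f then vt (rng E e) else 0)"
    and ck2: "v \<in> verts E \<Longrightarrow> regular_vertex E v \<Longrightarrow> vt v = (\<Sum>e\<in>emits E v. ed e * st (ed e))"
    and vt_nonzero: "v \<in> verts E \<Longrightarrow> vt v \<noteq> 0"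
begin

lemma sc_zero_left [simp]: "0 \<cdot> x = 0"
  using sc_add_left[of 0 0 x] by simp
lemma sc_zero_right [simp]: "c \<cdot> 0 = 0"
  using sc_add_right[of c 0 0] by simp
lemma sc_minus_left: "(- c) \<cdot> x = - (c \<cdot> x)"
  using sc_add_left[of "- c" c x] by (simp add: eq_neg_iff_add_eq_0)
lemma sc_eq_0_iff: "c \<cdot> x = 0 \<longleftrightarrow> c = 0 \<or> x = 0"
proof -
  have "x = 0" if "c \<cdot> x = 0" "c \<noteq> 0"
    using sc_sc[of "inverse c" c x] that by (simp add: sc_one)
  thus ?thesis by auto
qed

lemma st_zero [simp]: "st 0 = 0"
  using st_add[of 0 0] by simp
lemma st_minus: "st (- x) = - st x"
  using st_add[of "- x" x] by (simp add: eq_neg_iff_add_eq_0)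
lemma st_diff: "st (x - y) = st x - st y"
  using st_add[of x "- y"] by (simp add: st_minus)
lemma st_eq_0_iff: "st x = 0 \<longleftrightarrow> x = 0"
  by (metis st_st st_zero)

lemma cmp_zero [simp]: "cmp n 0 = 0"
  using cmp_add[of n 0 0] by simp
lemma cmp_minus: "cmp n (- x) = - cmp n x"
  using cmp_add[of n "- x" x] by (simp add: eq_neg_iff_add_eq_0)
lemma cmp_diff: "cmp n (x - y) = cmp n x - cmp n y"
  using cmp_add[of n x "- y"] by (simp add: cmp_minus)
lemma cmp_sum: "cmp n (sum f F) = (\<Sum>i\<in>F. cmp n (f i))"
  by (induction F rule: infinite_finite_induct) (auto simp: cmp_add)

lemma cmp_hom_mult: "cmp k q = q \<Longrightarrow> cmp n (q * y) = q * cmp (n - k) y"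
  using cmp_mult[of n k q y] by simp

text \<open>\<open>cmp_mult\<close> treats a homogeneous left factor; the involution, which negates
  degrees, carries it over to a right factor.\<close>

lemma cmp_mult_hom: "cmp k q = q \<Longrightarrow> cmp n (y * q) = cmp (n - k) y * q"
  using cmp_hom_mult[of "- k" "st q" "- n" "st y"] cmp_st[of "- n" "y * q"] cmp_st[of "- k" q]
    cmp_st[of "k - n" y]
  by (metis (no_types, opaque_lifting) add.inverse_inverse diff_minus_eq_add minus_diff_eq
      st_mult st_st uminus_add_conv_diff)

lemma hom_mult: "cmp m x = x \<Longrightarrow> cmp n y = y \<Longrightarrow> cmp (m + n) (x * y) = x * y"
  by (simp add: cmp_hom_mult)

lemma hom_other: "cmp m x = x \<Longrightarrow> n \<noteq> m \<Longrightarrow> cmp n x = 0"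
  by (metis cmp_cmp)

lemma hom_st: "cmp n x = x \<Longrightarrow> cmp (- n) (st x) = st x"
  by (simp add: cmp_st)

lemma vt_idem: "v \<in> verts E \<Longrightarrow> vt v * vt v = vt v"
  by (simp add: vt_vt)

lemma vt_ed_other: "e \<in> edges E \<Longrightarrow> v \<in> verts E \<Longrightarrow> v \<noteq> src E e \<Longrightarrow> vt v * ed e = 0"
  using vt_vt[of v "src E e"] src_ed[of e] wf
  by (metis mult.assoc mult_zero_left wf_graph_src)

lemma rng_st_ed: "e \<in> edges E \<Longrightarrow> vt (rng E e) * st (ed e) = st (ed e)"
  by (metis ed_rng st_mult st_vt)

section \<open>Paths as elements of the algebra and their products\<close>

fun pth :: "'v \<Rightarrow> 'e list \<Rightarrow> 'a" where
  "pth v [] = vt v"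
| "pth v (e # es) = ed e * pth (rng E e) es"

lemma vt_pth: "vpath E v a \<Longrightarrow> vt v * pth v a = pth v a"
  by (cases a) (auto simp: vt_vt src_ed mult.assoc[symmetric])

lemma vt_pth_other: "vpath E v a \<Longrightarrow> u \<in> verts E \<Longrightarrow> u \<noteq> v \<Longrightarrow> vt u * pth v a = 0"
  using vt_pth[of v a] vt_vt[of u v] vpath_start[OF wf, of v a]
  by (metis mult.assoc mult_zero_left)

lemma pth_vt: "vpath E v a \<Longrightarrow> pth v a * vt (endv E v a) = pth v a"
  by (induction a arbitrary: v) (auto simp: vt_vt mult.assoc)

lemma cmp_pth: "cmp (int (length a)) (pth v a) = pth v a"
proof (induction a arbitrary: v)
  case (Cons e a)
  show ?case using hom_mult[OF cmp_ed[of e] Cons[of "rng E e"]] by (simp add: add.commute)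
qed (simp add: cmp_vt)

lemma pth_append: "vpath E v (a @ b) \<Longrightarrow> pth v (a @ b) = pth v a * pth (endv E v a) b"
  by (induction a arbitrary: v) (auto simp: vt_pth mult.assoc)

lemma st_pth_pth: "vpath E v a \<Longrightarrow> st (pth v a) * pth v a = vt (endv E v a)"
proof (induction a arbitrary: v)
  case Nil thus ?case by (simp add: st_vt vt_vt)
next
  case (Cons e a)
  have "st (pth v (e # a)) * pth v (e # a) =
     st (pth (rng E e) a) * ((st (ed e) * ed e) * pth (rng E e) a)"
    by (simp add: st_mult mult.assoc)
  also have "\<dots> = st (pth (rng E e) a) * pth (rng E e) a"
    using Cons.prems by (simp add: ghost_ed vt_pth)
  finally show ?case using Cons by simp
qed

lemma st_pth_append:
  assumes "vpath E v (a @ c)" shows "st (pth v a) * pth v (a @ c) = pth (endv E v a) c"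
proof -
  have "vpath E v a" "vpath E (endv E v a) c" using assms wf by (auto simp: vpath_append)
  thus ?thesis using assms by (simp add: pth_append mult.assoc[symmetric] st_pth_pth vt_pth)
qed

lemma st_append_pth:
  assumes "vpath E v (a @ c)" shows "st (pth v (a @ c)) * pth v a = st (pth (endv E v a) c)"
  using arg_cong[OF st_pth_append[OF assms], of st] by (simp add: st_mult st_st)

lemma st_pth_incomparable:
  "vpath E v a \<Longrightarrow> vpath E v b \<Longrightarrow> \<nexists>c. b = a @ c \<Longrightarrow> \<nexists>c. a = b @ c \<Longrightarrow> st (pth v a) * pth v b = 0"
proof (induction a arbitrary: v b)
  case (Cons e a)
  then obtain f b' where b: "b = f # b'" by (cases b) auto
  have "st (pth v (e # a)) * pth v b =
     st (pth (rng E e) a) * ((st (ed e) * ed f) * pth (rng E f) b')"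
    by (simp add: st_mult mult.assoc b)
  also have "\<dots> = 0"
  proof (cases "e = f")
    case True
    have "st (pth (rng E e) a) * pth (rng E e) b' = 0"
      by (rule Cons.IH) (use Cons.prems True b in auto)
    thus ?thesis using True Cons.prems b by (simp add: ghost_ed vt_pth)
  qed (use Cons.prems b in \<open>simp add: ghost_ed\<close>)
  finally show ?case .
qed auto

text \<open>The Leavitt path algebra inside the possibly larger ambient ring. Taking the span of
  monomials instead of the generated subalgebra reduces inductions over elements to single
  monomials; closure under products then has to be proved.\<close>

inductive_set A :: "'a set" where
  zero: "0 \<in> A"
| add: "x \<in> A \<Longrightarrow> y \<in> A \<Longrightarrow> x + y \<in> A"
| mono: "vpath E v a \<Longrightarrow> vpath E v' b \<Longrightarrow> endv E v a = endv E v' b \<Longrightarrow>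
    c \<cdot> (pth v a * st (pth v' b)) \<in> A"

lemma A_mono1: "vpath E v a \<Longrightarrow> vpath E v' b \<Longrightarrow> endv E v a = endv E v' b \<Longrightarrow>
    pth v a * st (pth v' b) \<in> A"
  using A.mono[of v a v' b 1] by (simp add: sc_one)

lemma A_sc: "x \<in> A \<Longrightarrow> c \<cdot> x \<in> A"
  by (induction rule: A.induct) (auto simp: sc_add_right sc_sc intro: A.intros)

lemma A_minus: "x \<in> A \<Longrightarrow> - x \<in> A"
  using A_sc[of x "- 1"] by (simp add: sc_minus_left sc_one)

lemma A_diff: "x \<in> A \<Longrightarrow> y \<in> A \<Longrightarrow> x - y \<in> A"
  using A.add[of x "- y"] A_minus by simp

lemma A_sum: "(\<And>i. i \<in> F \<Longrightarrow> f i \<in> A) \<Longrightarrow> sum f F \<in> A"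
  by (induction F rule: infinite_finite_induct) (auto intro: A.intros)

lemmas sigma_simps = field_involution_simps[OF involution]

lemma sigma_inverse: "\<sigma> (inverse a) = inverse (\<sigma> a)"
proof (cases "a = 0")
  case False
  hence "\<sigma> a * \<sigma> (inverse a) = 1" by (simp add: sigma_simps(2)[symmetric] sigma_simps(5))
  thus ?thesis by (metis inverse_unique)
qed (simp add: sigma_simps)

lemma A_st: "x \<in> A \<Longrightarrow> st x \<in> A"
  by (induction rule: A.induct) (auto simp: st_add st_sc st_mult st_st intro: A.intros)

lemma A_pth: "vpath E v a \<Longrightarrow> pth v a \<in> A"
  using A_mono1[of v a "endv E v a" "[]"] by (simp add: vpath_end st_vt pth_vt)

lemma A_vt: "v \<in> verts E \<Longrightarrow> vt v \<in> A"
  using A_pth[of v "[]"] by simp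

lemma A_ed: "e \<in> edges E \<Longrightarrow> ed e \<in> A"
  using A_pth[of "src E e" "[e]"] wf by (simp add: ed_rng)

lemma A_vt_mult: "x \<in> A \<Longrightarrow> v \<in> verts E \<Longrightarrow> vt v * x \<in> A"
proof (induction rule: A.induct)
  case (mono u a v' b c)
  have "vt v * (pth u a * st (pth v' b)) = (if u = v then pth u a * st (pth v' b) else 0)"
    using mono by (auto simp: mult.assoc[symmetric] vt_pth vt_pth_other)
  thus ?case using mono by (auto simp: sc_mult_right intro: A.intros)
qed (auto simp: distrib_left intro: A.intros)

lemma A_ed_mult: "x \<in> A \<Longrightarrow> e \<in> edges E \<Longrightarrow> ed e * x \<in> A"
proof (induction rule: A.induct)
  case (mono u a v' b c)
  have "ed e * (pth u a * st (pth v' b)) = (ed e * (vt (rng E e) * pth u a)) * st (pth v' b)"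
    using mono by (simp add: mult.assoc[symmetric] ed_rng)
  also have "\<dots> = (if u = rng E e then pth (src E e) (e # a) * st (pth v' b) else 0)"
    using mono wf by (auto simp: vt_pth vt_pth_other)
  finally show ?case using mono A.mono[of "src E e" "e # a" v' b c]
    by (auto simp: sc_mult_right intro: A.intros)
qed (auto simp: distrib_left intro: A.intros)

text \<open>A ghost edge either meets a first edge of the path a and is absorbed by
  \<open>ghost_ed\<close>, or a is empty and the edge is appended to the ghost path b.\<close>

lemma A_ghost_mult: "x \<in> A \<Longrightarrow> e \<in> edges E \<Longrightarrow> st (ed e) * x \<in> A"
proof (induction rule: A.induct)
  case (mono u a v' b c)
  show ?case
  proof (cases a)
    case Nil
    have "st (ed e) * (vt u * st (pth v' b)) \<in> A"
    proof (cases "u = src E e")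
      case True
      have "vt u * st (pth v' b) = st (pth v' b)"
        using pth_vt[of v' b] mono Nil by (metis endv.simps(1) st_mult st_vt)
      moreover have "vpath E v' (b @ [e])" using mono Nil wf True by (simp add: vpath_append)
      ultimately have "st (ed e) * (vt u * st (pth v' b)) = vt (rng E e) * st (pth v' (b @ [e]))"
        using mono by (simp add: pth_append st_mult ed_rng mult.assoc[symmetric] rng_st_ed)
      thus ?thesis using A_mono1[of "rng E e" "[]" v' "b @ [e]"] mono True Nil wf by (simp add: vpath_append)
    next
      case False
      hence "st (ed e) * vt u = 0"
        using vt_ed_other[of e u] mono Nil by (metis st_mult st_vt st_zero vpath.simps(1))
      thus ?thesis by (simp add: mult.assoc[symmetric] A.zero)
    qed
    thus ?thesis using Nil A_sc by (simp add: sc_mult_right)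
  next
    case (Cons f a')
    have "st (ed e) * (pth u a * st (pth v' b)) = (st (ed e) * ed f) * pth (rng E f) a' * st (pth v' b)"
      using Cons by (simp add: mult.assoc)
    also have "\<dots> = (if e = f then pth (rng E f) a' * st (pth v' b) else 0)"
      using mono Cons by (simp add: ghost_ed vt_pth)
    finally show ?thesis using mono Cons by (auto simp: sc_mult_right intro: A.intros)
  qed
qed (auto simp: distrib_left intro: A.intros)

lemma A_pth_mult: "vpath E v a \<Longrightarrow> x \<in> A \<Longrightarrow> pth v a * x \<in> A"
  by (induction a arbitrary: v) (auto simp: A_vt_mult A_ed_mult mult.assoc)

lemma A_st_pth_mult: "vpath E v a \<Longrightarrow> x \<in> A \<Longrightarrow> st (pth v a) * x \<in> A"
  by (induction a arbitrary: v x) (auto simp: A_vt_mult A_ghost_mult mult.assoc st_vt st_mult)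

lemma A_mult: "x \<in> A \<Longrightarrow> y \<in> A \<Longrightarrow> x * y \<in> A"
  by (induction rule: A.induct)
    (auto simp: distrib_right mult.assoc sc_mult_left A_pth_mult A_st_pth_mult intro: A.intros A_sc)

lemma cmp_monomial:
  "cmp n (pth v a * st (pth v' b)) =
     (if n = int (length a) - int (length b) then pth v a * st (pth v' b) else 0)"
  using hom_mult[OF cmp_pth[of a v] hom_st[OF cmp_pth[of b v']]] hom_other
  by (metis diff_conv_add_uminus)

lemma A_cmp: "x \<in> A \<Longrightarrow> cmp n x \<in> A"
  by (induction rule: A.induct) (auto simp: cmp_add cmp_sc cmp_monomial intro: A.intros)

lemma A_finite_support: "x \<in> A \<Longrightarrow> finite {n. cmp n x \<noteq> 0}"
proof (induction rule: A.induct)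
  case (add x y)
  have "{n. cmp n (x + y) \<noteq> 0} \<subseteq> {n. cmp n x \<noteq> 0} \<union> {n. cmp n y \<noteq> 0}" by (auto simp: cmp_add)
  thus ?case using add finite_subset by blast
next
  case (mono v a v' b c)
  have "{n. cmp n (c \<cdot> (pth v a * st (pth v' b))) \<noteq> 0} \<subseteq> {int (length a) - int (length b)}"
    by (auto simp: cmp_sc cmp_monomial split: if_splits)
  thus ?case using finite_subset by blast
qed simp

text \<open>An element of the span is the sum of its components, a statement that may fail in the
  ambient ring.\<close>

lemma A_eq_0: assumes "x \<in> A" "\<And>n. cmp n x = 0" shows "x = 0"
proof -
  \<comment> \<open>Quantifying over all finite supersets of G lets the induction step for a sum use
    the union of the two sets.\<close>
  have "\<exists>G. finite G \<and> (\<forall>F. finite F \<longrightarrow> G \<subseteq> F \<longrightarrow> (\<Sum>n\<in>F. cmp n x) = x)" using assms(1)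
  proof (induction rule: A.induct)
    case (add x y)
    then obtain G H where "finite G" "\<And>F. finite F \<Longrightarrow> G \<subseteq> F \<Longrightarrow> (\<Sum>n\<in>F. cmp n x) = x"
      "finite H" "\<And>F. finite F \<Longrightarrow> H \<subseteq> F \<Longrightarrow> (\<Sum>n\<in>F. cmp n y) = y" by blast
    thus ?case by (intro exI[of _ "G \<union> H"]) (auto simp: cmp_add sum.distrib)
  next
    case (mono v a v' b c)
    let ?d = "int (length a) - int (length b)"
    have "(\<Sum>n\<in>F. cmp n (c \<cdot> (pth v a * st (pth v' b)))) = c \<cdot> (pth v a * st (pth v' b))"
      if "finite F" "{?d} \<subseteq> F" for F
    proof -
      have "(\<Sum>n\<in>F. cmp n (c \<cdot> (pth v a * st (pth v' b)))) =
        (\<Sum>n\<in>F. if n = ?d then c \<cdot> (pth v a * st (pth v' b)) else 0)"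
        by (intro sum.cong) (simp_all add: cmp_sc cmp_monomial)
      thus ?thesis using that by (simp add: sum.delta)
    qed
    thus ?case by (intro exI[of _ "{?d}"]) simp
  qed auto
  then obtain G where "finite G" "(\<Sum>n\<in>G. cmp n x) = x" by blast
  thus ?thesis using assms(2) by simp
qed

end

section \<open>Corners at linear vertices and frames\<close>

text \<open>Extends a rule for a product of two factors to the inside of right-nested products; used
  through \<open>THEN\<close> wherever \<open>mult.assoc\<close> is the normal form.\<close>

lemma mult_eq_assoc: "a * b = c \<Longrightarrow> a * (b * x) = c * x" for a :: "'a::semigroup_mult"
  by (simp add: mult.assoc[symmetric])

context leavitt
begin

text \<open>At a linear vertex with an edge the relation \<open>ck2\<close> has a single summand, so
  paths become invertible from both sides.\<close>

lemma pth_st_pth_linear: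
  "linear_vertex E w \<Longrightarrow> vpath E w a \<Longrightarrow> pth w a * st (pth w a) = vt w"
proof (induction a arbitrary: w)
  case Nil thus ?case by (simp add: st_vt vt_vt)
next
  case (Cons e a)
  have e: "e \<in> edges E" "src E e = w" "vpath E (rng E e) a" using Cons.prems by auto
  have em: "emits E w = {e}" by (rule linear_vertex_emits) (use Cons.prems e in auto)
  hence reg: "vt w = ed e * st (ed e)"
    using ck2[of w] e wf by (auto simp: regular_vertex_def)
  have "linear_vertex E (rng E e)"
    using linear_vertex_end[OF wf Cons.prems(1), of "[e]"] e wf by auto
  hence "pth (rng E e) a * st (pth (rng E e) a) = vt (rng E e)" using Cons.IH e by blast
  note F = this[THEN mult_eq_assoc]
  show ?case using e by (simp add: st_mult mult.assoc F rng_st_ed reg)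
qed

text \<open>A homogeneous partial isometry of degree n with range projection \<open>vt w\<close> and
  source projection \<open>vt w'\<close>; multiplying by it moves elements between the two corners
  without loss.\<close>

definition unitary :: "'v \<Rightarrow> 'v \<Rightarrow> int \<Rightarrow> 'a \<Rightarrow> bool" where
  "unitary w w' n g \<longleftrightarrow> g \<in> A \<and> g * st g = vt w \<and> st g * g = vt w' \<and> cmp n g = g \<and>
     vt w * g = g \<and> g * vt w' = g"

lemma unitary_monomial:
  assumes "linear_vertex E w" "linear_vertex E w'" "vpath E w a" "vpath E w' b"
    "endv E w a = endv E w' b"
  shows "unitary w w' (int (length a) - int (length b)) (pth w a * st (pth w' b))"
proof -
  define z where "z = endv E w a"
  have z: "endv E w' b = z" using assms(5) z_def by simp
  note F = st_pth_pth[OF assms(3), folded z_def] st_pth_pth[OF assms(4), unfolded z]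
    pth_st_pth_linear[OF assms(1,3)] pth_st_pth_linear[OF assms(2,4)]
    vt_pth[OF assms(3)] vt_pth[OF assms(4)] pth_vt[OF assms(3), folded z_def] pth_vt[OF assms(4), unfolded z]
  have "vt z * st (pth w a) = st (pth w a)" "vt z * st (pth w' b) = st (pth w' b)"
    "st (pth w' b) * vt w' = st (pth w' b)"
    using F(6-8) by (metis st_mult st_vt)+
  note F = F this
  note F = F F[THEN mult_eq_assoc]
  show ?thesis using A_mono1[OF assms(3-5)]
    by (auto simp: unitary_def cmp_monomial mult.assoc st_mult st_st F)
qed

text \<open>By uniqueness of paths the longer pair extends the shorter one, equality of degrees
  makes both extensions the same path c, and \<open>pth z c * st (pth z c) = vt z\<close> cancels
  it.\<close>

lemma linear_monomial_eq:
  assumes "linear_vertex E w" "linear_vertex E w'" "vpath E w a" "vpath E w' b" "endv E w a = endv E w' b"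
    and "vpath E w a'" "vpath E w' b'" "endv E w a' = endv E w' b'"
    and "int (length a) - int (length b) = int (length a') - int (length b')"
    and le: "length a \<le> length a'"
  shows "pth w a' * st (pth w' b') = pth w a * st (pth w' b)"
proof -
  obtain c where c: "a' = a @ c" using linear_vertex_unique_path[OF wf] assms by blast
  have "length b \<le> length b'" using assms(9) le by linarith
  then obtain c' where c': "b' = b @ c'" using linear_vertex_unique_path[OF wf] assms by blast
  define z where "z = endv E w a"
  have z: "endv E w' b = z" "linear_vertex E z" using assms linear_vertex_end[OF wf] z_def by auto
  have v: "vpath E z c" "vpath E z c'" using assms c c' z z_def by (auto simp: vpath_append wf)
  have "length c = length c'" using assms(9) c c' by simp
  moreover obtain d where "c' = c @ d"
    using linear_vertex_unique_path[OF wf z(2) v] calculation by auto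
  ultimately have cc: "c' = c" by simp
  note F = pth_st_pth_linear[OF z(2) v(1), THEN mult_eq_assoc]
  have "vt z * st (pth w' b) = st (pth w' b)" using pth_vt[OF assms(4)] z by (metis st_mult st_vt)
  thus ?thesis using assms(6,7) z
    by (simp add: c c' cc pth_append st_mult mult.assoc F z_def[symmetric])
qed

text \<open>All monomials of degree n from w to w' coincide, so a component between linear vertices
  is zero or the line spanned by one unitary.\<close>

lemma linear_hom:
  assumes w: "linear_vertex E w" "linear_vertex E w'"
    and x: "x \<in> A" "vt w * x = x" "x * vt w' = x" "cmp n x = x" "x \<noteq> 0"
  obtains l g where "l \<noteq> 0" "unitary w w' n g" "x = l \<cdot> g"
proof -
  define M where "M = {(a, b). vpath E w a \<and> vpath E w' b \<and> endv E w a = endv E w' b \<and>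
    int (length a) - int (length b) = n}"
  obtain g where g: "\<And>a b. (a, b) \<in> M \<Longrightarrow> pth w a * st (pth w' b) = g"
    "M \<noteq> {} \<Longrightarrow> unitary w w' n g"
  proof (cases "M = {}")
    case False
    then obtain a b where ab: "(a, b) \<in> M" by auto
    have eq: "pth w a' * st (pth w' b') = pth w a * st (pth w' b)" if "(a', b') \<in> M" for a' b'
      using linear_monomial_eq[OF w, of a b a' b'] linear_monomial_eq[OF w, of a' b' a b] that ab
      by (cases "length a \<le> length a'") (auto simp: M_def)
    have "unitary w w' n (pth w a * st (pth w' b))"
      using unitary_monomial[OF w, of a b] ab by (auto simp: M_def)
    thus thesis using that eq by blast
  qed (use that in auto)
  have wv: "w \<in> verts E" "w' \<in> verts E" using w by (auto simp: linear_vertex_def)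
  \<comment> \<open>The claim is made for the compression of an arbitrary y, because the conditions
    on x do not pass to the summands in an induction over \<open>A\<close>. If M is empty, g is
    arbitrary and l must be 0.\<close>
  have "\<exists>l. cmp n (vt w * y * vt w') = l \<cdot> g \<and> (M = {} \<longrightarrow> l = 0)" if "y \<in> A" for y
    using that
  proof (induction rule: A.induct)
    case zero show ?case by (rule exI[of _ 0]) simp
  next
    case (add x y)
    then obtain l k where "cmp n (vt w * x * vt w') = l \<cdot> g" "cmp n (vt w * y * vt w') = k \<cdot> g"
      "M = {} \<longrightarrow> l = 0" "M = {} \<longrightarrow> k = 0" by blast
    thus ?case by (intro exI[of _ "l + k"]) (simp add: distrib_left distrib_right cmp_add sc_add_left)
  next
    case (mono u a u' b c)
    have 1: "vt w * pth u a = (if u = w then pth u a else 0)"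
      using mono wv by (auto simp: vt_pth vt_pth_other)
    have "vt w' * pth u' b = (if u' = w' then pth u' b else 0)"
      using mono wv by (auto simp: vt_pth vt_pth_other)
    from arg_cong[OF this, of st] have 2: "st (pth u' b) * vt w' = (if u' = w' then st (pth u' b) else 0)"
      by (auto simp: st_mult st_vt)
    have "vt w * (c \<cdot> (pth u a * st (pth u' b))) * vt w' =
      c \<cdot> ((vt w * pth u a) * (st (pth u' b) * vt w'))"
      by (simp add: sc_mult_left sc_mult_right mult.assoc)
    also have "\<dots> = (if u = w \<and> u' = w' then c \<cdot> (pth w a * st (pth w' b)) else 0)"
      unfolding 1 2 by simp
    finally have 3: "cmp n (vt w * (c \<cdot> (pth u a * st (pth u' b))) * vt w') =
      (if u = w \<and> u' = w' \<and> n = int (length a) - int (length b)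
       then c \<cdot> (pth w a * st (pth w' b)) else 0)" by (simp add: cmp_sc cmp_monomial)
    show ?case
    proof (cases "u = w \<and> u' = w' \<and> n = int (length a) - int (length b)")
      case True
      hence "(a, b) \<in> M" using mono by (auto simp: M_def)
      moreover from this have "M \<noteq> {}" by blast
      ultimately show ?thesis using 3 True g(1) by auto
    next
      case False
      show ?thesis unfolding 3 using False by (intro exI[of _ 0]) auto
    qed
  qed
  from this[OF x(1)] obtain l where l: "x = l \<cdot> g" "M = {} \<Longrightarrow> l = 0" using x by auto
  show thesis using that[of l g] g(2) l x(5) by fastforce
qed

lemma vt_cmp: "vt w * x = x \<Longrightarrow> vt w * cmp n x = cmp n x"
  using cmp_hom_mult[OF cmp_vt, of n w x] by simp

lemma cmp_vt_right: "x * vt w = x \<Longrightarrow> cmp n x * vt w = cmp n x"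
  using cmp_mult_hom[OF cmp_vt, of n x w] by simp

lemma cmp_linear_hom:
  assumes w: "linear_vertex E w" "linear_vertex E w'"
    and x: "x \<in> A" "vt w * x = x" "x * vt w' = x" "cmp n x \<noteq> 0"
  obtains l g where "l \<noteq> 0" "unitary w w' n g" "cmp n x = l \<cdot> g"
proof (rule linear_hom[OF w])
  show "cmp n x \<in> A" "vt w * cmp n x = cmp n x" "cmp n x * vt w' = cmp n x" "cmp n (cmp n x) = cmp n x"
    using x A_cmp vt_cmp cmp_vt_right by (simp_all add: cmp_cmp)
qed (use x that in auto)

section \<open>Degrees, width and division with remainder\<close>

definition top_deg :: "'a \<Rightarrow> int" where "top_deg x = Max {n. cmp n x \<noteq> 0}"
definition bot_deg :: "'a \<Rightarrow> int" where "bot_deg x = Min {n. cmp n x \<noteq> 0}"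
text \<open>The Euclidean size of a Laurent polynomial: the spread of its degrees, unchanged by
  multiplication with a unit. The values at 0 are meaningless, so 0 is always treated as a separate
  case.\<close>

definition width :: "'a \<Rightarrow> nat" where "width x = nat (top_deg x - bot_deg x)"

lemma support_nonempty: "x \<in> A \<Longrightarrow> x \<noteq> 0 \<Longrightarrow> {n. cmp n x \<noteq> 0} \<noteq> {}"
  using A_eq_0 by blast

lemma cmp_top_deg: "x \<in> A \<Longrightarrow> x \<noteq> 0 \<Longrightarrow> cmp (top_deg x) x \<noteq> 0"
  using Max_in[OF A_finite_support support_nonempty, of x] by (simp add: top_deg_def)

lemma cmp_bot_deg: "x \<in> A \<Longrightarrow> x \<noteq> 0 \<Longrightarrow> cmp (bot_deg x) x \<noteq> 0"
  using Min_in[OF A_finite_support support_nonempty, of x] by (simp add: bot_deg_def)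

lemma degree_bounds: "x \<in> A \<Longrightarrow> cmp n x \<noteq> 0 \<Longrightarrow> bot_deg x \<le> n \<and> n \<le> top_deg x"
  using A_finite_support[of x] by (simp add: top_deg_def bot_deg_def)

lemma top_deg_hom: "x \<noteq> 0 \<Longrightarrow> cmp n x = x \<Longrightarrow> top_deg x = n"
proof -
  assume "x \<noteq> 0" "cmp n x = x"
  hence "{m. cmp m x \<noteq> 0} = {n}" using hom_other by auto
  thus ?thesis by (simp add: top_deg_def)
qed

lemma A_sum_cmp: "x \<in> A \<Longrightarrow> x = (\<Sum>n | cmp n x \<noteq> 0. cmp n x)"
proof -
  assume x: "x \<in> A"
  let ?s = "\<Sum>n | cmp n x \<noteq> 0. cmp n x"
  have "cmp m ?s = cmp m x" for m
  proof -
    have "cmp m ?s = (\<Sum>n | cmp n x \<noteq> 0. if m = n then cmp n x else 0)" by (simp add: cmp_sum cmp_cmp)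
    also have "\<dots> = cmp m x" using A_finite_support[OF x] by (subst sum.delta') auto
    finally show ?thesis .
  qed
  moreover have "x - ?s \<in> A" using x by (intro A_diff A_sum A_cmp)
  ultimately have "x - ?s = 0" using A_eq_0[of "x - ?s"] by (simp add: cmp_diff)
  thus "x = ?s" by simp
qed

text \<open>The corner at w has no zero divisors: the top component of d is a nonzero multiple of a
  unitary, so its product with the top component of a nonzero x survives in
  \<open>d * x\<close>.\<close>

lemma left_cancel:
  assumes w: "linear_vertex E w" and d: "d \<in> A" "vt w * d = d" "d * vt w = d" "d \<noteq> 0"
    and x: "x \<in> A" "vt w * x = x" "d * x = 0"
  shows "x = 0"
proof (rule ccontr)
  assume x0: "x \<noteq> 0"
  let ?h = "top_deg d" and ?k = "top_deg x"
  let ?S = "{n. cmp n d \<noteq> 0}"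
  have "d * x = (\<Sum>n\<in>?S. cmp n d * x)" by (subst A_sum_cmp[OF d(1)]) (rule sum_distrib_right)
  hence "cmp (?h + ?k) (d * x) = (\<Sum>n\<in>?S. cmp n d * cmp (?h + ?k - n) x)"
    by (simp add: cmp_sum cmp_mult)
  also have "\<dots> = cmp ?h d * cmp ?k x + (\<Sum>n\<in>?S - {?h}. cmp n d * cmp (?h + ?k - n) x)"
    using A_finite_support[OF d(1)] cmp_top_deg[OF d(1,4)] by (subst sum.remove[of _ ?h]) auto
  also have "(\<Sum>n\<in>?S - {?h}. cmp n d * cmp (?h + ?k - n) x) = 0"
  proof (rule sum.neutral, rule ballI)
    fix n assume n: "n \<in> ?S - {?h}"
    hence "n < ?h" using degree_bounds[OF d(1), of n] by auto
    hence "cmp (?h + ?k - n) x = 0" using degree_bounds[OF x(1), of "?h + ?k - n"] by fastforce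
    thus "cmp n d * cmp (?h + ?k - n) x = 0" by simp
  qed
  finally have z: "cmp ?h d * cmp ?k x = 0" using x(3) by simp
  obtain l g where g: "l \<noteq> 0" "unitary w w ?h g" "cmp ?h d = l \<cdot> g"
    using cmp_linear_hom[OF w w d(1-3) cmp_top_deg[OF d(1,4)]] .
  have "g * cmp ?k x = 0" using z g by (simp add: sc_mult_left sc_eq_0_iff)
  hence "st g * (g * cmp ?k x) = 0" by simp
  hence "vt w * cmp ?k x = 0" using g(2) by (simp add: mult.assoc[symmetric] unitary_def)
  hence "cmp ?k x = 0" using vt_cmp[OF x(2)] by simp
  thus False using cmp_top_deg[OF x(1) x0] by simp
qed

text \<open>One step of long division, cancelling the top component. The quotient is homogeneous,
  which is what later keeps the graded case inside homogeneous elements.\<close>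

lemma division_step:
  assumes w: "linear_vertex E w" "linear_vertex E w'"
    and a: "a \<in> A" "vt w * a = a" "a * vt w' = a" "a \<noteq> 0"
    and b: "b \<in> A" "vt w * b = b" "b * vt w' = b" "b \<noteq> 0"
    and le: "width b \<le> width a"
  obtains q where "q \<in> A" "cmp (top_deg a - top_deg b) q = q" "vt w * q = q" "q * vt w = q"
    "a - q * b = 0 \<or> width (a - q * b) < width a"
proof -
  let ?h = "top_deg a" and ?k = "top_deg b"
  obtain l g where g: "l \<noteq> 0" "unitary w w' ?h g" "cmp ?h a = l \<cdot> g"
    using cmp_linear_hom[OF w a(1-3) cmp_top_deg[OF a(1,4)]] .
  obtain k f where f: "k \<noteq> 0" "unitary w w' ?k f" "cmp ?k b = k \<cdot> f"
    using cmp_linear_hom[OF w b(1-3) cmp_top_deg[OF b(1,4)]] .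
  have g': "g \<in> A" "cmp ?h g = g" "vt w * g = g" "g * vt w' = g" using g(2) by (auto simp: unitary_def)
  have f': "f \<in> A" "st f * f = vt w'" "cmp ?k f = f" "vt w * f = f" using f(2) by (auto simp: unitary_def)
  \<comment> \<open>With \<open>st f * f = vt w'\<close> this q sends the top component of b exactly
    to that of a.\<close>
  define q where "q = (l / k) \<cdot> (g * st f)"
  have qA: "q \<in> A" using g' f' by (simp add: q_def A_mult A_st A_sc)
  have "cmp (?h - ?k) (g * st f) = g * st f"
    using hom_mult[OF g'(2) hom_st[OF f'(3)]] by simp
  hence qh: "cmp (?h - ?k) q = q" by (simp add: q_def cmp_sc)
  have qw: "vt w * q = q" "q * vt w = q"
  proof -
    have "st f * vt w = st f" using f'(4) by (metis st_mult st_vt)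
    thus "q * vt w = q" by (simp add: q_def sc_mult_left mult.assoc)
    show "vt w * q = q" using g'(3) by (simp add: q_def sc_mult_right mult.assoc[symmetric])
  qed
  have top: "q * cmp ?k b = cmp ?h a"
    using g f g' f' by (simp add: q_def sc_mult_left sc_mult_right sc_sc mult.assoc)
  let ?r = "a - q * b"
  have rA: "?r \<in> A" using a b qA by (simp add: A_diff A_mult)
  have cr: "cmp n ?r = cmp n a - q * cmp (n - (?h - ?k)) b" for n
    using cmp_hom_mult[OF qh] by (simp add: cmp_diff)
  have "width ?r < width a" if r0: "?r \<noteq> 0"
  proof -
    have wa: "bot_deg a \<le> ?h" "bot_deg b \<le> ?k"
      using degree_bounds[OF a(1) cmp_top_deg[OF a(1,4)]] degree_bounds[OF b(1) cmp_top_deg[OF b(1,4)]] by auto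
    have bd: "bot_deg a \<le> n \<and> n < ?h" if n: "cmp n ?r \<noteq> 0" for n
    proof -
      have "n \<noteq> ?h" using n cr[of ?h] top by auto
      moreover have "n \<le> ?h"
      proof (rule ccontr)
        assume "\<not> n \<le> ?h"
        hence "cmp n a = 0" "cmp (n - (?h - ?k)) b = 0"
          using degree_bounds[OF a(1), of n] degree_bounds[OF b(1), of "n - (?h - ?k)"] by fastforce+
        thus False using n cr[of n] by simp
      qed
      moreover have "bot_deg a \<le> n"
      proof (rule ccontr)
        assume n': "\<not> bot_deg a \<le> n"
        \<comment> \<open>Here the comparison of widths enters: once the tops are aligned, b reaches
          no lower than a.\<close>
        hence "n - (?h - ?k) < bot_deg b" using le wa by (simp add: width_def)
        hence "cmp n a = 0" "cmp (n - (?h - ?k)) b = 0"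
          using n' degree_bounds[OF a(1), of n] degree_bounds[OF b(1), of "n - (?h - ?k)"] by fastforce+
        thus False using n cr[of n] by simp
      qed
      ultimately show ?thesis by auto
    qed
    from bd[OF cmp_top_deg[OF rA r0]] bd[OF cmp_bot_deg[OF rA r0]]
      degree_bounds[OF rA cmp_top_deg[OF rA r0]]
    show ?thesis by (simp add: width_def)
  qed
  thus thesis using that[OF qA qh qw] by blast
qed

text \<open>Adding summands one at a time supplies the induction for annihilators. The summands m
  act as matrix coordinates; \<open>u * m = 0\<close> makes them orthogonal, and their homogeneity
  puts the sum in degree 0.\<close>

inductive frame :: "'a \<Rightarrow> bool" where
  zero: "frame 0"
| add: "frame u \<Longrightarrow> linear_vertex E w \<Longrightarrow> m \<in> A \<Longrightarrow> st m * m = vt w \<Longrightarrow> m * vt w = m \<Longrightarrow>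
    cmp n m = m \<Longrightarrow> u * m = 0 \<Longrightarrow> frame (m * st m + u)"

lemma frame_props:
  assumes "frame u"
  shows "u \<in> A" "st u = u" "u * u = u" "cmp 0 u = u"
proof -
  from assms have "u \<in> A \<and> st u = u \<and> u * u = u \<and> cmp 0 u = u"
  proof (induction rule: frame.induct)
    case (add u w m n)
    have "st m * u = 0" using add by (metis st_mult st_zero)
    note F = this add(4,5,7) this[THEN mult_eq_assoc] add(4,5,7)[THEN mult_eq_assoc]
    have "(m * st m + u) * (m * st m + u) = m * st m + u"
      using add.IH by (simp add: distrib_left distrib_right mult.assoc F)
    moreover have "cmp 0 (m * st m) = m * st m" using hom_mult[OF add(6) hom_st[OF add(6)]] by simp
    ultimately show ?case using add
      by (auto simp: A_mult A_st A.add st_add st_mult st_st cmp_add)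
  qed (auto intro: A.zero)
  thus "u \<in> A" "st u = u" "u * u = u" "cmp 0 u = u" by auto
qed

lemma frame_add_mult:
  assumes "frame u" "st m * m = vt w" "m * vt w = m" "u * m = 0"
  shows "(m * st m + u) * m = m" "u * (m * st m + u) = u" "(m * st m + u) * u = u" "st m * u = 0"
proof -
  show z: "st m * u = 0" using assms frame_props by (metis st_mult st_zero)
  show "(m * st m + u) * m = m" using assms by (simp add: distrib_right mult.assoc)
  show "u * (m * st m + u) = u"
    using frame_props(3)[OF assms(1)] assms(4) by (simp add: distrib_left mult.assoc[symmetric])
  show "(m * st m + u) * u = u"
    using frame_props(3)[OF assms(1)] z by (simp add: distrib_right mult.assoc)
qed

lemma frame_plus: "frame u \<Longrightarrow> frame u' \<Longrightarrow> u * u' = 0 \<Longrightarrow> frame (u + u')"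
proof (induction rule: frame.induct)
  case (add u w m n)
  note F = frame_add_mult[OF add(1,4,5,7)]
  have "u * u' = (u * (m * st m + u)) * u'" by (simp add: F)
  hence "u * u' = 0" using add.prems by (simp add: mult.assoc)
  hence f: "frame (u + u')" using add by blast
  have "u' * (m * st m + u) = 0"
    using add.prems frame_props(2)[OF add.prems(1)] frame_props(2)[OF frame.add[OF add(1-7)]]
    by (metis st_mult st_zero)
  hence "u' * m = 0" using F(1) by (metis mult.assoc mult_zero_left)
  hence "frame (m * st m + (u + u'))" using add f by (intro frame.add) (auto simp: distrib_right)
  thus ?case by (simp add: add.assoc)
qed simp

lemma frame_sum:
  assumes "finite F" "\<And>i. i \<in> F \<Longrightarrow> frame (f i)" "\<And>i j. i \<in> F \<Longrightarrow> j \<in> F \<Longrightarrow> i \<noteq> j \<Longrightarrow> f i * f j = 0"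
  shows "frame (sum f F)"
  using assms
proof (induction F rule: finite_induct)
  case (insert x F)
  have "f x * sum f F = 0" unfolding sum_distrib_left
    by (rule sum.neutral) (use insert in auto)
  thus ?case using insert by (auto intro: frame_plus)
qed (simp add: frame.zero)

text \<open>Every summand m of u is replaced by \<open>ed e * m\<close>; nothing is lost because
  \<open>st (ed e) * ed e = vt (rng E e)\<close> fixes m.\<close>

lemma frame_edge:
  "frame u \<Longrightarrow> e \<in> edges E \<Longrightarrow> vt (rng E e) * u = u \<Longrightarrow> frame (ed e * u * st (ed e))"
proof (induction rule: frame.induct)
  case (add u w m n)
  note F = frame_add_mult[OF add(1,4,5,7)]
  have rm: "vt (rng E e) * m = m" using F(1) add.prems by (metis mult.assoc)
  have ru: "vt (rng E e) * u = u" using F(3) add.prems by (metis mult.assoc)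
  hence f: "frame (ed e * u * st (ed e))" using add by blast
  have g: "st (ed e) * ed e = vt (rng E e)" using add.prems by (simp add: ghost_ed)
  note G = g[THEN mult_eq_assoc] rm
  have "frame ((ed e * m) * st (ed e * m) + ed e * u * st (ed e))"
  proof (rule frame.add[OF f add(2)])
    show "ed e * m \<in> A" using add by (simp add: A_ed_mult)
    show "st (ed e * m) * (ed e * m) = vt w" using add by (simp add: st_mult mult.assoc G)
    show "ed e * m * vt w = ed e * m" using add by (simp add: mult.assoc)
    show "cmp (1 + n) (ed e * m) = ed e * m" by (rule hom_mult[OF cmp_ed add(6)])
    show "ed e * u * st (ed e) * (ed e * m) = 0" using add by (simp add: mult.assoc G)
  qed
  thus ?case by (simp add: distrib_left distrib_right st_mult mult.assoc)
qed (simp add: frame.zero)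

text \<open>Well-founded induction along \<open>graph_cond_wf\<close>. A non-linear vertex is not a
  sink, hence regular, and \<open>ck2\<close> splits it into the orthogonal pieces that come from
  the ranges of its edges.\<close>

lemma frame_vt:
  assumes "graph_cond E" "v \<in> verts E"
  shows "frame (vt v)"
  using graph_cond_wf[OF wf assms(1)] assms(2)
proof (induction v rule: wf_induct_rule)
  case (less v)
  show ?case
  proof (cases "linear_vertex E v")
    case True
    have "frame (vt v * st (vt v) + 0)"
      by (rule frame.add[OF frame.zero True, of _ 0]) (use less.prems in \<open>auto simp: A_vt st_vt vt_vt cmp_vt\<close>)
    thus ?thesis using less.prems by (simp add: st_vt vt_vt)
  next
    case False
    hence reg: "regular_vertex E v"
      using assms(1) less.prems linear_vertexI_sink[of E v] by (auto simp: graph_cond_def row_finite_def)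
    have "frame (\<Sum>e\<in>emits E v. ed e * st (ed e))"
    proof (rule frame_sum)
      show "finite (emits E v)" using reg by (simp add: regular_vertex_def)
      fix e assume e: "e \<in> emits E v"
      hence "frame (vt (rng E e))"
        using False by (intro less.IH) (auto simp: emits_def wf)
      hence "frame (ed e * vt (rng E e) * st (ed e))"
        using e wf by (intro frame_edge) (auto simp: emits_def vt_vt)
      thus "frame (ed e * st (ed e))" using e by (simp add: ed_rng emits_def)
    next
      fix e f assume "e \<in> emits E v" "f \<in> emits E v" "e \<noteq> f"
      hence "st (ed e) * ed f = 0" by (auto simp: emits_def ghost_ed)
      thus "ed e * st (ed e) * (ed f * st (ed f)) = 0"
        by (simp add: mult.assoc mult_eq_assoc)
    qed
    thus ?thesis using ck2[OF less.prems reg] by simp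
  qed
qed

section \<open>Local units\<close>

definition local_unit :: "'v set \<Rightarrow> 'a" where "local_unit F = (\<Sum>v\<in>F. vt v)"

lemma vt_local_unit:
  assumes "finite F" "F \<subseteq> verts E" "v \<in> verts E"
  shows "vt v * local_unit F = (if v \<in> F then vt v else 0)"
    "local_unit F * vt v = (if v \<in> F then vt v else 0)"
proof -
  have "vt v * local_unit F = (\<Sum>u\<in>F. if v = u then vt u else 0)"
    unfolding local_unit_def sum_distrib_left by (rule sum.cong) (use assms vt_vt in auto)
  thus "vt v * local_unit F = (if v \<in> F then vt v else 0)" using assms by simp
  have "local_unit F * vt v = (\<Sum>u\<in>F. if u = v then vt u else 0)"
    unfolding local_unit_def sum_distrib_right by (rule sum.cong) (use assms vt_vt in auto)
  thus "local_unit F * vt v = (if v \<in> F then vt v else 0)" using assms by simp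
qed

lemma st_local_unit: "st (local_unit F) = local_unit F"
  unfolding local_unit_def
  by (induction F rule: infinite_finite_induct) (auto simp: st_add st_vt)

lemma frame_local_unit:
  assumes "graph_cond E" "finite F" "F \<subseteq> verts E" shows "frame (local_unit F)"
  unfolding local_unit_def by (rule frame_sum) (use assms frame_vt in \<open>auto simp: vt_vt subset_iff\<close>)

text \<open>Stated for all finite vertex sets above G so that the units of two summands can be
  merged by taking the union.\<close>

lemma local_unit_exists:
  assumes "x \<in> A"
  shows "\<exists>G. finite G \<and> G \<subseteq> verts E \<and>
    (\<forall>F. finite F \<longrightarrow> G \<subseteq> F \<longrightarrow> F \<subseteq> verts E \<longrightarrow> local_unit F * x = x \<and> x * local_unit F = x)"
  using assms
proof (induction rule: A.induct)
  case (add x y)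
  then obtain G H where "finite G" "G \<subseteq> verts E"
    "\<forall>F. finite F \<longrightarrow> G \<subseteq> F \<longrightarrow> F \<subseteq> verts E \<longrightarrow> local_unit F * x = x \<and> x * local_unit F = x"
    "finite H" "H \<subseteq> verts E"
    "\<forall>F. finite F \<longrightarrow> H \<subseteq> F \<longrightarrow> F \<subseteq> verts E \<longrightarrow> local_unit F * y = y \<and> y * local_unit F = y"
    by blast
  thus ?case by (intro exI[of _ "G \<union> H"]) (simp add: distrib_left distrib_right)
next
  case (mono v a v' b c)
  have v: "v \<in> verts E" "v' \<in> verts E" using mono vpath_start[OF wf] by auto
  have "local_unit F * (c \<cdot> (pth v a * st (pth v' b))) = c \<cdot> (pth v a * st (pth v' b)) \<and>
      c \<cdot> (pth v a * st (pth v' b)) * local_unit F = c \<cdot> (pth v a * st (pth v' b))"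
    if F: "finite F" "{v, v'} \<subseteq> F" "F \<subseteq> verts E" for F
  proof -
    have "local_unit F * pth u p = pth u p" if "vpath E u p" "u \<in> F" for u p
    proof -
      have "local_unit F * (vt u * pth u p) = vt u * pth u p"
        using F that by (simp add: mult.assoc[symmetric] vt_local_unit subsetD)
      thus ?thesis using that by (simp add: vt_pth)
    qed
    hence 1: "local_unit F * pth v a = pth v a" and "local_unit F * pth v' b = pth v' b"
      using F mono by auto
    hence 2: "st (pth v' b) * local_unit F = st (pth v' b)" by (metis st_mult st_local_unit)
    show ?thesis using 1 2 by (simp add: sc_mult_left sc_mult_right mult.assoc mult_eq_assoc)
  qed
  thus ?case using v by (intro exI[of _ "{v, v'}"]) simp
qed auto

section \<open>Annihilators of sets\<close>

lemma nonzero_unitary: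
  assumes w: "linear_vertex E w" "linear_vertex E w'"
    and x: "x \<in> A" "vt w * x = x" "x * vt w' = x" "x \<noteq> 0"
  obtains n g where "unitary w w' n g"
  using cmp_linear_hom[OF w x(1-3) cmp_top_deg[OF x(1,4)]] that by blast

lemma mult_nonzero_unitary:
  assumes w: "linear_vertex E w" "linear_vertex E w'"
    and y: "y \<in> A" "vt w * y = y" and m: "m \<in> A" "m * vt w' = m" and nz: "y * m \<noteq> 0"
  obtains n g where "unitary w w' n g"
proof (rule nonzero_unitary[OF w])
  show "y * m \<in> A" "vt w * (y * m) = y * m" "y * m * vt w' = y * m"
    using y m by (simp_all add: A_mult mult.assoc y(2)[THEN mult_eq_assoc])
qed (use nz that in auto)

lemma hom_mult_unitary:
  assumes w: "linear_vertex E w" "linear_vertex E w'"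
    and y: "y \<in> A" "vt w * y = y" "cmp n y = y"
    and m: "m \<in> A" "m * vt w' = m" "cmp k m = m" and nz: "y * m \<noteq> 0"
  obtains l g where "l \<noteq> 0" "unitary w w' (n + k) g" "y * m = l \<cdot> g"
proof (rule linear_hom[OF w])
  show "y * m \<in> A" "vt w * (y * m) = y * m" "y * m * vt w' = y * m" "cmp (n + k) (y * m) = y * m"
    using y m by (simp_all add: A_mult hom_mult mult.assoc y(2)[THEN mult_eq_assoc])
qed (use nz that in auto)

lemma unitary_st_vt: "unitary w w' n g \<Longrightarrow> st g * vt w = st g"
  unfolding unitary_def by (metis st_mult st_vt)

text \<open>If y vanishes on every coordinate m, it vanishes on u, which is a sum of elements
  \<open>m * st m\<close>.\<close>

lemma frame_nonzero:
  assumes "frame u" "y * u \<noteq> 0"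
  obtains m n w' where "linear_vertex E w'" "m \<in> A" "st m * m = vt w'" "m * vt w' = m"
    "cmp n m = m" "u * m = m" "y * m \<noteq> 0"
proof -
  from assms have "\<exists>w' m n. linear_vertex E w' \<and> m \<in> A \<and> st m * m = vt w' \<and> m * vt w' = m \<and>
    cmp n m = m \<and> u * m = m \<and> y * m \<noteq> 0"
  proof (induction rule: frame.induct)
    case (add u w m n)
    note F = frame_add_mult[OF add(1,4,5,7)]
    show ?case
    proof (cases "y * m = 0")
      case True
      hence "y * u \<noteq> 0" using add.prems by (simp add: distrib_left mult.assoc[symmetric])
      then obtain w' m' n' where m': "linear_vertex E w'" "m' \<in> A" "st m' * m' = vt w'" "m' * vt w' = m'"
        "cmp n' m' = m'" "u * m' = m'" "y * m' \<noteq> 0" using add.IH by blast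
      have "(m * st m + u) * m' = m'" using F(3) m'(6) by (metis mult.assoc)
      thus ?thesis using m' by blast
    next
      case False
      thus ?thesis using add F(1) by blast
    qed
  qed simp
  thus thesis using that by blast
qed

text \<open>The right ideal of the corner at \<open>w\<close> that is spanned by the values of \<open>y\<close> is principal,
  as the corner admits division with remainder; \<open>d\<close> is a generator of minimal width.\<close>

lemma gcd_factorization:
  assumes w: "linear_vertex E w" and u: "frame u"
    and y: "y \<in> A" "vt w * y = y" "y * u = y" "y \<noteq> 0"
  obtains d y' z where "d \<in> A" "vt w * d = d" "d * vt w = d" "d \<noteq> 0"
    "y' \<in> A" "vt w * y' = y'" "z \<in> A" "y = d * y'" "y' * z = vt w"
proof -
  have wv: "w \<in> verts E" using w by (simp add: linear_vertex_def)
  \<comment> \<open>Z collects the arguments z for which \<open>y * z\<close> is a nonzero element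
    of the corner at w; these values are the candidates for a generator.\<close>
  define Z where "Z = {z \<in> A. u * z = z \<and> z * vt w = z \<and> y * z \<noteq> 0}"
  obtain m n w' where m: "linear_vertex E w'" "m \<in> A" "st m * m = vt w'" "m * vt w' = m"
    "cmp n m = m" "u * m = m" "y * m \<noteq> 0" using frame_nonzero[OF u, of y, unfolded y(3), OF y(4)] .
  obtain n' g where g: "unitary w w' n' g"
    using mult_nonzero_unitary[OF w m(1) y(1,2) m(2,4,7)] .
  \<comment> \<open>A coordinate m at w' on which y does not vanish is moved to w by the unitary g,
    so Z is nonempty.\<close>
  have "y * (m * st g) \<noteq> 0"
  proof
    assume "y * (m * st g) = 0"
    hence "y * (m * st g) * g = 0" by simp
    hence "y * m = 0" using g m(4) by (simp add: unitary_def mult.assoc)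
    thus False using m(7) by simp
  qed
  hence "m * st g \<in> Z"
    using m(2,6) g unitary_st_vt[OF g] by (auto simp: Z_def unitary_def A_mult A_st mult.assoc[symmetric])
      (simp add: mult.assoc)
  \<comment> \<open>\<open>division_step\<close> divides on the left, while the values of y form a
    right ideal; hence widths are compared after applying \<open>st\<close>.\<close>
  then obtain z where zZ: "z \<in> Z" and zmin: "\<And>z'. z' \<in> Z \<Longrightarrow> width (st (y * z)) \<le> width (st (y * z'))"
    using ex_has_least_nat[of "\<lambda>z. z \<in> Z" "m * st g" "\<lambda>z. width (st (y * z))"] by blast
  define d where "d = y * z"
  have z: "z \<in> A" "u * z = z" "z * vt w = z" "d \<noteq> 0" using zZ by (auto simp: Z_def d_def)
  have d: "d \<in> A" "vt w * d = d" "d * vt w = d"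
    using z y by (auto simp: d_def A_mult mult.assoc[symmetric]) (simp add: mult.assoc)
  have "\<exists>a\<in>A. y * x = d * a" if "x \<in> A" "u * x = x" "x * vt w = x" for x
    using that
  proof (induction "width (st (y * x))" arbitrary: x rule: less_induct)
    case (less x)
    show ?case
    proof (cases "y * x = 0")
      case True thus ?thesis using A.zero by force
    next
      case False
      hence "x \<in> Z" using less.prems by (auto simp: Z_def)
      hence le: "width (st d) \<le> width (st (y * x))" using zmin d_def by simp
      have 1: "st (y * x) \<in> A" "vt w * st (y * x) = st (y * x)" "st (y * x) * vt w = st (y * x)" "st (y * x) \<noteq> 0"
        and 2: "st d \<in> A" "vt w * st d = st d" "st d * vt w = st d" "st d \<noteq> 0"
      proof -
        have "y * x * vt w = y * x" "vt w * (y * x) = y * x"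
          using less.prems y(2) by (simp_all add: mult.assoc y(2)[THEN mult_eq_assoc])
        thus "vt w * st (y * x) = st (y * x)" "st (y * x) * vt w = st (y * x)" by (metis st_mult st_vt)+
        show "vt w * st d = st d" "st d * vt w = st d" using d(2,3) by (metis st_mult st_vt)+
        show "st (y * x) \<in> A" "st d \<in> A" using d y less.prems by (auto intro: A_st A_mult)
      qed (use z False in \<open>auto simp: st_eq_0_iff\<close>)
      obtain q where q: "q \<in> A" "vt w * q = q" "q * vt w = q"
        "st (y * x) - q * st d = 0 \<or> width (st (y * x) - q * st d) < width (st (y * x))"
        using division_step[OF w w 1 2 le] by metis
      let ?x = "x - z * st q"
      have e: "st (y * x) - q * st d = st (y * ?x)"
        by (simp add: d_def st_diff st_mult st_st right_diff_distrib left_diff_distrib mult.assoc)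
      have "st q * vt w = st q" using q(2) by (metis st_mult st_vt)
      hence xp: "?x \<in> A" "u * ?x = ?x" "?x * vt w = ?x"
        using less.prems z q by (simp_all add: A_diff A_mult A_st right_diff_distrib left_diff_distrib mult.assoc z(2)[THEN mult_eq_assoc] q(3)[THEN mult_eq_assoc] z(3)[THEN mult_eq_assoc])
      have "\<exists>a\<in>A. y * ?x = d * a"
      proof (cases "st (y * ?x) = 0")
        case True
        hence "y * ?x = d * 0" by (simp add: st_eq_0_iff)
        thus ?thesis using A.zero by blast
      next
        case False
        hence "width (st (y * ?x)) < width (st (y * x))" using q(4) e by simp
        thus ?thesis using less.hyps xp by blast
      qed
      then obtain a where a: "a \<in> A" "y * ?x = d * a" by blast
      have "y * x = y * ?x + d * st q" by (simp add: d_def right_diff_distrib mult.assoc)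
      also have "\<dots> = d * (a + st q)" using a by (simp add: distrib_left)
      finally show ?thesis using a q by (metis A.add A_st)
    qed
  qed
  note ideal = this
  \<comment> \<open>The factorization through d is assembled coordinate by coordinate. A coordinate
    \<open>y * m\<close> lies between w and w'; it is moved into the corner at w by
    \<open>st g\<close>, divided by d there and moved back by g.\<close>
  have "\<exists>y'\<in>A. vt w * y' = y' \<and> y * f = d * y'" if "frame f" "u * f = f" for f
    using that
  proof (induction rule: frame.induct)
    case zero thus ?case using A.zero by (intro bexI[of _ 0]) auto
  next
    case (add f w' m n)
    note F = frame_add_mult[OF add(1,4,5,7)]
    have um: "u * m = m" using F(1) add.prems by (metis mult.assoc)
    have uf: "u * f = f" using F(3) add.prems by (metis mult.assoc)
    then obtain y1 where y1: "y1 \<in> A" "vt w * y1 = y1" "y * f = d * y1" using add by blast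
    have "\<exists>y2\<in>A. vt w * y2 = y2 \<and> y * m = d * y2"
    proof (cases "y * m = 0")
      case True thus ?thesis using A.zero by (intro bexI[of _ 0]) auto
    next
      case False
      obtain n' g where g: "unitary w w' n' g"
        using mult_nonzero_unitary[OF w add(2) y(1,2) add(3,5) False] .
      have "\<exists>a\<in>A. y * (m * st g) = d * a"
        using add(3) um g unitary_st_vt[OF g]
        by (intro ideal) (auto simp: unitary_def A_mult A_st mult.assoc um[THEN mult_eq_assoc])
      then obtain a where a: "a \<in> A" "y * (m * st g) = d * a" by blast
      have "y * m = y * (m * st g) * g" using g add(5) by (simp add: unitary_def mult.assoc)
      also have "\<dots> = d * (vt w * (a * g))" using a by (simp add: mult.assoc d(3)[THEN mult_eq_assoc])
      finally have "y * m = d * (vt w * (a * g))" .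
      moreover have "vt w * (a * g) \<in> A" using a g wv by (simp add: A_mult A_vt_mult unitary_def)
      ultimately show ?thesis using wv by (metis vt_idem mult.assoc)
    qed
    then obtain y2 where y2: "y2 \<in> A" "vt w * y2 = y2" "y * m = d * y2" by blast
    have "y * (m * st m + f) = d * (y2 * st m + y1)"
      using y1 y2 by (simp add: distrib_left mult.assoc[symmetric])
    moreover have "vt w * (y2 * st m + y1) = y2 * st m + y1"
      using y1 y2 by (simp add: distrib_left mult.assoc[symmetric])
    moreover have "y2 * st m + y1 \<in> A" using y1 y2 add(3) by (simp add: A.add A_mult A_st)
    ultimately show ?case by blast
  qed
  from this[OF u frame_props(3)[OF u]] y(3) obtain y' where
    y': "y' \<in> A" "vt w * y' = y'" "y = d * y'" by auto
  \<comment> \<open>Both sides equal \<open>y * z\<close>. Cancelling d turns the minimal value into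
    a right inverse of y'.\<close>
  have "d * (y' * z) = d" using y'(3) d_def by (metis mult.assoc)
  hence "d * (y' * z - vt w) = 0" using d(3) by (simp add: right_diff_distrib)
  moreover have "y' * z - vt w \<in> A" "vt w * (y' * z - vt w) = y' * z - vt w"
    using y' z wv by (auto simp: A_diff A_mult A_vt right_diff_distrib vt_idem mult.assoc[symmetric])
  ultimately have "y' * z - vt w = 0" using left_cancel[OF w d z(4)] by blast
  thus thesis using that[OF d z(4) y'(1,2) z(1) y'(3)] by simp
qed

text \<open>A nonzero coordinate \<open>y * m\<close> is \<open>l \<cdot> g\<close> with g unitary
  and contributes \<open>l * \<sigma> l\<close> to the norm. As ks lists only nonzero scalars, it
  can consist of zeros only if it is empty, when every coordinate vanishes. This is the shape that
  \<open>positive_definite\<close> speaks about.\<close>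

lemma frame_norm:
  assumes "frame f" and w: "linear_vertex E w" and y: "y \<in> A" "vt w * y = y" "cmp n y = y"
  shows "\<exists>ks. y * f * st y = (\<Sum>k\<leftarrow>ks. k * \<sigma> k) \<cdot> vt w \<and> ((\<forall>k\<in>set ks. k = 0) \<longrightarrow> y * f = 0)"
  using assms(1)
proof (induction rule: frame.induct)
  case zero show ?case by (rule exI[of _ "[]"]) simp
next
  case (add f w' m k)
  then obtain ks where ks: "y * f * st y = (\<Sum>k\<leftarrow>ks. k * \<sigma> k) \<cdot> vt w"
    "(\<forall>k\<in>set ks. k = 0) \<longrightarrow> y * f = 0" by blast
  have e: "y * (m * st m + f) * st y = (y * m) * st (y * m) + y * f * st y"
    by (simp add: distrib_left distrib_right st_mult mult.assoc)
  show ?case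
  proof (cases "y * m = 0")
    case True
    have "y * (m * st m + f) = y * f" using True by (simp add: distrib_left mult.assoc[symmetric])
    thus ?thesis using ks by auto
  next
    case False
    obtain l g where g: "l \<noteq> 0" "unitary w w' (n + k) g" "y * m = l \<cdot> g"
      using hom_mult_unitary[OF w add(2) y add(3,5,6) False] .
    have "(y * m) * st (y * m) = (l * \<sigma> l) \<cdot> vt w"
      using g by (simp add: unitary_def st_sc sc_mult_left sc_mult_right sc_sc mult.commute[of l])
    hence "y * (m * st m + f) * st y = (\<Sum>k\<leftarrow>l # ks. k * \<sigma> k) \<cdot> vt w"
      using e ks by (simp add: sc_add_left)
    thus ?thesis using g(1) by (intro exI[of _ "l # ks"]) simp
  qed
qed

text \<open>The flags select the version of the theorem: \<open>h\<close> restricts to homogeneous elements and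
  idempotents of degree 0, \<open>s\<close> moreover asks for projections.\<close>

definition adm :: "bool \<Rightarrow> 'a \<Rightarrow> bool" where
  "adm h x \<longleftrightarrow> (h \<longrightarrow> (\<exists>n. cmp n x = x))"

definition idem :: "bool \<Rightarrow> bool \<Rightarrow> 'a \<Rightarrow> bool" where
  "idem h s p \<longleftrightarrow> p \<in> A \<and> p * p = p \<and> (h \<longrightarrow> cmp 0 p = p) \<and> (s \<longrightarrow> st p = p)"

text \<open>A right inverse z of y makes \<open>e * z * y\<close> idempotent, and
  \<open>y * q = y\<close> recovers y from q, so both kill the same elements.\<close>

lemma rank_one_idempotent:
  assumes "y * e = y" "vt w * y = y" "y * z = vt w" "e * e = e"
  defines "q \<equiv> e * z * y"
  shows "q * q = q" "e * q = q" "q * e = q" "q * t = 0 \<longleftrightarrow> y * t = 0"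
proof -
  note F = assms(1-4) assms(1-4)[THEN mult_eq_assoc]
  show "q * q = q" "e * q = q" "q * e = q" by (simp_all add: q_def mult.assoc F)
  have "y * (q * t) = y * t" by (simp add: q_def mult.assoc F)
  thus "q * t = 0 \<longleftrightarrow> y * t = 0" by (auto simp: q_def mult.assoc)
qed

text \<open>The cases differ only in the right inverse. Ungraded: y is replaced by the factor y' of
  \<open>gcd_factorization\<close>, which kills the same elements since d cancels. Graded: one
  nonzero coordinate of y is a multiple of a unitary, which is inverted. With projections:
  \<open>st y\<close> divided by the norm of y, so that q is a multiple of
  \<open>st y * y\<close>.\<close>

lemma annihilator_step:
  assumes w: "linear_vertex E w" and u: "frame u" and e: "idem h s e" "e * u = e"
    and y: "y \<in> A" "vt w * y = y" "y * e = y" "y \<noteq> 0" "adm h y"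
    and hs: "s \<Longrightarrow> h \<and> positive_definite \<sigma>"
  obtains q where "idem h s q" "e * q = q" "q * e = q" "\<And>t. t \<in> A \<Longrightarrow> q * t = 0 \<longleftrightarrow> y * t = 0"
proof -
  have e': "e \<in> A" "e * e = e" "h \<Longrightarrow> cmp 0 e = e" "s \<Longrightarrow> st e = e" using e by (auto simp: idem_def)
  have wv: "w \<in> verts E" using w by (simp add: linear_vertex_def)
  have yu: "y * u = y" using y(3) e(2) by (metis mult.assoc)
  consider "\<not> h" "\<not> s" | "h" "\<not> s" | "h" "s" "positive_definite \<sigma>" using hs by blast
  thus thesis
  proof cases
    case 1
    obtain d y' z where d: "d \<in> A" "vt w * d = d" "d * vt w = d" "d \<noteq> 0"
      "y' \<in> A" "vt w * y' = y'" "z \<in> A" "y = d * y'" "y' * z = vt w"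
      using gcd_factorization[OF w u y(1,2) yu y(4)] .
    have "d * (y' * e - y') = 0" using y(3) d(8) by (simp add: right_diff_distrib mult.assoc)
    moreover have "y' * e - y' \<in> A" "vt w * (y' * e - y') = y' * e - y'"
      using d e' by (auto simp: A_diff A_mult right_diff_distrib mult.assoc[symmetric])
    ultimately have ye: "y' * e = y'" using left_cancel[OF w d(1-4)] by fastforce
    note q = rank_one_idempotent[OF ye d(6,9) e'(2)]
    have "y' * t = 0" if "y * t = 0" "t \<in> A" for t
    proof (rule left_cancel[OF w d(1-4)])
      show "y' * t \<in> A" "vt w * (y' * t) = y' * t" "d * (y' * t) = 0"
        using d(5,6,8) that by (auto simp: A_mult mult.assoc d(6)[THEN mult_eq_assoc])
    qed
    hence "y * t = 0 \<longleftrightarrow> y' * t = 0" if "t \<in> A" for t using that d(8) by (auto simp: mult.assoc)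
    thus thesis using that[of "e * z * y'"] q 1 d e' by (auto simp: idem_def A_mult)
  next
    case 2
    then obtain n where n: "cmp n y = y" using y(5) by (auto simp: adm_def)
    obtain m k w' where m: "linear_vertex E w'" "m \<in> A" "st m * m = vt w'" "m * vt w' = m"
      "cmp k m = m" "u * m = m" "y * m \<noteq> 0" using frame_nonzero[OF u, of y, unfolded yu, OF y(4)] .
    obtain l g where g: "l \<noteq> 0" "unitary w w' (n + k) g" "y * m = l \<cdot> g"
      using hom_mult_unitary[OF w m(1) y(1,2) n m(2,4,5,7)] .
    define z where "z = inverse l \<cdot> (m * st g)"
    have g': "g \<in> A" "g * st g = vt w" "cmp (n + k) g = g" using g(2) by (auto simp: unitary_def)
    have "y * z = inverse l \<cdot> ((y * m) * st g)" by (simp add: z_def sc_mult_right mult.assoc)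
    hence yz: "y * z = vt w" using g(1,3) g' by (simp add: sc_mult_left sc_sc sc_one)
    have "cmp (k + - (n + k)) (m * st g) = m * st g" by (rule hom_mult[OF m(5) hom_st[OF g'(3)]])
    hence zn: "cmp (- n) z = z" by (simp add: z_def cmp_sc)
    have "cmp (0 + - n + n) (e * z * y) = e * z * y"
      using hom_mult[OF hom_mult[OF e'(3)[OF 2(1)] zn] n] .
    thus thesis using that[of "e * z * y"] rank_one_idempotent[OF y(3,2) yz e'(2)] 2 e' m g' y(1)
      by (auto simp: idem_def A_mult A_sc A_st z_def)
  next
    case 3
    then obtain n where n: "cmp n y = y" using y(5) by (auto simp: adm_def)
    obtain ks where ks: "y * u * st y = (\<Sum>k\<leftarrow>ks. k * \<sigma> k) \<cdot> vt w" "(\<forall>k\<in>set ks. k = 0) \<longrightarrow> y * u = 0"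
      using frame_norm[OF u w y(1,2) n] by blast
    define l where "l = (\<Sum>k\<leftarrow>ks. k * \<sigma> k)"
    \<comment> \<open>If l were 0, positive definiteness would make all coordinates vanish, against
      \<open>y \<noteq> 0\<close>.\<close>
    have l0: "l \<noteq> 0" using ks(2) 3(3) yu y(4) unfolding positive_definite_def l_def by auto
    have "\<sigma> (\<Sum>k\<leftarrow>ks. k * \<sigma> k) = (\<Sum>k\<leftarrow>ks. k * \<sigma> k)" for ks
      by (induction ks) (auto simp: sigma_simps(1-4))
    hence sl: "\<sigma> (inverse l) = inverse l" by (simp add: l_def sigma_inverse)
    define z where "z = inverse l \<cdot> st y"
    have yz: "y * z = vt w" using ks(1) l0 yu by (simp add: z_def sc_mult_right l_def[symmetric] sc_sc sc_one)
    have "e * st y = st y" using y(3) e'(4)[OF 3(2)] by (metis st_mult)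
    hence q: "e * z * y = inverse l \<cdot> (st y * y)" by (simp add: z_def sc_mult_right sc_mult_left)
    have "cmp 0 (st y * y) = st y * y" using hom_mult[OF hom_st[OF n] n] by simp
    hence "cmp 0 (e * z * y) = e * z * y" unfolding q by (simp add: cmp_sc)
    moreover have "st (e * z * y) = e * z * y" unfolding q by (simp add: st_sc sl st_mult st_st)
    ultimately show thesis using that[of "e * z * y"] rank_one_idempotent[OF y(3,2) yz e'(2)] e' y(1)
      by (auto simp: idem_def A_mult A_sc A_st z_def)
  qed
qed

lemma adm_mult: "adm h x \<Longrightarrow> adm h y \<Longrightarrow> adm h (x * y)"
  unfolding adm_def using hom_mult by blast

lemma adm_unitary: "unitary w w' n g \<Longrightarrow> adm h g" "unitary w w' n g \<Longrightarrow> adm h (st g)"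
  unfolding adm_def unitary_def using hom_st by blast+

lemma idem_adm: "idem h s e \<Longrightarrow> adm h e"
  unfolding adm_def idem_def by blast

lemma frame_annihilates:
  assumes "frame f" "\<And>m n w. m \<in> A \<Longrightarrow> linear_vertex E w \<Longrightarrow> vt w * st m = st m \<Longrightarrow> cmp n m = m \<Longrightarrow> st m * x = 0"
  shows "f * x = 0"
  using assms(1)
proof (induction rule: frame.induct)
  case (add u w m n)
  have "vt w * st m = st m" using add(5) by (metis st_mult st_vt)
  hence "st m * x = 0" using assms(2) add by blast
  thus ?case using add.IH by (simp add: distrib_right mult.assoc)
qed simp

text \<open>Besides generating the annihilator inside u, p is required to lie in the corner of u;
  the induction needs this to keep the generator for u' orthogonal to the new summand m.\<close>

theorem frame_annihilator:
  assumes gc: "graph_cond E" and hs: "s \<Longrightarrow> h \<and> positive_definite \<sigma>"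
    and "frame u" "S \<subseteq> A" "\<And>x. x \<in> S \<Longrightarrow> adm h x"
  shows "\<exists>p. idem h s p \<and> u * p = p \<and> p * u = p \<and>
    (\<forall>t\<in>A. (u * t = t \<and> (\<forall>x\<in>S. x * t = 0)) \<longleftrightarrow> p * t = t)"
  using assms(3-5)
proof (induction arbitrary: S rule: frame.induct)
  case zero
  show ?case by (rule exI[of _ 0]) (auto simp: idem_def A.zero)
next
  case (add u' w m n S)
  define u where "u = m * st m + u'"
  have fu: "frame u" using frame.add[OF add(1-7)] by (simp add: u_def)
  note w = add(2) and m = add(3-6)
  note F = frame_add_mult[OF add(1,4,5,7), folded u_def]
  note U' = frame_props[OF add(1)] and U = frame_props[OF fu]
  have stm: "st m * u' = 0" by (rule F(4))
  \<comment> \<open>N is the annihilator sought. L, the admissible elements that kill N, contains S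
    and has the same annihilator inside u, but it is also stable under multiplication by admissible
    elements from the left. L0 is the part of L whose coordinate at m is zero; it is a matter of the
    smaller frame u' alone.\<close>
  define N where "N = {t \<in> A. u * t = t \<and> (\<forall>x\<in>S. x * t = 0)}"
  define L where "L = {x \<in> A. adm h x \<and> (\<forall>t\<in>N. x * t = 0)}"
  define L0 where "L0 = {x \<in> L. x * m = 0}"
  have SL: "S \<subseteq> L" using add.prems by (auto simp: L_def N_def)
  have L_left: "a * x \<in> L" if "a \<in> A" "adm h a" "x \<in> L" for a x
    using that by (auto simp: L_def A_mult adm_mult mult.assoc)
  have "\<exists>p. idem h s p \<and> u' * p = p \<and> p * u' = p \<and>
    (\<forall>t\<in>A. (u' * t = t \<and> (\<forall>x\<in>L0. x * t = 0)) \<longleftrightarrow> p * t = t)"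
    by (rule add.IH) (auto simp: L0_def L_def)
  then obtain e' where e': "idem h s e'" "u' * e' = e'" "e' * u' = e'"
    "\<And>t. t \<in> A \<Longrightarrow> (u' * t = t \<and> (\<forall>x\<in>L0. x * t = 0)) \<longleftrightarrow> e' * t = t"
    by metis
  define e where "e = m * st m + e'"
  have me': "st m * e' = 0" using stm e'(2) by (metis mult.assoc mult_zero_left)
  have e'm: "e' * m = 0" using add(7) e'(3) by (metis mult.assoc mult_zero_right)
  note G = m(2,3) me' e'm e'(2,3) add(7) stm
  note G = G G[THEN mult_eq_assoc]
  have e'': "e' * e' = e'" "e' \<in> A" using e'(1) by (auto simp: idem_def)
  have ee: "e * e = e" by (simp add: e_def distrib_left distrib_right mult.assoc G e'')
  have ue: "u * e = e" "e * u = e" by (simp_all add: e_def u_def distrib_left distrib_right mult.assoc G)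
  have "cmp 0 (m * st m) = m * st m" using hom_mult[OF m(4) hom_st[OF m(4)]] by simp
  hence ie: "idem h s e" using e' ee m by (auto simp: idem_def e_def A.add A_mult A_st cmp_add st_add st_mult st_st)
  \<comment> \<open>Elements of L0 do not see m, so on t they act as on \<open>u' * t\<close>; there
    e' decides, and the coordinate at m is left free by the summand \<open>m * st m\<close> of
    e.\<close>
  have eN: "(u * t = t \<and> (\<forall>x\<in>L0. x * t = 0)) \<longleftrightarrow> e * t = t" if t: "t \<in> A" for t
  proof -
    have 1: "e' * (u' * t) = e' * t" using e'(3)[THEN mult_eq_assoc] .
    have 2: "x * (u' * t) = x * t" if "u * t = t" "x \<in> L0" for x
    proof -
      have "x * t = x * (m * st m * t) + x * (u' * t)"
        using that(1) by (metis u_def distrib_left distrib_right)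
      moreover have "x * (m * st m * t) = 0" using that(2) by (simp add: L0_def mult.assoc[symmetric])
      ultimately show ?thesis by simp
    qed
    have 3: "e' * (u' * t) = u' * t \<longleftrightarrow> (\<forall>x\<in>L0. x * (u' * t) = 0)"
      using e'(4)[of "u' * t"] t U' by (auto simp: A_mult U'(3)[THEN mult_eq_assoc])
    have 4: "e * t = t \<longleftrightarrow> u * t = t \<and> e' * t = u' * t"
    proof
      assume et: "e * t = t"
      hence "u * t = t" using ue(1) by (metis mult.assoc)
      thus "u * t = t \<and> e' * t = u' * t"
        using et by (metis e_def u_def distrib_right add_left_cancel)
    next
      assume "u * t = t \<and> e' * t = u' * t"
      thus "e * t = t" by (metis e_def u_def distrib_right)
    qed
    show ?thesis using 1 2 3 4 by auto
  qed
  \<comment> \<open>Modulo L0 the elements of L that start at w are left multiples of a single y,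
    namely one with a coordinate of minimal width at m. If all these coordinates vanish, y = 0
    serves.\<close>
  have "\<exists>y\<in>L. vt w * y = y \<and> (\<forall>x\<in>L. vt w * x = x \<longrightarrow> (\<exists>a\<in>A. x - a * y \<in> L0))"
  proof (cases "\<exists>y\<in>L. vt w * y = y \<and> y * m \<noteq> 0")
    case False
    have "0 \<in> L" by (auto simp: L_def A.zero adm_def)
    thus ?thesis using False A.zero by (intro bexI[of _ 0]) (auto simp: L0_def intro!: bexI[of _ 0])
  next
    case True
    then obtain y where y: "y \<in> L" "vt w * y = y" "y * m \<noteq> 0"
      and ymin: "\<And>x. x \<in> L \<Longrightarrow> vt w * x = x \<Longrightarrow> x * m \<noteq> 0 \<Longrightarrow> width (y * m) \<le> width (x * m)"
      using ex_has_least_nat[of "\<lambda>y. y \<in> L \<and> vt w * y = y \<and> y * m \<noteq> 0" _ "\<lambda>y. width (y * m)"] by blast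
    have ym: "x * m \<in> A" "vt w * (x * m) = x * m" "x * m * vt w = x * m"
      if "x \<in> L" "vt w * x = x" for x
      using that m by (auto simp: L_def A_mult mult.assoc that(2)[THEN mult_eq_assoc])
    have "\<exists>a\<in>A. x - a * y \<in> L0" if "x \<in> L" "vt w * x = x" for x
      using that
    proof (induction "width (x * m)" arbitrary: x rule: less_induct)
      case (less x)
      show ?case
      proof (cases "x * m = 0")
        case True
        thus ?thesis using less.prems by (intro bexI[of _ 0]) (auto simp: L0_def A.zero)
      next
        case False
        obtain q where q: "q \<in> A" "cmp (top_deg (x * m) - top_deg (y * m)) q = q" "vt w * q = q" "q * vt w = q"
          "x * m - q * (y * m) = 0 \<or> width (x * m - q * (y * m)) < width (x * m)"
          using division_step[OF w w ym[OF less.prems] False ym[OF y(1,2)] y(3) ymin[OF less.prems False]] .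
        let ?x = "x - q * y"
        \<comment> \<open>In the graded case q has the degree of x minus that of y, so
          \<open>x - q * y\<close> is still homogeneous.\<close>
        have "adm h ?x"
        proof (cases h)
          case True
          then obtain a b where ab: "cmp a x = x" "cmp b y = y"
            using less.prems y by (auto simp: L_def adm_def)
          have "top_deg (x * m) = a + n" "top_deg (y * m) = b + n"
            using top_deg_hom[OF False hom_mult[OF ab(1) m(4)]] top_deg_hom[OF y(3) hom_mult[OF ab(2) m(4)]] by auto
          hence "cmp (a - b) q = q" using q(2) by simp
          hence "cmp a (q * y) = q * y" using hom_mult[of "a - b" q b y] ab by simp
          thus ?thesis using ab by (auto simp: adm_def cmp_diff intro!: exI[of _ a])
        qed (simp add: adm_def)
        hence xL: "?x \<in> L" using less.prems y q
          by (auto simp: L_def A_diff A_mult left_diff_distrib mult.assoc)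
        have xw: "vt w * ?x = ?x" using less.prems q by (simp add: right_diff_distrib q(3)[THEN mult_eq_assoc])
        have xm: "x * m - q * (y * m) = ?x * m" by (simp add: left_diff_distrib mult.assoc)
        have "\<exists>a\<in>A. ?x - a * y \<in> L0"
        proof (cases "?x * m = 0")
          case True
          thus ?thesis using xL by (intro bexI[of _ 0]) (auto simp: L0_def A.zero)
        next
          case False
          hence "width (?x * m) < width (x * m)" using q(5) unfolding xm by blast
          thus ?thesis using less.hyps xL xw by blast
        qed
        then obtain a where "a \<in> A" "?x - a * y \<in> L0" by blast
        moreover from this have "x - (q + a) * y \<in> L0" by (simp add: distrib_right diff_diff_eq)
        ultimately show ?thesis using q A.add by blast
      qed
    qed
    thus ?thesis using y by blast
  qed
  then obtain y where y: "y \<in> L" "vt w * y = y"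
    and ydiv: "\<And>x. x \<in> L \<Longrightarrow> vt w * x = x \<Longrightarrow> \<exists>a\<in>A. x - a * y \<in> L0" by blast
  have N: "t \<in> N \<longleftrightarrow> e * t = t \<and> y * t = 0" if t: "t \<in> A" for t
  proof
    assume tN: "t \<in> N"
    hence "u * t = t" "\<forall>x\<in>L0. x * t = 0" "y * t = 0" using y by (auto simp: N_def L0_def L_def)
    thus "e * t = t \<and> y * t = 0" using eN[OF t] by blast
  next
    assume et: "e * t = t \<and> y * t = 0"
    hence ut: "u * t = t" and L0t: "\<And>x. x \<in> L0 \<Longrightarrow> x * t = 0" using eN[OF t] by auto
    have "x * t = 0" if xS: "x \<in> S" for x
    proof -
      have xL: "x \<in> L" using xS SL by blast
      hence xA: "x \<in> A" by (simp add: L_def)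
      \<comment> \<open>An element of S need not start at w. A frame of a local unit cuts it into
        pieces \<open>st m' * x\<close> that start at linear vertices; a piece with a nonzero
        coordinate at m is moved to w by the unitary that this coordinate provides.\<close>
      obtain D where D: "finite D" "D \<subseteq> verts E" "local_unit D * x = x"
        using local_unit_exists[OF xA] by blast
      have "local_unit D * (x * t) = 0"
      proof (rule frame_annihilates)
        show "frame (local_unit D)" using frame_local_unit[OF gc D(1,2)] .
        fix m' n' w' assume m': "m' \<in> A" "linear_vertex E w'" "vt w' * st m' = st m'" "cmp n' m' = m'"
        let ?x = "st m' * x"
        have "adm h (st m')" using hom_st[OF m'(4)] by (auto simp: adm_def)
        hence x'L: "?x \<in> L" using L_left m' xL A_st by blast
        have "?x * t = 0"
        proof (cases "?x * m = 0")
          case True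
          thus ?thesis using L0t x'L by (simp add: L0_def)
        next
          case False
          have "?x \<in> A" "vt w' * ?x = ?x"
            using m' xA by (simp_all add: A_mult A_st m'(3)[THEN mult_eq_assoc])
          then obtain k g where g: "unitary w' w k g"
            using mult_nonzero_unitary[OF m'(2) w _ _ m(1,3) False] by blast
          hence g': "st g \<in> A" "vt w * st g = st g" "g * st g = vt w'"
            by (auto simp: unitary_def A_st) (metis st_mult st_vt)
          have "st g * ?x \<in> L" using L_left[OF g'(1) adm_unitary(2)[OF g] x'L] .
          moreover have "vt w * (st g * ?x) = st g * ?x" using g'(2)[THEN mult_eq_assoc] .
          ultimately obtain a where a: "a \<in> A" "st g * ?x - a * y \<in> L0" using ydiv by blast
          have "(st g * ?x - a * y) * t = 0" using L0t a by blast
          hence "st g * (?x * t) = 0" using et by (simp add: left_diff_distrib mult.assoc)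
          hence "g * (st g * (?x * t)) = 0" by simp
          hence "vt w' * (?x * t) = 0" by (simp add: g'(3)[THEN mult_eq_assoc])
          thus ?thesis by (simp add: mult.assoc m'(3)[THEN mult_eq_assoc])
        qed
        thus "st m' * (x * t) = 0" by (simp add: mult.assoc)
      qed
      thus ?thesis by (simp add: D(3)[THEN mult_eq_assoc])
    qed
    thus "t \<in> N" using t ut by (auto simp: N_def)
  qed
  have yA: "y \<in> A" "adm h y" using y by (auto simp: L_def)
  have "\<exists>p. idem h s p \<and> u * p = p \<and> p * u = p \<and> (\<forall>t\<in>A. t \<in> N \<longleftrightarrow> p * t = t)"
  proof (cases "y * e = 0")
    case True
    have "y * t = 0" if "e * t = t" for t using True that by (metis mult.assoc mult_zero_left)
    thus ?thesis using N ie ue by blast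
  next
    case False
    obtain q where q: "idem h s q" "e * q = q" "q * e = q" "\<And>t. t \<in> A \<Longrightarrow> q * t = 0 \<longleftrightarrow> y * e * t = 0"
    proof (rule annihilator_step[OF w fu ie ue(2), of "y * e"])
      show "y * e \<in> A" "vt w * (y * e) = y * e" "y * e * e = y * e"
        using yA y(2) ie ee by (auto simp: A_mult idem_def mult.assoc y(2)[THEN mult_eq_assoc])
      show "adm h (y * e)" using yA(2) idem_adm[OF ie] by (rule adm_mult)
    qed (use False hs in auto)
    have q': "q \<in> A" "q * q = q" using q(1) by (auto simp: idem_def)
    \<comment> \<open>Inside e, the elements killed by y are those killed by q, hence those fixed by
      the complement of q.\<close>
    let ?p = "e - q"
    have "idem h s ?p" using ie q ee q'
      by (auto simp: idem_def A_diff cmp_diff st_diff left_diff_distrib right_diff_distrib)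
    moreover have "u * ?p = ?p" "?p * u = ?p"
    proof -
      have "u * q = q" "q * u = q" using q(2,3) ue by (metis mult.assoc)+
      thus "u * ?p = ?p" "?p * u = ?p" using ue by (simp_all add: left_diff_distrib right_diff_distrib)
    qed
    moreover have "t \<in> N \<longleftrightarrow> ?p * t = t" if t: "t \<in> A" for t
    proof
      assume "t \<in> N"
      hence a: "e * t = t" "y * t = 0" using N[OF t] by auto
      hence "q * t = 0" using q(4)[OF t] by (simp add: mult.assoc)
      thus "?p * t = t" using a by (simp add: left_diff_distrib)
    next
      assume p: "?p * t = t"
      have "e * ?p = ?p" "q * ?p = 0" using ee q q' by (simp_all add: right_diff_distrib)
      hence a: "e * t = t" "q * t = 0" using p by (metis mult.assoc, metis mult.assoc mult_zero_left)
      hence "y * (e * t) = 0" using q(4)[OF t] by (simp add: mult.assoc)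
      thus "t \<in> N" using N[OF t] a by simp
    qed
    ultimately show ?thesis by blast
  qed
  thus ?case unfolding N_def u_def by simp
qed

section \<open>Corners and the converse\<close>

lemma corner_eq:
  assumes "e \<in> A" "e * e = e"
  shows "corner A (*) e = {x \<in> A. e * x = x \<and> x * e = x}"
proof -
  have "x \<in> corner A (*) e" if "x \<in> A" "e * x = x" "x * e = x" for x
    unfolding corner_def using that by (intro image_eqI[of _ _ x]) auto
  moreover have "e * (e * x * e) = e * x * e" "e * x * e * e = e * x * e" for x
    using assms(2) by (simp_all add: mult.assoc assms(2)[THEN mult_eq_assoc])
  ultimately show ?thesis using assms(1) by (auto simp: corner_def A_mult)
qed

text \<open>Passes from f to a smaller idempotent e. As elements of S end in e, they kill
  \<open>f - e\<close>; so p fixes \<open>f - e\<close>, which gives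
  \<open>e * p * e = e * p\<close>, and this product inherits idempotency from p.\<close>

lemma corner_annihilator:
  assumes e: "e \<in> A" "e * e = e" and f: "f \<in> A" "f * f = f" "f * e = e" "e * f = e"
    and p: "p \<in> A" "p * p = p" "f * p = p" "p * f = p"
    and S: "S \<subseteq> corner A (*) e"
    and ann: "\<And>t. t \<in> A \<Longrightarrow> (f * t = t \<and> (\<forall>x\<in>S. x * t = 0)) \<longleftrightarrow> p * t = t"
  defines "q \<equiv> e * p * e"
  shows "q \<in> corner A (*) e" "q * q = q" "rann (corner A (*) e) (*) 0 S = (*) q ` corner A (*) e"
proof -
  let ?C = "corner A (*) e"
  note C = corner_eq[OF e]
  have Se: "x * e = x" "x \<in> A" if "x \<in> S" for x using that S C by auto
  have "x * (f - e) = 0" if "x \<in> S" for x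
  proof -
    have "x * f = x" using Se[OF that] f(4) by (metis mult.assoc)
    thus ?thesis using Se[OF that] by (simp add: right_diff_distrib)
  qed
  moreover have "f * (f - e) = f - e" "f - e \<in> A" using f e by (auto simp: right_diff_distrib A_diff)
  ultimately have "p * (f - e) = f - e" using ann by blast
  hence "p - p * e = f - e" using p by (simp add: right_diff_distrib)
  hence "e * (p - p * e) = 0" using e f by (simp add: right_diff_distrib)
  hence ep: "e * (p * e) = e * p" by (simp add: right_diff_distrib)
  note F = ep e(2) p(2)
  note F = F F[THEN mult_eq_assoc]
  have q: "q = e * p" by (simp add: q_def mult.assoc ep)
  show qC: "q \<in> ?C" using e p by (simp add: C q_def A_mult mult.assoc F)
  have epep: "e * (p * (e * x)) = e * (p * x)" for x using ep by (metis mult.assoc)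
  show "q * q = q" by (simp add: q mult.assoc epep F)
  show "rann ?C (*) 0 S = (*) q ` ?C"
  proof
    show "rann ?C (*) 0 S \<subseteq> (*) q ` ?C"
    proof
      fix t assume "t \<in> rann ?C (*) 0 S"
      hence t: "t \<in> ?C" "t \<in> A" "e * t = t" "\<forall>x\<in>S. x * t = 0" by (auto simp: rann_def C)
      have "f * t = t" using t(3) f(3) by (metis mult.assoc)
      hence "p * t = t" using ann t by blast
      hence "q * t = t" using t(3) by (simp add: q mult.assoc)
      thus "t \<in> (*) q ` ?C" using t(1) by (metis imageI)
    qed
    have "x * (q * c) = 0" if "x \<in> S" for x c
    proof -
      have "x * p = 0" using ann[OF p(1)] p that by blast
      thus ?thesis using Se(1)[OF that] unfolding q by (metis mult.assoc mult_zero_left)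
    qed
    moreover have "q * c \<in> ?C" if "c \<in> ?C" for c
    proof -
      have "e * (q * c) = q * c" using e(2) unfolding q by (metis mult.assoc)
      thus ?thesis using qC that by (auto simp: C A_mult mult.assoc)
    qed
    ultimately show "(*) q ` ?C \<subseteq> rann ?C (*) 0 S" by (auto simp: rann_def)
  qed
qed

text \<open>The common core of the three Baer conditions, without the demand for a unit; the flags
  are those of \<open>adm\<close> and \<open>idem\<close>.\<close>

definition annihilators_idem :: "bool \<Rightarrow> bool \<Rightarrow> 'a set \<Rightarrow> bool" where
  "annihilators_idem h s C \<longleftrightarrow> (\<forall>S\<subseteq>C. (\<forall>x\<in>S. adm h x) \<longrightarrow>
     (\<exists>p\<in>C. idem h s p \<and> rann C (*) 0 S = (*) p ` C))"

text \<open>Serves both directions: f is a local unit above e when the graph condition is given, and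
  the unit of the whole algebra when one descends to the corner of a vertex.\<close>

lemma annihilators_idem_corner:
  assumes f: "f \<in> A" "f * f = f"
    and ann: "\<And>S. S \<subseteq> A \<Longrightarrow> (\<And>x. x \<in> S \<Longrightarrow> adm h x) \<Longrightarrow> \<exists>p. idem h s p \<and> f * p = p \<and> p * f = p \<and>
      (\<forall>t\<in>A. (f * t = t \<and> (\<forall>x\<in>S. x * t = 0)) \<longleftrightarrow> p * t = t)"
    and e: "idem h s e" "f * e = e" "e * f = e"
  shows "annihilators_idem h s (corner A (*) e)"
  unfolding annihilators_idem_def
proof (intro allI impI)
  fix S assume S: "S \<subseteq> corner A (*) e" "\<forall>x\<in>S. adm h x"
  have e': "e \<in> A" "e * e = e" using e by (auto simp: idem_def)
  have "S \<subseteq> A" using S(1) corner_eq[OF e'] by auto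
  from ann[OF this] S(2) obtain p where p: "idem h s p" "f * p = p" "p * f = p"
    "\<And>t. t \<in> A \<Longrightarrow> (f * t = t \<and> (\<forall>x\<in>S. x * t = 0)) \<longleftrightarrow> p * t = t" by blast
  have p': "p \<in> A" "p * p = p" using p by (auto simp: idem_def)
  note q = corner_annihilator[OF e' f e(2,3) p' p(2,3) S(1) p(4)]
  have "cmp 0 (e * p * e) = e * p * e" if h
    using hom_mult[OF hom_mult[of 0 e 0 p], of 0 e] that e p by (simp add: idem_def)
  moreover have "st (e * p * e) = e * p * e" if s
    using that e p by (simp add: idem_def st_mult mult.assoc)
  ultimately have "idem h s (e * p * e)" using q(2) e' p' by (auto simp: idem_def A_mult)
  thus "\<exists>p\<in>corner A (*) e. idem h s p \<and> rann (corner A (*) e) (*) 0 S = (*) p ` corner A (*) e"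
    using q by blast
qed

theorem graph_cond_annihilators_idem:
  assumes gc: "graph_cond E" and hs: "s \<Longrightarrow> h \<and> positive_definite \<sigma>" and e: "idem h s e"
  shows "annihilators_idem h s (corner A (*) e)"
proof -
  have "e \<in> A" using e by (simp add: idem_def)
  from local_unit_exists[OF this] obtain D where D: "finite D" "D \<subseteq> verts E"
    "local_unit D * e = e" "e * local_unit D = e" by blast
  note fr = frame_local_unit[OF gc D(1,2)]
  show ?thesis
    by (rule annihilators_idem_corner[OF frame_props(1,3)[OF fr] _ e D(3,4)])
      (rule frame_annihilator[OF gc hs fr])
qed

lemma finite_verts_unit:
  assumes "finite (verts E)"
  shows "x \<in> A \<Longrightarrow> local_unit (verts E) * x = x" "x \<in> A \<Longrightarrow> x * local_unit (verts E) = x"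
  using local_unit_exists[of x] assms by blast+

lemma local_unit_A: "F \<subseteq> verts E \<Longrightarrow> local_unit F \<in> A"
  unfolding local_unit_def by (rule A_sum) (auto intro: A_vt)

lemma corner_unit: "u \<in> A \<Longrightarrow> (\<And>x. x \<in> A \<Longrightarrow> u * x = x \<and> x * u = x) \<Longrightarrow> corner A (*) u = A"
  by (subst corner_eq) auto

text \<open>A unit is fixed by a local unit over some finite D; a vertex outside D would be
  orthogonal to it and hence zero.\<close>

lemma unit_finite_verts:
  assumes "u \<in> A" "\<And>x. x \<in> A \<Longrightarrow> u * x = x \<and> x * u = x"
  shows "finite (verts E)"
proof -
  obtain D where D: "finite D" "D \<subseteq> verts E" "local_unit D * u = u"
    using local_unit_exists[OF assms(1)] by blast
  have "v \<in> D" if v: "v \<in> verts E" for v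
  proof (rule ccontr)
    assume "v \<notin> D"
    hence "vt v * (local_unit D * u) = 0"
      using vt_local_unit(1)[OF D(1,2) v] by (simp add: mult.assoc[symmetric])
    thus False using D(3) assms(2)[OF A_vt[OF v]] vt_nonzero[OF v] by simp
  qed
  thus ?thesis using D by (meson finite_subset subsetI)
qed

text \<open>What every version of the Baer property implies: only homogeneous sets are tested, only
  in corners at vertices, and the generator may be any idempotent.\<close>

definition vertex_corners_baer :: bool where
  "vertex_corners_baer \<longleftrightarrow> (\<forall>v\<in>verts E. \<forall>S\<subseteq>corner A (*) (vt v). (\<forall>x\<in>S. \<exists>n. cmp n x = x) \<longrightarrow>
     (\<exists>p\<in>corner A (*) (vt v). p * p = p \<and>
        rann (corner A (*) (vt v)) (*) 0 S = (*) p ` corner A (*) (vt v)))"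

lemma idem_vt: "v \<in> verts E \<Longrightarrow> idem h s (vt v)"
  by (simp add: idem_def A_vt vt_idem cmp_vt st_vt)

lemma vertex_corners_baer_local:
  assumes "\<And>v. v \<in> verts E \<Longrightarrow> annihilators_idem h s (corner A (*) (vt v))"
  shows "vertex_corners_baer"
  unfolding vertex_corners_baer_def
proof (intro ballI allI impI)
  fix v S assume v: "v \<in> verts E" and S: "S \<subseteq> corner A (*) (vt v)" "\<forall>x\<in>S. \<exists>n. cmp n x = x"
  have "\<forall>x\<in>S. adm h x" using S by (simp add: adm_def)
  with assms[OF v] S(1) show "\<exists>p\<in>corner A (*) (vt v). p * p = p \<and>
        rann (corner A (*) (vt v)) (*) 0 S = (*) p ` corner A (*) (vt v)"
    unfolding annihilators_idem_def idem_def by meson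
qed

lemma vertex_corners_baer_unital:
  assumes u: "u \<in> A" "\<And>x. x \<in> A \<Longrightarrow> u * x = x \<and> x * u = x" and ann: "annihilators_idem h s A"
  shows "vertex_corners_baer"
proof (rule vertex_corners_baer_local)
  fix v assume v: "v \<in> verts E"
  show "annihilators_idem h s (corner A (*) (vt v))"
  proof (rule annihilators_idem_corner[of u])
    fix S assume S: "S \<subseteq> A" "\<And>x. x \<in> S \<Longrightarrow> adm h x"
    then obtain p where p: "p \<in> A" "idem h s p" "rann A (*) 0 S = (*) p ` A"
      using ann unfolding annihilators_idem_def by meson
    have pp: "p * p = p" using p(2) by (simp add: idem_def)
    have "(\<forall>x\<in>S. x * t = 0) \<longleftrightarrow> p * t = t" if t: "t \<in> A" for t
    proof -
      have "(\<forall>x\<in>S. x * t = 0) \<longleftrightarrow> t \<in> (*) p ` A" using t p(3) by (auto simp: rann_def)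
      also have "\<dots> \<longleftrightarrow> p * t = t" using t pp by (auto simp: mult.assoc[symmetric]) (metis image_eqI)
      finally show ?thesis .
    qed
    thus "\<exists>p. idem h s p \<and> u * p = p \<and> p * u = p \<and>
      (\<forall>t\<in>A. (u * t = t \<and> (\<forall>x\<in>S. x * t = 0)) \<longleftrightarrow> p * t = t)"
      using p u by blast
  qed (use u idem_vt[OF v] A_vt[OF v] in auto)
qed

text \<open>The annihilator of the even-indexed idempotents \<open>t i * st (t i)\<close> contains the odd-indexed
  ones; an idempotent generator would have to act like one scalar at almost every index.\<close>

lemma no_orthogonal_family:
  fixes t :: "nat \<Rightarrow> 'a" and r :: "nat \<Rightarrow> 'v"
  assumes W: "vertex_corners_baer" and v: "v \<in> verts E"
    and r: "\<And>i. r i \<in> verts E"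
    and t: "\<And>i. t i \<in> A" "\<And>i. vt v * t i = t i" "\<And>i. t i * vt (r i) = t i" "\<And>i. \<exists>n. cmp n (t i) = t i"
    and orth: "\<And>i. st (t i) * t i = vt (r i)" "\<And>i j. i \<noteq> j \<Longrightarrow> st (t i) * t j = 0"
    and scalar: "\<And>x. x \<in> A \<Longrightarrow> \<exists>l. eventually (\<lambda>i. st (t i) * x * t i = l \<cdot> vt (r i)) cofinite"
  shows False
proof -
  let ?C = "corner A (*) (vt v)"
  note C = corner_eq[OF A_vt[OF v] vt_idem[OF v]]
  define q where "q i = t i * st (t i)" for i
  have st_vt_t: "st (t i) * vt v = st (t i)" "vt (r i) * st (t i) = st (t i)" for i
    using t(2,3)[of i] by (metis st_mult st_vt)+
  have qC: "q i \<in> ?C" for i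
    using t[of i] st_vt_t[of i] by (simp add: C q_def A_mult A_st mult.assoc t(2)[THEN mult_eq_assoc])
  have qh: "\<exists>n. cmp n (q i) = q i" for i
    using t(4)[of i] hom_mult hom_st unfolding q_def by blast
  define S where "S = range (\<lambda>i. q (2 * i))"
  obtain p where p: "p \<in> ?C" "p * p = p" "rann ?C (*) 0 S = (*) p ` ?C"
  proof -
    have "S \<subseteq> ?C" "\<forall>x\<in>S. \<exists>n. cmp n x = x" using qC qh by (auto simp: S_def)
    thus thesis using W v that unfolding vertex_corners_baer_def by meson
  qed
  have pA: "p \<in> A" using p(1) C by simp
  obtain l where "eventually (\<lambda>i. st (t i) * p * t i = l \<cdot> vt (r i)) cofinite" using scalar[OF pA] by blast
  hence "finite {i. \<not> st (t i) * p * t i = l \<cdot> vt (r i)}" by (simp add: eventually_cofinite)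
  then obtain N where N: "\<And>i. st (t i) * p * t i \<noteq> l \<cdot> vt (r i) \<Longrightarrow> i < N"
    unfolding finite_nat_set_iff_bounded by blast
  \<comment> \<open>From N on the scalar of p is l. The even index 2 N forces l = 0, since p is
    killed there; the odd index 2 N + 1 then contradicts that p fixes \<open>q ?k\<close>.\<close>
  have "p \<in> rann ?C (*) 0 S" using p by (metis imageI)
  hence "q (2 * N) * p = 0" by (simp add: rann_def S_def)
  hence "st (t (2 * N)) * (q (2 * N) * p) = 0" by simp
  hence "st (t (2 * N)) * p = 0"
    by (simp add: q_def mult.assoc orth(1)[THEN mult_eq_assoc] st_vt_t(2)[THEN mult_eq_assoc])
  hence "l \<cdot> vt (r (2 * N)) = 0" using N[of "2 * N"] by fastforce
  hence l0: "l = 0" using vt_nonzero[OF r] by (simp add: sc_eq_0_iff)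
  let ?k = "2 * N + 1"
  have "st (t (2 * i)) * t ?k = 0" for i by (rule orth(2)) presburger
  hence "q (2 * i) * q ?k = 0" for i
    by (simp add: q_def mult.assoc) (metis mult.assoc mult_zero_left mult_zero_right)
  hence "q ?k \<in> rann ?C (*) 0 S" using qC by (auto simp: rann_def S_def)
  then obtain c where "q ?k = p * c" using p(3) by auto
  hence "p * q ?k = q ?k" using p(2) by (simp add: mult.assoc[symmetric])
  hence "st (t ?k) * (p * q ?k) * t ?k = st (t ?k) * q ?k * t ?k" by simp
  hence "st (t ?k) * p * t ?k = vt (r ?k)"
    using t(3)[of ?k] by (simp add: q_def mult.assoc orth(1) vt_idem[OF r])
  moreover have "st (t ?k) * p * t ?k = 0" using N[of ?k] l0 by fastforce
  ultimately show False using vt_nonzero[OF r] by simp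
qed

text \<open>Paths of which none is a prefix of another are orthogonal, and by linearity the scalar
  condition needs checking only for monomials with both paths starting at v; all others act as
  0.\<close>

lemma no_path_family:
  fixes P :: "nat \<Rightarrow> 'e list"
  assumes W: "vertex_corners_baer"
    and P: "\<And>i. vpath E v (P i)" "\<And>i j c. i \<noteq> j \<Longrightarrow> P j \<noteq> P i @ c"
    and scalar: "\<And>a b. vpath E v a \<Longrightarrow> vpath E v b \<Longrightarrow> endv E v a = endv E v b \<Longrightarrow>
      \<exists>l. eventually (\<lambda>i. st (pth v (P i)) * (pth v a * st (pth v b)) * pth v (P i) =
        l \<cdot> vt (endv E v (P i))) cofinite"
  shows False
proof (rule no_orthogonal_family[OF W, of v "\<lambda>i. endv E v (P i)" "\<lambda>i. pth v (P i)"])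
  show v: "v \<in> verts E" using vpath_start[OF wf P(1)] .
  fix i j :: nat assume "i \<noteq> j"
  thus "st (pth v (P i)) * pth v (P j) = 0" using P by (intro st_pth_incomparable) metis+
next
  fix x assume "x \<in> A"
  thus "\<exists>l. eventually (\<lambda>i. st (pth v (P i)) * x * pth v (P i) = l \<cdot> vt (endv E v (P i))) cofinite"
  proof (induction rule: A.induct)
    case zero show ?case by (rule exI[of _ 0]) simp
  next
    case (add x y)
    then obtain l k where
      "eventually (\<lambda>i. st (pth v (P i)) * x * pth v (P i) = l \<cdot> vt (endv E v (P i))) cofinite"
      "eventually (\<lambda>i. st (pth v (P i)) * y * pth v (P i) = k \<cdot> vt (endv E v (P i))) cofinite" by blast
    hence "eventually (\<lambda>i. st (pth v (P i)) * (x + y) * pth v (P i) = (l + k) \<cdot> vt (endv E v (P i))) cofinite"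
      by eventually_elim (simp add: distrib_left distrib_right sc_add_left)
    thus ?case by blast
  next
    case (mono u a u' b c)
    have v: "v \<in> verts E" using vpath_start[OF wf P(1)] .
    show ?case
    proof (cases "u = v \<and> u' = v")
      case True
      then obtain l where
        l: "eventually (\<lambda>i. st (pth v (P i)) * (pth u a * st (pth u' b)) * pth v (P i) = l \<cdot> vt (endv E v (P i))) cofinite"
        using scalar[of a b] mono by auto
      hence "eventually (\<lambda>i. st (pth v (P i)) * (c \<cdot> (pth u a * st (pth u' b))) * pth v (P i) =
         (c * l) \<cdot> vt (endv E v (P i))) cofinite"
        by eventually_elim (simp add: sc_mult_left sc_mult_right sc_sc)
      thus ?thesis by blast
    next
      case False
      have "st (pth v (P i)) * (c \<cdot> (pth u a * st (pth u' b))) * pth v (P i) = 0" for i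
      proof -
        have 1: "st (pth v (P i)) * vt v = st (pth v (P i))" using vt_pth[OF P(1)[of i]] by (metis st_mult st_vt)
        have "st (pth v (P i)) * pth u a = 0" if "u \<noteq> v"
          using vt_pth_other[OF mono(1) v] that 1 by (metis mult.assoc mult_zero_right)
        moreover have "st (pth u' b) * pth v (P i) = 0" if "u' \<noteq> v"
        proof -
          have "vt v * pth u' b = 0" using vt_pth_other[OF mono(2) v] that by blast
          hence "st (pth u' b) * vt v = 0" by (metis st_mult st_vt st_zero)
          thus ?thesis using vt_pth[OF P(1)[of i]] by (metis mult.assoc mult_zero_left)
        qed
        ultimately have "st (pth v (P i)) * (pth u a * st (pth u' b)) * pth v (P i) = 0"
          using False by (metis mult.assoc mult_zero_left mult_zero_right)
        thus ?thesis by (simp add: sc_mult_left sc_mult_right)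
      qed
      thus ?thesis by (intro exI[of _ 0]) simp
    qed
  qed
qed (use P(1) cmp_pth in \<open>auto simp: vpath_end A_pth vt_pth pth_vt st_pth_pth\<close>)

text \<open>Infinitely many edges out of v form the family. A monomial other than the vertex itself
  contains a path with a fixed first edge and so meets at most one of them.\<close>

lemma finite_emitters:
  assumes W: "vertex_corners_baer" and v: "v \<in> verts E"
  shows "finite (emits E v)"
proof (rule ccontr)
  assume "infinite (emits E v)"
  then obtain e :: "nat \<Rightarrow> 'e" where e: "inj e" "range e \<subseteq> emits E v"
    using infinite_countable_subset by blast
  have P: "vpath E v [e i]" for i
  proof -
    have "e i \<in> emits E v" using e(2) by blast
    thus ?thesis using wf by (simp add: emits_def)
  qed
  show False
  proof (rule no_path_family[OF W, of v "\<lambda>i. [e i]"])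
    fix a b assume a: "vpath E v a" and b: "vpath E v b"
    have fin: "eventually (\<lambda>i. e i \<noteq> f) cofinite" for f
    proof -
      have "{i. e i = f} \<subseteq> {inv e f}" using e(1) by auto
      thus ?thesis by (simp add: eventually_cofinite finite_subset)
    qed
    have z: "eventually (\<lambda>i. st (pth v [e i]) * pth v c = 0) cofinite" if c: "vpath E v c" "c \<noteq> []" for c
    proof -
      obtain f c' where c': "c = f # c'" using c(2) by (cases c) auto
      from fin[of f] show ?thesis
      proof eventually_elim
        case (elim i)
        show ?case
        proof (rule st_pth_incomparable[OF P c(1)])
          show "\<nexists>d. c = [e i] @ d" using c' elim by auto
          show "\<nexists>d. [e i] = c @ d" using c' elim by auto
        qed
      qed
    qed
    show "\<exists>l. eventually (\<lambda>i. st (pth v [e i]) * (pth v a * st (pth v b)) * pth v [e i] =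
        l \<cdot> vt (endv E v [e i])) cofinite"
    proof (cases "a = [] \<and> b = []")
      case True
      have "st (pth v [e i]) * (pth v a * st (pth v b)) * pth v [e i] = 1 \<cdot> vt (endv E v [e i])" for i
      proof -
        have "vt v * pth v [e i] = pth v [e i]" by (rule vt_pth[OF P])
        thus ?thesis using True st_pth_pth[OF P[of i]] v
          by (simp add: st_vt vt_vt mult.assoc sc_one del: pth.simps(2))
      qed
      thus ?thesis by (intro exI[of _ 1]) simp
    next
      case False
      have "eventually (\<lambda>i. st (pth v [e i]) * (pth v a * st (pth v b)) * pth v [e i] = 0) cofinite"
      proof (cases "a = []")
        case True
        hence "eventually (\<lambda>i. st (pth v [e i]) * pth v b = 0) cofinite" using False z b by blast
        thus ?thesis
        proof eventually_elim
          case (elim i)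
          hence "st (pth v b) * pth v [e i] = 0" by (metis st_mult st_st st_zero)
          thus ?case by (simp add: mult.assoc del: pth.simps)
        qed
      next
        case a': False
        from z[OF a a'] show ?thesis by eventually_elim (simp add: mult.assoc[symmetric] del: pth.simps)
      qed
      thus ?thesis by (intro exI[of _ 0]) simp
    qed
  qed (use P e(1) in \<open>auto simp: inj_def\<close>)
qed

lemma vpath_inf_path:
  assumes "is_inf_path E p" shows "vpath E (src E (p 0)) (map p [0..<n])" "endv E (src E (p 0)) (map p [0..<n]) = src E (p n)"
proof -
  have p: "p i \<in> edges E" "rng E (p i) = src E (p (Suc i))" for i
    using assms by (auto simp: is_inf_path_def)
  have "vpath E (src E (p 0)) (map p [0..<n]) \<and> endv E (src E (p 0)) (map p [0..<n]) = src E (p n)"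
    by (induction n) (use p wf in \<open>auto simp: vpath_append\<close>)
  thus "vpath E (src E (p 0)) (map p [0..<n])" "endv E (src E (p 0)) (map p [0..<n]) = src E (p n)" by auto
qed

text \<open>The family follows p up to an exit and then leaves it. As exits do not occur on p, these
  paths are incomparable, and a monomial acts on almost all of them as 0 unless both of its paths
  are initial segments of p.\<close>

lemma finitely_many_exits:
  assumes W: "vertex_corners_baer" and p: "is_inf_path E p"
    and exits: "\<And>N. \<exists>n\<ge>N. \<exists>f\<in>emits E (src E (p n)). f \<notin> range p"
  shows False
proof -
  define B where "B = {n. \<exists>f\<in>emits E (src E (p n)). f \<notin> range p}"
  have "infinite B"
  proof
    assume "finite B"
    then obtain N where "\<And>n. n \<in> B \<Longrightarrow> n < N" unfolding finite_nat_set_iff_bounded by blast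
    thus False using exits[of N] by (fastforce simp: B_def)
  qed
  then obtain n :: "nat \<Rightarrow> nat" where n: "inj n" "range n \<subseteq> B" using infinite_countable_subset by blast
  hence "\<forall>i. \<exists>f. f \<in> emits E (src E (p (n i))) \<and> f \<notin> range p" by (auto simp: B_def)
  then obtain f where f: "\<And>i. f i \<in> emits E (src E (p (n i)))" "\<And>i. f i \<notin> range p" by metis
  define v where "v = src E (p 0)"
  define P where "P i = map p [0..<n i] @ [f i]" for i
  have lenP: "length (P i) = Suc (n i)" for i by (simp add: P_def)
  have P: "vpath E v (P i)" for i
    using vpath_inf_path[OF p, of "n i"] f(1)[of i] wf by (simp add: P_def v_def vpath_append emits_def)
  show False
  proof (rule no_path_family[OF W P])
    fix i j :: nat and c assume "i \<noteq> j"
    hence nn: "n i \<noteq> n j" using n(1) by (auto simp: inj_def)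
    show "P j \<noteq> P i @ c"
    proof
      assume e: "P j = P i @ c"
      have "n i < n j" using arg_cong[OF e, of length] nn by (simp add: lenP)
      hence "P j ! n i = p (n i)" by (simp add: P_def nth_append)
      moreover have "(P i @ c) ! n i = f i" by (simp add: P_def nth_append)
      ultimately show False using e f(2)[of i] by auto
    qed
  next
    fix a b assume a: "vpath E v a" and b: "vpath E v b" and ab: "endv E v a = endv E v b"
    have large: "eventually (\<lambda>i. n i \<ge> N) cofinite" for N
    proof -
      have "{i. \<not> n i \<ge> N} = n -` {..<N}" by auto
      thus ?thesis using finite_vimageI[OF _ n(1), of "{..<N}"] by (simp add: eventually_cofinite)
    qed
    have z: "eventually (\<lambda>i. st (pth v (P i)) * pth v c = 0) cofinite"
      if c: "vpath E v c" "c \<noteq> map p [0..<length c]" for c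
      using large[of "length c"]
    proof eventually_elim
      case (elim i)
      show ?case
      proof (rule st_pth_incomparable[OF P c(1)])
        show "\<nexists>d. c = P i @ d" using elim lenP[of i] by auto
        show "\<nexists>d. P i = c @ d"
        proof
          assume "\<exists>d. P i = c @ d"
          hence "c = take (length c) (P i)" by auto
          also have "\<dots> = map p [0..<length c]" using elim by (simp add: P_def take_map)
          finally show False using c(2) by simp
        qed
      qed
    qed
    consider "a \<noteq> map p [0..<length a]" | "b \<noteq> map p [0..<length b]"
      | "a = map p [0..<length a]" "b = map p [0..<length b]" by blast
    thus "\<exists>l. eventually (\<lambda>i. st (pth v (P i)) * (pth v a * st (pth v b)) * pth v (P i) =
        l \<cdot> vt (endv E v (P i))) cofinite"
    proof cases
      case 1
      from z[OF a 1] have "eventually (\<lambda>i. st (pth v (P i)) * (pth v a * st (pth v b)) * pth v (P i) =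
        0 \<cdot> vt (endv E v (P i))) cofinite"
        by eventually_elim (simp add: mult.assoc[symmetric])
      thus ?thesis by blast
    next
      case 2
      from z[OF b 2] have "eventually (\<lambda>i. st (pth v (P i)) * (pth v a * st (pth v b)) * pth v (P i) =
        0 \<cdot> vt (endv E v (P i))) cofinite"
      proof eventually_elim
        case (elim i)
        hence "st (pth v b) * pth v (P i) = 0" by (metis st_mult st_st st_zero)
        thus ?case by (simp add: mult.assoc)
      qed
      thus ?thesis by blast
    next
      case 3
      \<comment> \<open>The monomial of two initial segments compares the remaining stretches of
        \<open>P i\<close> from two positions on p: equal lengths give the same stretch and the
        scalar 1, different lengths give incomparable ones and 0.\<close>
      define l :: 'k where "l = (if length a = length b then 1 else 0)"
      have "eventually (\<lambda>i. st (pth v (P i)) * (pth v a * st (pth v b)) * pth v (P i) =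
        l \<cdot> vt (endv E v (P i))) cofinite"
        using large[of "length a + length b"]
      proof eventually_elim
        case (elim i)
        define T where "T k = map p [k..<n i] @ [f i]" for k
        have split: "P i = map p [0..<k] @ T k" if "k \<le> n i" for k
          using that by (simp add: P_def T_def map_append[symmetric] upt_add_eq_append[symmetric] del: map_append)
            (metis le_add_diff_inverse upt_add_eq_append zero_le)
        define z where "z = endv E v a"
        have Pa: "P i = a @ T (length a)" and Pb: "P i = b @ T (length b)"
          using split[of "length a"] split[of "length b"] elim 3 by auto
        have vz: "vpath E z (T (length a))" "vpath E z (T (length b))"
          using P[of i] Pa Pb ab z_def wf by (metis vpath_append)+
        have "st (pth v (P i)) * pth v a = st (pth z (T (length a)))"
          using st_append_pth[of v a "T (length a)"] P[of i] Pa z_def by simp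
        moreover have "st (pth v b) * pth v (P i) = pth z (T (length b))"
          using st_pth_append[of v b "T (length b)"] P[of i] Pb ab z_def by simp
        ultimately have e: "st (pth v (P i)) * (pth v a * st (pth v b)) * pth v (P i) =
          st (pth z (T (length a))) * pth z (T (length b))" by (metis mult.assoc)
        show ?case
        proof (cases "length a = length b")
          case True
          have "endv E z (T (length a)) = endv E v (P i)" using Pa z_def by simp
          thus ?thesis using e True st_pth_pth[OF vz(1)] by (simp add: l_def sc_one)
        next
          case False
          \<comment> \<open>Where the shorter stretch already reads the exit \<open>f i\<close>, the
            longer one still reads an edge of p.\<close>
          have no: "T k' \<noteq> T k @ d" if "k' \<noteq> k" "k \<le> n i" "k' \<le> n i" for k k' d
          proof
            assume eq: "T k' = T k @ d"
            have "k' < k" using arg_cong[OF eq, of length] that by (simp add: T_def)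
            hence "n i - k < n i - k'" using that by linarith
            hence "T k' ! (n i - k) = p (k' + (n i - k))" by (simp add: T_def nth_append)
            moreover have "(T k @ d) ! (n i - k) = f i" by (simp add: T_def nth_append)
            ultimately show False using eq f(2)[of i] by auto
          qed
          have "st (pth z (T (length a))) * pth z (T (length b)) = 0"
            using no[of "length b" "length a"] no[of "length a" "length b"] False elim
            by (intro st_pth_incomparable vz) auto
          thus ?thesis using e False by (simp add: l_def)
        qed
      qed
      thus ?thesis by blast
    qed
  qed
qed

text \<open>A cycle with an exit and an infinite path without a proper end both give an infinite
  path with exits arbitrarily far out, which \<open>finitely_many_exits\<close> excludes.\<close>

theorem vertex_corners_baer_graph_cond:
  assumes W: "vertex_corners_baer" shows "graph_cond E"
proof -
  have rf: "row_finite E"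
    using finite_emitters[OF W] by (auto simp: row_finite_def regular_vertex_def sink_def)
  have ne: "no_exit E"
    unfolding no_exit_def
  proof (intro allI impI, rule ccontr)
    fix c i assume c: "is_cycle E c" and i: "i < length c" and card: "card (emits E (src E (c ! i))) \<noteq> 1"
    have "c ! i \<in> emits E (src E (c ! i))" using c i by (auto simp: is_cycle_def is_path_def emits_def)
    moreover have "emits E (src E (c ! i)) \<noteq> {c ! i}" using card by auto
    ultimately obtain f where f: "f \<in> emits E (src E (c ! i))" "f \<noteq> c ! i" by blast
    define p where "p k = c ! ((i + k) mod length c)" for k
    have fp: "f \<notin> range p"
    proof
      assume "f \<in> range p"
      then obtain k where k: "f = c ! (k mod length c)" by (auto simp: p_def)
      have "inj_on (\<lambda>i. src E (c ! i)) {..<length c}" using c by (simp add: is_cycle_def)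
      moreover have "src E (c ! (k mod length c)) = src E (c ! i)" using f(1) k by (simp add: emits_def)
      moreover have "k mod length c < length c" using i by (intro mod_less_divisor) linarith
      ultimately have "k mod length c = i" using i by (auto dest: inj_onD)
      thus False using k f(2) by simp
    qed
    \<comment> \<open>The position \<open>N * length c\<close> is back at the vertex
      \<open>src E (c ! i)\<close>, where the same exit f is available on every lap.\<close>
    have "\<exists>n\<ge>N. \<exists>f\<in>emits E (src E (p n)). f \<notin> range p" for N
    proof (intro exI conjI)
      show "N \<le> N * length c" using i by (cases "length c") auto
      show "\<exists>f\<in>emits E (src E (p (N * length c))). f \<notin> range p" using f fp i by (auto simp: p_def)
    qed
    moreover have "is_inf_path E p" unfolding p_def by (rule inf_path_mod_cycle[OF c])
    ultimately show False using finitely_many_exits[OF W] by blast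
  qed
  have "ends_in_sink_or_cycle E p" if p: "is_inf_path E p" for p
  proof (rule ccontr)
    assume no: "\<not> ends_in_sink_or_cycle E p"
    \<comment> \<open>Given the no-exit condition just proved, a repeated vertex would make p end in
      a cycle. With all sources distinct, an edge other than \<open>p n\<close> out of a vertex of p
      cannot lie on p.\<close>
    have inj: "src E (p i) \<noteq> src E (p j)" if "i < j" for i j
      using no_exit_repeat_ends_in_cycle[OF ne p that] no by blast
    have nocyc: "\<not> is_cycle E (map p [i..<Suc j])" if "i \<le> j" for i j
    proof
      assume "is_cycle E (map p [i..<Suc j])"
      hence "src E (hd (map p [i..<Suc j])) = rng E (last (map p [i..<Suc j]))" by (simp add: is_cycle_def)
      moreover have "hd (map p [i..<Suc j]) = p i" using that by (simp add: hd_map del: upt_Suc)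
      ultimately have "src E (p i) = rng E (p j)" using that by simp
      also have "\<dots> = src E (p (Suc j))" using p by (simp add: is_inf_path_def)
      finally show False using inj[of i "Suc j"] that by simp
    qed
    have "\<exists>n\<ge>N. \<exists>f\<in>emits E (src E (p n)). f \<notin> range p" for N
    proof -
      have "\<not> (\<forall>i\<ge>N. emits E (src E (p i)) = {p i})"
        using no nocyc unfolding ends_in_sink_or_cycle_def by blast
      then obtain n where n: "n \<ge> N" "emits E (src E (p n)) \<noteq> {p n}" by blast
      moreover have "p n \<in> emits E (src E (p n))" using p by (simp add: is_inf_path_def emits_def)
      ultimately obtain f where f: "f \<in> emits E (src E (p n))" "f \<noteq> p n" by blast
      have "f \<notin> range p"
      proof
        assume "f \<in> range p"
        then obtain k where "f = p k" by blast
        moreover from this have "k \<noteq> n" "src E (p k) = src E (p n)" using f by (auto simp: emits_def)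
        ultimately show False using inj[of k n] inj[of n k] by (cases "k < n") auto
      qed
      thus ?thesis using n f by blast
    qed
    thus False using finitely_many_exits[OF W p] by blast
  qed
  thus ?thesis using rf ne by (simp add: graph_cond_def)
qed


section \<open>From annihilators to the Baer properties\<close>

lemma has_unit_corner: "e \<in> A \<Longrightarrow> e * e = e \<Longrightarrow> has_unit (corner A (*) e) (*)"
  unfolding has_unit_def by (auto simp: corner_eq intro!: bexI[of _ e])

text \<open>A homogeneous idempotent of degree n also has degree n + n, so it is zero unless n = 0.
  Hence \<open>idem\<close> may ask for degree 0.\<close>

lemma hom_idem_degree_0: "cmp n p = p \<Longrightarrow> p * p = p \<Longrightarrow> cmp 0 p = p"
  using hom_mult[of n p n p] hom_other[of n p "n + n"] by (cases "n = 0") auto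

lemma baer_iff: "C \<subseteq> A \<Longrightarrow> baer C (*) 0 \<longleftrightarrow> has_unit C (*) \<and> annihilators_idem False False C"
  unfolding baer_def annihilators_idem_def idem_def adm_def by (auto simp: subset_iff)

lemma gr_baer_iff:
  "C \<subseteq> A \<Longrightarrow> gr_baer C (*) 0 (\<lambda>x. \<exists>n. cmp n x = x) \<longleftrightarrow> has_unit C (*) \<and> annihilators_idem True False C"
proof -
  assume C: "C \<subseteq> A"
  have "(\<exists>n. cmp n p = p) \<and> p * p = p \<longleftrightarrow> idem True False p" if "p \<in> C" for p
    using that C hom_idem_degree_0 unfolding idem_def by blast
  hence "(\<exists>p\<in>C. (\<exists>n. cmp n p = p) \<and> p * p = p \<and> Q p) \<longleftrightarrow> (\<exists>p\<in>C. idem True False p \<and> Q p)" for Q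
    by blast
  thus ?thesis unfolding gr_baer_def annihilators_idem_def adm_def by simp
qed

lemma gr_baer_star_iff:
  "C \<subseteq> A \<Longrightarrow> gr_baer_star C (*) 0 st (\<lambda>x. \<exists>n. cmp n x = x) \<longleftrightarrow> annihilators_idem True True C"
proof -
  assume C: "C \<subseteq> A"
  have "(\<exists>n. cmp n p = p) \<and> p * p = p \<and> st p = p \<longleftrightarrow> idem True True p" if "p \<in> C" for p
    using that C hom_idem_degree_0 unfolding idem_def by blast
  hence "(\<exists>p\<in>C. (\<exists>n. cmp n p = p) \<and> p * p = p \<and> st p = p \<and> Q p) \<longleftrightarrow> (\<exists>p\<in>C. idem True True p \<and> Q p)" for Q
    by blast
  thus ?thesis unfolding gr_baer_star_def annihilators_idem_def adm_def by simp
qed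

text \<open>Vertices are projections of degree 0, so each of the local properties applies to their
  corners.\<close>

lemma local_characterization:
  assumes "s \<Longrightarrow> h \<and> positive_definite \<sigma>"
  shows "graph_cond E \<longleftrightarrow> (\<forall>e. idem h s e \<longrightarrow> annihilators_idem h s (corner A (*) e))"
  using graph_cond_annihilators_idem[of s h, OF _ assms] idem_vt
    vertex_corners_baer_graph_cond[OF vertex_corners_baer_local[of h s]] by blast

lemma unital_characterization:
  assumes "s \<Longrightarrow> h \<and> positive_definite \<sigma>"
  shows "finite_graph E \<and> no_exit E \<longleftrightarrow> has_unit A (*) \<and> annihilators_idem h s A"
proof
  assume g: "finite_graph E \<and> no_exit E"
  hence gc: "graph_cond E" using finite_no_exit_graph_cond wf by blast
  have fin: "finite (verts E)" using g by (simp add: finite_graph_def)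
  let ?u = "local_unit (verts E)"
  note u = finite_verts_unit[OF fin] local_unit_A[of "verts E", simplified]
  have "idem h s ?u"
    using frame_props[OF frame_local_unit[OF gc fin]] by (simp add: idem_def)
  from graph_cond_annihilators_idem[OF gc assms this] show "has_unit A (*) \<and> annihilators_idem h s A"
    using corner_unit[of ?u] u by (auto simp: has_unit_def)
next
  assume a: "has_unit A (*) \<and> annihilators_idem h s A"
  then obtain u where u: "u \<in> A" "\<And>x. x \<in> A \<Longrightarrow> u * x = x \<and> x * u = x" by (auto simp: has_unit_def)
  have "graph_cond E"
    using vertex_corners_baer_graph_cond[OF vertex_corners_baer_unital[OF u]] a by blast
  thus "finite_graph E \<and> no_exit E"
    using unit_finite_verts[OF u] by (simp add: finite_graph_def graph_cond_def)
qed

text \<open>The definition of a graded Baer star-ring mentions no unit; it comes from the empty set,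
  whose annihilator is everything. Its generator is a left unit, and being self-adjoint also a right
  one.\<close>

lemma star_unit:
  assumes "annihilators_idem h True A" shows "has_unit A (*)"
proof -
  from assms have "\<exists>p\<in>A. idem h True p \<and> rann A (*) 0 {} = (*) p ` A"
    unfolding annihilators_idem_def by blast
  then obtain p where p: "p \<in> A" "idem h True p" "A = (*) p ` A" by (auto simp: rann_def)
  have 1: "p * x = x" if x: "x \<in> A" for x
  proof -
    have "x \<in> (*) p ` A" using x p(3) by blast
    then obtain y where "x = p * y" by blast
    thus ?thesis using p(2) by (simp add: idem_def mult.assoc[symmetric])
  qed
  moreover have "x * p = x" if x: "x \<in> A" for x
    using 1[OF A_st[OF x]] p(2) by (metis idem_def st_mult st_st)
  ultimately show ?thesis using p(1) by (auto simp: has_unit_def)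
qed

theorem baer_characterizations:
  "graph_cond E \<longleftrightarrow> locally_baer A (*) 0"
  "graph_cond E \<longleftrightarrow> gr_locally_baer A (*) 0 (\<lambda>x. \<exists>n. cmp n x = x)"
  "positive_definite \<sigma> \<Longrightarrow> graph_cond E \<longleftrightarrow> gr_locally_baer_star A (*) 0 st (\<lambda>x. \<exists>n. cmp n x = x)"
  "finite_graph E \<and> no_exit E \<longleftrightarrow> baer A (*) 0"
  "finite_graph E \<and> no_exit E \<longleftrightarrow> gr_baer A (*) 0 (\<lambda>x. \<exists>n. cmp n x = x)"
  "positive_definite \<sigma> \<Longrightarrow> finite_graph E \<and> no_exit E \<longleftrightarrow> gr_baer_star A (*) 0 st (\<lambda>x. \<exists>n. cmp n x = x)"
proof -
  have CA: "corner A (*) e \<subseteq> A" if "e \<in> A" for e using that by (auto simp: corner_def A_mult)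
  have "locally_baer A (*) 0 \<longleftrightarrow> (\<forall>e. idem False False e \<longrightarrow> annihilators_idem False False (corner A (*) e))"
    unfolding locally_baer_def idem_def using has_unit_corner CA baer_iff by auto
  thus "graph_cond E \<longleftrightarrow> locally_baer A (*) 0" using local_characterization[of False False] by simp
  have idem_iff: "idem True s e \<longleftrightarrow> e \<in> A \<and> (\<exists>n. cmp n e = e) \<and> e * e = e \<and> (s \<longrightarrow> st e = e)" for s e
    using hom_idem_degree_0 unfolding idem_def by blast
  have "gr_locally_baer A (*) 0 (\<lambda>x. \<exists>n. cmp n x = x) \<longleftrightarrow>
      (\<forall>e. idem True False e \<longrightarrow> annihilators_idem True False (corner A (*) e))"
    unfolding gr_locally_baer_def idem_iff using has_unit_corner CA gr_baer_iff by auto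
  thus "graph_cond E \<longleftrightarrow> gr_locally_baer A (*) 0 (\<lambda>x. \<exists>n. cmp n x = x)"
    using local_characterization[of False True] by simp
  have "gr_locally_baer_star A (*) 0 st (\<lambda>x. \<exists>n. cmp n x = x) \<longleftrightarrow>
      (\<forall>e. idem True True e \<longrightarrow> annihilators_idem True True (corner A (*) e))"
    unfolding gr_locally_baer_star_def idem_iff using CA gr_baer_star_iff by auto
  thus "positive_definite \<sigma> \<Longrightarrow> graph_cond E \<longleftrightarrow> gr_locally_baer_star A (*) 0 st (\<lambda>x. \<exists>n. cmp n x = x)"
    using local_characterization[of True True] by simp
  show "finite_graph E \<and> no_exit E \<longleftrightarrow> baer A (*) 0"
    using unital_characterization[of False False] by (simp add: baer_iff)
  show "finite_graph E \<and> no_exit E \<longleftrightarrow> gr_baer A (*) 0 (\<lambda>x. \<exists>n. cmp n x = x)"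
    using unital_characterization[of False True] by (simp add: gr_baer_iff)
  show "positive_definite \<sigma> \<Longrightarrow> finite_graph E \<and> no_exit E \<longleftrightarrow> gr_baer_star A (*) 0 st (\<lambda>x. \<exists>n. cmp n x = x)"
    using unital_characterization[of True True] star_unit by (auto simp: gr_baer_star_iff)
qed

end

section \<open>The free algebra and its ideal\<close>

definition fa_comp :: "int \<Rightarrow> ('v,'e,'k::comm_ring_1) fa \<Rightarrow> ('v,'e,'k) fa" where
  "fa_comp n f = (\<lambda>w. if wdeg w = n then f w else 0)"

definition wstar :: "('v,'e) gen list \<Rightarrow> ('v,'e) gen list" where
  "wstar w = rev (map gswap w)"

lemma gswap_gswap [simp]: "gswap (gswap x) = x"
  by (cases x) auto

lemma wstar_wstar [simp]: "wstar (wstar w) = w"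
  by (simp add: wstar_def rev_map comp_def)

lemma fa_star_wstar: "fa_star \<sigma> f = (\<lambda>w. \<sigma> (f (wstar w)))"
  by (simp add: fa_star_def wstar_def)

lemma gen_ok_gswap [simp]: "gen_ok E (gswap x) = gen_ok E x"
  by (cases x) (auto simp: gen_ok_def)

lemma wstar_ok: "set (wstar w) \<subseteq> Collect (gen_ok E) \<longleftrightarrow> set w \<subseteq> Collect (gen_ok E)"
  by (auto simp: wstar_def)

lemma wdeg_append [simp]: "wdeg (u @ w) = wdeg u + wdeg w"
  by (simp add: wdeg_def)

lemma gdeg_gswap [simp]: "gdeg (gswap x) = - gdeg x"
  by (cases x) auto

lemma wdeg_wstar [simp]: "wdeg (wstar w) = - wdeg w"
  by (induction w) (auto simp: wdeg_def wstar_def)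

lemmas fa_simps = fa_zero_def fa_add_def fa_diff_def fa_smult_def

lemma fa_mult_add_left: "fa_mult (fa_add f g) h = fa_add (fa_mult f h) (fa_mult g h)"
  by (simp add: fa_mult_def fa_add_def fun_eq_iff distrib_right sum.distrib)

lemma fa_mult_add_right: "fa_mult f (fa_add g h) = fa_add (fa_mult f g) (fa_mult f h)"
  by (simp add: fa_mult_def fa_add_def fun_eq_iff distrib_left sum.distrib)

lemma fa_mult_diff_left: "fa_mult (fa_diff f g) h = fa_diff (fa_mult f h) (fa_mult g h)"
  by (simp add: fa_mult_def fa_diff_def fun_eq_iff left_diff_distrib sum_subtractf)

lemma fa_mult_diff_right: "fa_mult f (fa_diff g h) = fa_diff (fa_mult f g) (fa_mult f h)"
  by (simp add: fa_mult_def fa_diff_def fun_eq_iff right_diff_distrib sum_subtractf)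

lemma fa_mult_smult_left: "fa_mult (fa_smult c f) h = fa_smult c (fa_mult f h)"
  by (simp add: fa_mult_def fa_smult_def fun_eq_iff sum_distrib_left mult.assoc)

lemma fa_mult_smult_right: "fa_mult f (fa_smult c h) = fa_smult c (fa_mult f h)"
  by (simp add: fa_mult_def fa_smult_def fun_eq_iff sum_distrib_left mult_ac)

lemma fa_mult_zero: "fa_mult fa_zero f = fa_zero" "fa_mult f fa_zero = fa_zero"
  by (simp_all add: fa_mult_def fa_zero_def)

lemma fa_mult_assoc: "fa_mult (fa_mult f g) h = fa_mult f (fa_mult g h)"
proof
  fix w :: "('a, 'b) gen list"
  let ?n = "length w"
  \<comment> \<open>A word is cut into pieces of length j, k and the rest; both bracketings sum over
    all pairs with j + k at most the length.\<close>
  define G where "G j k = f (take j w) * g (take k (drop j w)) * h (drop (j + k) w)" for j k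
  have "fa_mult (fa_mult f g) h w = (\<Sum>i\<le>?n. \<Sum>j\<le>i. G j (i - j))"
    unfolding fa_mult_def sum_distrib_right
    by (intro sum.cong refl) (auto simp: G_def min_def drop_take)
  also have "\<dots> = (\<Sum>(j, k)\<in>{(j, k). j + k \<le> ?n}. G j k)"
    by (rule sum.triangle_reindex_eq[symmetric])
  also have "{(j, k). j + k \<le> ?n} = Sigma {..?n} (\<lambda>j. {..?n - j})" by auto
  also have "(\<Sum>(j, k)\<in>\<dots>. G j k) = (\<Sum>j\<le>?n. \<Sum>k\<le>?n - j. G j k)"
    by (subst sum.Sigma) auto
  also have "\<dots> = fa_mult f (fa_mult g h) w"
    unfolding fa_mult_def sum_distrib_left
    by (intro sum.cong refl) (auto simp: G_def mult.assoc add.commute)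
  finally show "fa_mult (fa_mult f g) h w = fa_mult f (fa_mult g h) w" .
qed

lemma fa_mono_mult: "fa_mult (fa_mono u) g w = (if take (length u) w = u then g (drop (length u) w) else 0)"
proof (cases "take (length u) w = u")
  case True
  hence le: "length u \<le> length w" using arg_cong[OF True, of length] unfolding length_take by linarith
  have "(\<Sum>i\<le>length w. fa_mono u (take i w) * g (drop i w)) =
    (\<Sum>i\<le>length w. if i = length u then g (drop i w) else 0)"
  proof (rule sum.cong[OF refl])
    fix i assume "i \<in> {..length w}"
    hence "take i w = u \<longleftrightarrow> i = length u" using True by auto
    thus "fa_mono u (take i w) * g (drop i w) = (if i = length u then g (drop i w) else 0)"
      by (simp add: fa_mono_def)
  qed
  thus ?thesis using True le by (simp add: fa_mult_def)
next
  case False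
  have "take i w \<noteq> u" if "i \<le> length w" for i using that False by auto
  thus ?thesis using False by (simp add: fa_mult_def fa_mono_def)
qed

lemma fa_mult_mono_mono: "fa_mult (fa_mono u) (fa_mono w) = fa_mono (u @ w)"
proof
  fix v
  have "v = u @ w \<longleftrightarrow> take (length u) v = u \<and> drop (length u) v = w"
    using append_eq_conv_conj[of u w v] by auto
  thus "fa_mult (fa_mono u) (fa_mono w) v = fa_mono (u @ w) v"
    unfolding fa_mono_mult by (simp add: fa_mono_def)
qed

lemma fa_mono_mult_append: "fa_mult (fa_mono u) g (u @ w) = g w"
  by (simp add: fa_mono_mult)

lemma fa_mult_mono_append: "fa_mult g (fa_mono u) (w @ u) = g w"
proof -
  have "(\<Sum>i\<le>length (w @ u). g (take i (w @ u)) * fa_mono u (drop i (w @ u))) =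
    (\<Sum>i\<le>length (w @ u). if i = length w then g w else 0)"
  proof (rule sum.cong[OF refl])
    fix i assume "i \<in> {..length (w @ u)}"
    hence "drop i (w @ u) = u \<longleftrightarrow> i = length w"
      using length_drop[of i "w @ u"] by (auto simp del: length_drop drop_append) auto
    thus "g (take i (w @ u)) * fa_mono u (drop i (w @ u)) = (if i = length w then g w else 0)"
      by (simp add: fa_mono_def)
  qed
  thus ?thesis by (simp add: fa_mult_def)
qed

lemma fa_mult_support: "fa_mult f g w \<noteq> 0 \<Longrightarrow> \<exists>u v. w = u @ v \<and> f u \<noteq> 0 \<and> g v \<noteq> 0"
proof -
  assume "fa_mult f g w \<noteq> 0"
  hence "(\<Sum>i\<le>length w. f (take i w) * g (drop i w)) \<noteq> 0" by (simp add: fa_mult_def)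
  then obtain i where "f (take i w) * g (drop i w) \<noteq> 0"
    by (rule sum.not_neutral_contains_not_neutral)
  thus ?thesis by (intro exI[of _ "take i w"] exI[of _ "drop i w"]) auto
qed

lemma fa_mono_nil_mult: "fa_mult (fa_mono []) g = g" "fa_mult g (fa_mono []) = g"
  using fa_mono_mult_append[of "[]" g] fa_mult_mono_append[of g "[]"] by auto

lemma FA_zero: "fa_zero \<in> FA E"
  by (simp add: FA_def fa_zero_def)

lemma FA_add: "f \<in> FA E \<Longrightarrow> g \<in> FA E \<Longrightarrow> fa_add f g \<in> FA E"
proof -
  assume a: "f \<in> FA E" "g \<in> FA E"
  have "{w. f w + g w \<noteq> 0} \<subseteq> {w. f w \<noteq> 0} \<union> {w. g w \<noteq> 0}" by auto
  moreover have "finite ({w. f w \<noteq> 0} \<union> {w. g w \<noteq> 0})" using a by (simp add: FA_def)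
  ultimately have "finite {w. f w + g w \<noteq> 0}" by (rule finite_subset)
  moreover have "f w \<noteq> 0 \<or> g w \<noteq> 0" if "f w + g w \<noteq> 0" for w using that by auto
  hence "set w \<subseteq> Collect (gen_ok E)" if "f w + g w \<noteq> 0" for w
    using a that unfolding FA_def by blast
  ultimately show ?thesis using a by (simp add: FA_def fa_add_def)
qed

lemma FA_support:
  assumes f: "f \<in> FA E" and g: "\<And>w. g w \<noteq> 0 \<Longrightarrow> f w \<noteq> 0" shows "g \<in> FA E"
proof -
  have "{w. g w \<noteq> 0} \<subseteq> {w. f w \<noteq> 0}" using g by blast
  hence "finite {w. g w \<noteq> 0}" by (rule finite_subset) (use f in \<open>simp add: FA_def\<close>)
  thus ?thesis using f g unfolding FA_def by blast
qed

lemma FA_smult: "f \<in> FA E \<Longrightarrow> fa_smult c f \<in> FA E"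
  by (erule FA_support) (auto simp: fa_smult_def)

lemma FA_comp: "f \<in> FA E \<Longrightarrow> fa_comp n f \<in> FA E"
  by (erule FA_support) (auto simp: fa_comp_def split: if_splits)

lemma FA_mono: "w \<noteq> [] \<Longrightarrow> set w \<subseteq> Collect (gen_ok E) \<Longrightarrow> fa_mono w \<in> FA E"
  by (auto simp: FA_def fa_mono_def)

lemma FA_mult: "f \<in> FA E \<Longrightarrow> g \<in> FA E \<Longrightarrow> fa_mult f g \<in> FA E"
proof -
  assume a: "f \<in> FA E" "g \<in> FA E"
  have "{w. fa_mult f g w \<noteq> 0} \<subseteq> (\<lambda>(u, v). u @ v) ` ({w. f w \<noteq> 0} \<times> {w. g w \<noteq> 0})"
    using fa_mult_support[of f g] by force
  moreover have "finite ({w. f w \<noteq> 0} \<times> {w. g w \<noteq> 0})" using a by (simp add: FA_def)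
  ultimately have "finite {w. fa_mult f g w \<noteq> 0}" using finite_surj by blast
  moreover have "fa_mult f g [] = 0" using a by (simp add: FA_def fa_mult_def)
  moreover have "set w \<subseteq> Collect (gen_ok E)" if nz: "fa_mult f g w \<noteq> 0" for w
  proof -
    obtain u v where "w = u @ v" "f u \<noteq> 0" "g v \<noteq> 0" using fa_mult_support[OF nz] by blast
    thus ?thesis using a by (simp add: FA_def)
  qed
  ultimately show ?thesis by (simp add: FA_def)
qed

lemma FA_induct [consumes 1, case_names zero mono add]:
  assumes "f \<in> FA E" and zero: "P fa_zero"
    and mono: "\<And>c w. w \<noteq> [] \<Longrightarrow> set w \<subseteq> Collect (gen_ok E) \<Longrightarrow> P (fa_smult c (fa_mono w))"
    and add: "\<And>f g. f \<in> FA E \<Longrightarrow> g \<in> FA E \<Longrightarrow> P f \<Longrightarrow> P g \<Longrightarrow> P (fa_add f g)"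
  shows "P f"
proof -
  have "\<And>f. f \<in> FA E \<Longrightarrow> {w. f w \<noteq> 0} = S \<Longrightarrow> P f" if "finite S" for S
    using that
  proof (induction S rule: finite_induct)
    case empty
    hence "f = fa_zero" by (auto simp: fa_zero_def)
    thus ?case using zero by simp
  next
    case (insert w S)
    have w: "w \<noteq> []" "set w \<subseteq> Collect (gen_ok E)"
      using insert.prems by (auto simp: FA_def)
    define g where "g = f(w := 0)"
    have gS: "{v. g v \<noteq> 0} = S" using insert.prems(2) insert.hyps(2) by (auto simp: g_def)
    have gFA: "g \<in> FA E" using insert.prems insert.hyps(1) gS by (auto simp: FA_def g_def)
    have "f = fa_add (fa_smult (f w) (fa_mono w)) g"
      by (auto simp: fa_simps fa_mono_def g_def)
    moreover have "P (fa_smult (f w) (fa_mono w))" by (rule mono[OF w])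
    moreover have "P g" by (rule insert.IH[OF gFA gS])
    ultimately show ?case using add[OF FA_smult[OF FA_mono[OF w]] gFA] by metis
  qed
  moreover have "finite {w. f w \<noteq> 0}" using assms(1) by (simp add: FA_def)
  ultimately show ?thesis using assms(1) by blast
qed

section \<open>The ideal of the relations\<close>

lemma lideal_smult: "a \<in> lideal E \<Longrightarrow> fa_smult c a \<in> lideal E"
proof (induction rule: lideal.induct)
  case zero thus ?case using lideal.zero by (simp add: fa_simps)
next
  case (gen \<rho> u w d)
  have "fa_smult c (fa_smult d (fa_mult (fa_mult (fa_mono u) \<rho>) (fa_mono w))) =
    fa_smult (c * d) (fa_mult (fa_mult (fa_mono u) \<rho>) (fa_mono w))"
    by (simp add: fa_smult_def mult.assoc)
  thus ?case using lideal.gen[OF gen] by simp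
next
  case (add a b)
  have "fa_smult c (fa_add a b) = fa_add (fa_smult c a) (fa_smult c b)"
    by (simp add: fa_simps distrib_left)
  thus ?case using add lideal.add by metis
qed

lemma lideal_mono_left: "a \<in> lideal E \<Longrightarrow> set v \<subseteq> Collect (gen_ok E) \<Longrightarrow> fa_mult (fa_mono v) a \<in> lideal E"
proof (induction rule: lideal.induct)
  case (gen \<rho> u w d)
  have "fa_mult (fa_mono v) (fa_smult d (fa_mult (fa_mult (fa_mono u) \<rho>) (fa_mono w))) =
    fa_smult d (fa_mult (fa_mult (fa_mono (v @ u)) \<rho>) (fa_mono w))"
    by (simp add: fa_mult_smult_right fa_mult_mono_mono[symmetric] fa_mult_assoc)
  thus ?case using lideal.gen[OF gen(1), of "v @ u" w d] gen by simp
qed (auto simp: fa_mult_zero fa_mult_add_right intro: lideal.intros)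

lemma lideal_mono_right: "a \<in> lideal E \<Longrightarrow> set v \<subseteq> Collect (gen_ok E) \<Longrightarrow> fa_mult a (fa_mono v) \<in> lideal E"
proof (induction rule: lideal.induct)
  case (gen \<rho> u w d)
  have "fa_mult (fa_smult d (fa_mult (fa_mult (fa_mono u) \<rho>) (fa_mono w))) (fa_mono v) =
    fa_smult d (fa_mult (fa_mult (fa_mono u) \<rho>) (fa_mono (w @ v)))"
    by (simp add: fa_mult_smult_left fa_mult_mono_mono[symmetric] fa_mult_assoc)
  thus ?case using lideal.gen[OF gen(1), of u "w @ v" d] gen by simp
qed (auto simp: fa_mult_zero fa_mult_add_left intro: lideal.intros)

lemma lideal_mult_left: "f \<in> FA E \<Longrightarrow> a \<in> lideal E \<Longrightarrow> fa_mult f a \<in> lideal E"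
  by (induction rule: FA_induct)
    (auto simp: fa_mult_zero fa_mult_add_left fa_mult_smult_left intro: lideal.intros lideal_smult lideal_mono_left)

lemma lideal_mult_right: "f \<in> FA E \<Longrightarrow> a \<in> lideal E \<Longrightarrow> fa_mult a f \<in> lideal E"
  by (induction rule: FA_induct)
    (auto simp: fa_mult_zero fa_mult_add_right fa_mult_smult_right intro: lideal.intros lideal_smult lideal_mono_right)

lemma lrels_cases:
  assumes "\<rho> \<in> lrels E"
  obtains
    (vert) v w where "\<rho> = fa_diff (fa_mono [Vt v, Vt w]) (if v = w then fa_mono [Vt v] else fa_zero)" "v \<in> verts E" "w \<in> verts E"
  | (src) e where "\<rho> = fa_diff (fa_mono [Vt (src E e), Ed e]) (fa_mono [Ed e])" "e \<in> edges E"
  | (rng) e where "\<rho> = fa_diff (fa_mono [Ed e, Vt (rng E e)]) (fa_mono [Ed e])" "e \<in> edges E"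
  | (rng_gh) e where "\<rho> = fa_diff (fa_mono [Vt (rng E e), Gh e]) (fa_mono [Gh e])" "e \<in> edges E"
  | (src_gh) e where "\<rho> = fa_diff (fa_mono [Gh e, Vt (src E e)]) (fa_mono [Gh e])" "e \<in> edges E"
  | (ck1) e f where "\<rho> = fa_diff (fa_mono [Gh e, Ed f]) (if e = f then fa_mono [Vt (rng E e)] else fa_zero)" "e \<in> edges E" "f \<in> edges E"
  | (ck2) v where "\<rho> = fa_diff (fa_mono [Vt v]) (\<lambda>w. \<Sum>e\<in>emits E v. fa_mono [Ed e, Gh e] w)" "v \<in> verts E" "regular_vertex E v"
  using assms unfolding lrels_def by blast

definition fa_hom :: "int \<Rightarrow> ('v,'e,'k::comm_ring_1) fa \<Rightarrow> bool" where
  "fa_hom n f \<longleftrightarrow> (\<forall>w. f w \<noteq> 0 \<longrightarrow> wdeg w = n)"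

lemma fa_hom_mono: "wdeg w = n \<Longrightarrow> fa_hom n (fa_mono w)"
  by (simp add: fa_hom_def fa_mono_def)

lemma fa_hom_diff: "fa_hom n f \<Longrightarrow> fa_hom n g \<Longrightarrow> fa_hom n (fa_diff f g)"
  unfolding fa_hom_def fa_diff_def by (metis diff_0_right)

lemma fa_hom_zero: "fa_hom n fa_zero"
  by (simp add: fa_hom_def fa_zero_def)

lemma fa_hom_sum: "(\<And>e. e \<in> S \<Longrightarrow> fa_hom n (F e)) \<Longrightarrow> fa_hom n (\<lambda>w. \<Sum>e\<in>S. F e w)"
  unfolding fa_hom_def by (metis sum.not_neutral_contains_not_neutral)

lemma lrels_hom:
  assumes "\<rho> \<in> lrels E" shows "\<exists>n. fa_hom n \<rho>"
  using assms
proof (cases rule: lrels_cases)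
  case (src e)
  thus ?thesis by (intro exI[of _ 1]) (auto intro!: fa_hom_diff fa_hom_mono simp: wdeg_def)
next
  case (rng e)
  thus ?thesis by (intro exI[of _ 1]) (auto intro!: fa_hom_diff fa_hom_mono simp: wdeg_def)
next
  case (rng_gh e)
  thus ?thesis by (intro exI[of _ "-1"]) (auto intro!: fa_hom_diff fa_hom_mono simp: wdeg_def)
next
  case (src_gh e)
  thus ?thesis by (intro exI[of _ "-1"]) (auto intro!: fa_hom_diff fa_hom_mono simp: wdeg_def)
qed (intro exI[of _ 0]; auto intro!: fa_hom_diff fa_hom_mono fa_hom_zero fa_hom_sum simp: wdeg_def)+

text \<open>Each relation is homogeneous, so a generator of the ideal lives in one degree and its
  components are itself or zero.\<close>

lemma lideal_comp: "a \<in> lideal E \<Longrightarrow> fa_comp n a \<in> lideal E"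
proof (induction rule: lideal.induct)
  case zero thus ?case using lideal.zero by (simp add: fa_comp_def fa_zero_def)
next
  case (gen \<rho> u w d)
  obtain m where m: "\<And>w. \<rho> w \<noteq> 0 \<Longrightarrow> wdeg w = m" using lrels_hom[OF gen(1)] unfolding fa_hom_def by blast
  let ?x = "fa_smult d (fa_mult (fa_mult (fa_mono u) \<rho>) (fa_mono w))"
  have "wdeg v = wdeg u + m + wdeg w" if "?x v \<noteq> 0" for v
  proof -
    have "fa_mult (fa_mult (fa_mono u) \<rho>) (fa_mono w) v \<noteq> 0" using that by (auto simp: fa_smult_def)
    from fa_mult_support[OF this] obtain p q where p: "v = p @ q" "fa_mult (fa_mono u) \<rho> p \<noteq> 0"
      "(fa_mono w :: ('a,'b,'c) fa) q \<noteq> 0" by blast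
    from fa_mult_support[OF p(2)] obtain r s where r: "p = r @ s"
      "(fa_mono u :: ('a,'b,'c) fa) r \<noteq> 0" "\<rho> s \<noteq> 0" by blast
    show ?thesis using p r m by (auto simp: fa_mono_def split: if_splits)
  qed
  hence "fa_comp n ?x = (if n = wdeg u + m + wdeg w then ?x else fa_zero)"
    by (auto simp: fa_comp_def fa_zero_def fun_eq_iff)
  thus ?case using lideal.gen[OF gen, of d] by (cases "n = wdeg u + m + wdeg w") (simp_all add: lideal.zero)
next
  case (add a b)
  have "fa_comp n (fa_add a b) = fa_add (fa_comp n a) (fa_comp n b)"
    by (auto simp: fa_comp_def fa_add_def)
  thus ?case using add lideal.add by metis
qed

context
  fixes \<sigma> :: "'k::field \<Rightarrow> 'k"
  assumes inv: "field_involution \<sigma>"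
begin

lemmas inv_simps = field_involution_simps[OF inv]

lemma fa_star_mono: "fa_star \<sigma> (fa_mono w) = fa_mono (wstar w)"
  by (auto simp: fa_star_wstar fa_mono_def inv_simps fun_eq_iff)

lemma fa_star_add: "fa_star \<sigma> (fa_add f g) = fa_add (fa_star \<sigma> f) (fa_star \<sigma> g)"
  by (simp add: fa_star_wstar fa_add_def inv_simps)

lemma fa_star_diff: "fa_star \<sigma> (fa_diff f g) = fa_diff (fa_star \<sigma> f) (fa_star \<sigma> g)"
  by (simp add: fa_star_wstar fa_diff_def inv_simps)

lemma fa_star_zero: "fa_star \<sigma> fa_zero = fa_zero"
  by (simp add: fa_star_wstar fa_zero_def inv_simps)

lemma fa_star_smult: "fa_star \<sigma> (fa_smult c f) = fa_smult (\<sigma> c) (fa_star \<sigma> f)"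
  by (simp add: fa_star_wstar fa_smult_def inv_simps)

lemma fa_star_star: "fa_star \<sigma> (fa_star \<sigma> f) = f"
  by (simp add: fa_star_wstar inv_simps)

lemma fa_star_mult:
  fixes f g :: "('v,'e,'k) fa"
  shows "fa_star \<sigma> (fa_mult f g) = fa_mult (fa_star \<sigma> g) (fa_star \<sigma> f)"
proof
  fix w :: "('v,'e) gen list"
  have len: "length (wstar w) = length w" by (simp add: wstar_def)
  have td: "take i (wstar w) = wstar (drop (length w - i) w)" "drop i (wstar w) = wstar (take (length w - i) w)"
    for i by (simp_all add: wstar_def take_rev drop_rev take_map drop_map)
  have "fa_star \<sigma> (fa_mult f g) w =
     (\<Sum>i\<le>length w. \<sigma> (f (wstar (drop (length w - i) w))) * \<sigma> (g (wstar (take (length w - i) w))))"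
    by (simp add: fa_star_wstar fa_mult_def inv_simps len td)
  also have "\<dots> = (\<Sum>i\<le>length w. \<sigma> (f (wstar (drop i w))) * \<sigma> (g (wstar (take i w))))"
    by (rule sum.reindex_bij_witness[of _ "\<lambda>i. length w - i" "\<lambda>i. length w - i"]) auto
  also have "\<dots> = fa_mult (fa_star \<sigma> g) (fa_star \<sigma> f) w"
    by (simp add: fa_star_wstar fa_mult_def mult.commute)
  finally show "fa_star \<sigma> (fa_mult f g) w = fa_mult (fa_star \<sigma> g) (fa_star \<sigma> f) w" .
qed

lemma fa_star_FA: "f \<in> FA E \<Longrightarrow> fa_star \<sigma> f \<in> FA E"
proof (induction rule: FA_induct)
  case (mono c w)
  have "wstar w \<noteq> []" using mono by (simp add: wstar_def)
  moreover have "set (wstar w) \<subseteq> Collect (gen_ok E)" using mono(2) unfolding wstar_ok .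
  ultimately show ?case unfolding fa_star_smult fa_star_mono by (intro FA_smult FA_mono)
qed (auto simp: fa_star_zero fa_star_add FA_zero FA_add)

text \<open>The involution permutes the relations: it exchanges those for an edge with those for its
  ghost edge, swaps the two indices in the vertex and ghost-edge relations, and fixes the splitting
  of a regular vertex.\<close>

lemma fa_star_lrels:
  fixes E :: "('v,'e) dgraph"
  assumes "\<rho> \<in> lrels E" shows "fa_star \<sigma> \<rho> \<in> lrels E"
proof -
  have s: "fa_star \<sigma> (\<lambda>w :: ('v,'e) gen list. \<Sum>e\<in>S. fa_mono [Ed e, Gh e] w) = (\<lambda>w. \<Sum>e\<in>S. fa_mono [Ed e, Gh e] w)" for S :: "'e set"
  proof
    fix w :: "('v,'e) gen list"
    have "fa_star \<sigma> (fa_mono [Ed e, Gh e]) w = fa_mono [Ed e, Gh e] w" for e :: 'e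
      by (simp add: fa_star_mono wstar_def)
    thus "fa_star \<sigma> (\<lambda>w. \<Sum>e\<in>S. fa_mono [Ed e, Gh e] w) w = (\<Sum>e\<in>S. fa_mono [Ed e, Gh e] w)"
      by (simp add: fa_star_wstar inv_simps)
  qed
  from assms show ?thesis
  proof (cases rule: lrels_cases)
    case (vert v w)
    have "fa_star \<sigma> \<rho> = fa_diff (fa_mono [Vt w, Vt v]) (if w = v then fa_mono [Vt w] else fa_zero)"
      using vert by (simp add: fa_star_diff fa_star_mono fa_star_zero wstar_def)
    thus ?thesis using vert unfolding lrels_def by blast
  next
    case (ck1 e f)
    have "fa_star \<sigma> \<rho> = fa_diff (fa_mono [Gh f, Ed e]) (if f = e then fa_mono [Vt (rng E f)] else fa_zero)"
      using ck1 by (simp add: fa_star_diff fa_star_mono fa_star_zero wstar_def)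
    thus ?thesis using ck1 unfolding lrels_def by blast
  next
    case (src e)
    have "fa_star \<sigma> \<rho> = fa_diff (fa_mono [Gh e, Vt (src E e)]) (fa_mono [Gh e])"
      using src by (simp add: fa_star_diff fa_star_mono wstar_def)
    thus ?thesis using src unfolding lrels_def by blast
  next
    case (rng e)
    have "fa_star \<sigma> \<rho> = fa_diff (fa_mono [Vt (rng E e), Gh e]) (fa_mono [Gh e])"
      using rng by (simp add: fa_star_diff fa_star_mono wstar_def)
    thus ?thesis using rng unfolding lrels_def by blast
  next
    case (rng_gh e)
    have "fa_star \<sigma> \<rho> = fa_diff (fa_mono [Ed e, Vt (rng E e)]) (fa_mono [Ed e])"
      using rng_gh by (simp add: fa_star_diff fa_star_mono wstar_def)
    thus ?thesis using rng_gh unfolding lrels_def by blast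
  next
    case (src_gh e)
    have "fa_star \<sigma> \<rho> = fa_diff (fa_mono [Vt (src E e), Ed e]) (fa_mono [Ed e])"
      using src_gh by (simp add: fa_star_diff fa_star_mono wstar_def)
    thus ?thesis using src_gh unfolding lrels_def by blast
  next
    case (ck2 v)
    have "fa_star \<sigma> \<rho> = \<rho>" using ck2 by (simp add: fa_star_diff fa_star_mono s) (simp add: wstar_def)
    thus ?thesis using assms by simp
  qed
qed

lemma lideal_star: "a \<in> lideal E \<Longrightarrow> fa_star \<sigma> a \<in> lideal E"
proof (induction rule: lideal.induct)
  case (gen \<rho> u w d)
  have "fa_star \<sigma> (fa_smult d (fa_mult (fa_mult (fa_mono u) \<rho>) (fa_mono w))) =
    fa_smult (\<sigma> d) (fa_mult (fa_mult (fa_mono (wstar w)) (fa_star \<sigma> \<rho>)) (fa_mono (wstar u)))"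
    by (simp add: fa_star_smult fa_star_mult fa_star_mono fa_mult_assoc)
  thus ?case using lideal.gen[OF fa_star_lrels[OF gen(1)], of "wstar w" "wstar u"] gen wstar_ok by metis
qed (auto simp: fa_star_zero fa_star_add intro: lideal.intros)

end

section \<open>The congruence modulo the ideal\<close>

lemma lequiv_refl: "f \<in> FA E \<Longrightarrow> (f, f) \<in> lequiv E"
  using lideal.zero[of E] by (simp add: lequiv_def fa_diff_def fa_zero_def)

lemma lequiv_sym: "(f, g) \<in> lequiv E \<Longrightarrow> (g, f) \<in> lequiv E"
  using lideal_smult[of "fa_diff f g" E "- 1"]
  by (simp add: lequiv_def fa_simps)

lemma lequiv_trans: "(f, g) \<in> lequiv E \<Longrightarrow> (g, h) \<in> lequiv E \<Longrightarrow> (f, h) \<in> lequiv E"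
  using lideal.add[of "fa_diff f g" E "fa_diff g h"]
  by (simp add: lequiv_def fa_simps)

lemma lequiv_add: "(f, f') \<in> lequiv E \<Longrightarrow> (g, g') \<in> lequiv E \<Longrightarrow> (fa_add f g, fa_add f' g') \<in> lequiv E"
  using lideal.add[of "fa_diff f f'" E "fa_diff g g'"]
  by (simp add: lequiv_def FA_add) (simp add: fa_simps algebra_simps)

lemma lequiv_smult: "(f, f') \<in> lequiv E \<Longrightarrow> (fa_smult c f, fa_smult c f') \<in> lequiv E"
  using lideal_smult[of "fa_diff f f'" E c]
  by (simp add: lequiv_def FA_smult) (simp add: fa_simps right_diff_distrib)

lemma lequiv_mult:
  assumes "(f, f') \<in> lequiv E" "(g, g') \<in> lequiv E"
  shows "(fa_mult f g, fa_mult f' g') \<in> lequiv E"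
proof -
  have FA: "f \<in> FA E" "f' \<in> FA E" "g \<in> FA E" "g' \<in> FA E" using assms by (auto simp: lequiv_def)
  have "fa_diff (fa_mult f g) (fa_mult f' g') =
    fa_add (fa_mult (fa_diff f f') g) (fa_mult f' (fa_diff g g'))"
    unfolding fa_mult_diff_left fa_mult_diff_right by (simp add: fa_simps)
  moreover have "\<dots> \<in> lideal E"
    using assms FA by (intro lideal.add lideal_mult_left lideal_mult_right) (auto simp: lequiv_def)
  ultimately show ?thesis using FA by (simp add: lequiv_def FA_mult)
qed

lemma lequiv_comp: "(f, f') \<in> lequiv E \<Longrightarrow> (fa_comp n f, fa_comp n f') \<in> lequiv E"
proof -
  assume a: "(f, f') \<in> lequiv E"
  have "fa_diff (fa_comp n f) (fa_comp n f') = fa_comp n (fa_diff f f')"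
    by (auto simp: fa_diff_def fa_comp_def)
  thus ?thesis using a lideal_comp[of "fa_diff f f'" E n] by (simp add: lequiv_def FA_comp)
qed

lemma lequiv_star:
  "field_involution \<sigma> \<Longrightarrow> (f, f') \<in> lequiv E \<Longrightarrow> (fa_star \<sigma> f, fa_star \<sigma> f') \<in> lequiv E"
  using lideal_star[of \<sigma> "fa_diff f f'" E] by (simp add: lequiv_def fa_star_FA fa_star_diff)

text \<open>Faithfulness on vertices: the generators act on functions on \<open>'v \<times> 'e list \<times> nat\<close>, where the
  fibre over a regular vertex is split evenly among the emitted edges by residues of the number,
  and the list absorbs the edges of an infinite emitter.\<close>

definition edge_index :: "('v,'e) dgraph \<Rightarrow> 'v \<Rightarrow> 'e \<Rightarrow> nat" where
  "edge_index E v = (SOME h. bij_betw h (emits E v) {0..<card (emits E v)})"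

text \<open>Partial inverse of the injection \<open>edge_image E e\<close> from the fibre over
  \<open>rng E e\<close> into the fibre over \<open>src E e\<close>. The images for different edges
  are disjoint; over a regular vertex they fill the fibre, by division with remainder. Over an
  infinite emitter states with empty list lie in no image.\<close>

fun edge_preimage :: "('v,'e) dgraph \<Rightarrow> 'e \<Rightarrow> 'v \<times> 'e list \<times> nat \<Rightarrow> ('v \<times> 'e list \<times> nat) option" where
  "edge_preimage E e (v, l, n) =
    (if v \<noteq> src E e then None
     else if regular_vertex E v
     then (if n mod card (emits E v) = edge_index E v e
           then Some (rng E e, l, n div card (emits E v)) else None)
     else (case l of [] \<Rightarrow> None | f # l' \<Rightarrow> if f = e then Some (rng E e, l', n) else None))"

fun edge_image :: "('v,'e) dgraph \<Rightarrow> 'e \<Rightarrow> 'v \<times> 'e list \<times> nat \<Rightarrow> 'v \<times> 'e list \<times> nat" where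
  "edge_image E e (v, l, n) =
    (if regular_vertex E (src E e)
     then (src E e, l, n * card (emits E (src E e)) + edge_index E (src E e) e)
     else (src E e, e # l, n))"

lemma edge_index_bij:
  "regular_vertex E v \<Longrightarrow> bij_betw (edge_index E v) (emits E v) {0..<card (emits E v)}"
  unfolding edge_index_def
  using someI_ex[OF ex_bij_betw_finite_nat[of "emits E v"]] by (simp add: regular_vertex_def)

lemma edge_preimage_image:
  assumes "e \<in> edges E" "fst y = rng E e"
  shows "edge_preimage E e (edge_image E e y) = Some y"
proof (cases y)
  case (fields v l n)
  let ?s = "src E e"
  have "edge_index E ?s e < card (emits E ?s)" if "regular_vertex E ?s"
    using bij_betwE[OF edge_index_bij[OF that]] assms by (auto simp: emits_def)
  thus ?thesis using assms fields by auto
qed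

lemma edge_image_preimage:
  "edge_preimage E e x = Some y \<Longrightarrow> edge_image E e y = x \<and> fst y = rng E e \<and> fst x = src E e"
  by (cases x) (auto split: if_splits list.splits, metis div_mult_mod_eq)

lemma edge_preimage_disjoint:
  assumes "e \<in> edges E" "f \<in> edges E" "edge_preimage E e x = Some y" "edge_preimage E f x = Some z"
  shows "e = f"
proof (cases x)
  case (fields v l n)
  show ?thesis
  proof (cases "regular_vertex E v")
    case True
    have "v = src E e" "v = src E f" "edge_index E v e = edge_index E v f"
      using assms fields True by (auto split: if_splits)
    moreover have "inj_on (edge_index E v) (emits E v)"
      using edge_index_bij[OF True] by (rule bij_betw_imp_inj_on)
    ultimately show ?thesis using assms by (auto simp: emits_def dest: inj_onD)
  qed (use assms fields in \<open>auto split: if_splits list.splits\<close>)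
qed

lemma edge_preimage_total:
  assumes "regular_vertex E (fst x)" obtains e y where "e \<in> emits E (fst x)" "edge_preimage E e x = Some y"
proof (cases x)
  case (fields v l n)
  have "card (emits E v) > 0" using assms fields by (simp add: regular_vertex_def card_gt_0_iff)
  hence "n mod card (emits E v) \<in> edge_index E v ` emits E v"
    using edge_index_bij[of E v] assms fields by (simp add: bij_betw_def)
  then obtain e where "e \<in> emits E v" "edge_index E v e = n mod card (emits E v)" by auto
  thus thesis using that[of e] assms fields by (auto simp: emits_def)
qed

type_synonym ('v,'e,'k) state_fun = "'v \<times> 'e list \<times> nat \<Rightarrow> 'k"

fun gen_act :: "('v,'e) dgraph \<Rightarrow> ('v,'e) gen \<Rightarrow> ('v,'e,'k::comm_ring_1) state_fun \<Rightarrow> ('v,'e,'k) state_fun" where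
  "gen_act E (Vt v) \<phi> x = (if fst x = v then \<phi> x else 0)"
| "gen_act E (Ed e) \<phi> x = (case edge_preimage E e x of None \<Rightarrow> 0 | Some y \<Rightarrow> \<phi> y)"
| "gen_act E (Gh e) \<phi> x = (if fst x = rng E e then \<phi> (edge_image E e x) else 0)"

definition word_act :: "('v,'e) dgraph \<Rightarrow> ('v,'e) gen list \<Rightarrow> ('v,'e,'k::comm_ring_1) state_fun \<Rightarrow> ('v,'e,'k) state_fun" where
  "word_act E w = foldr (gen_act E) w"

text \<open>A sum over an infinite set is 0 by convention, so the additivity lemmas carry finiteness
  of the supports along.\<close>

definition fa_act :: "('v,'e) dgraph \<Rightarrow> ('v,'e,'k::comm_ring_1) fa \<Rightarrow> ('v,'e,'k) state_fun \<Rightarrow> ('v,'e,'k) state_fun" where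
  "fa_act E f \<phi> x = (\<Sum>w | f w \<noteq> 0. f w * word_act E w \<phi> x)"

lemma word_act_simps [simp]: "word_act E [] \<phi> = \<phi>" "word_act E (g # w) \<phi> = gen_act E g (word_act E w \<phi>)"
  "word_act E (u @ w) \<phi> = word_act E u (word_act E w \<phi>)"
  by (simp_all add: word_act_def)

lemma word_act_sum:
  "word_act E u (\<lambda>x. \<Sum>i\<in>S. c i * \<phi> i x) x = (\<Sum>i\<in>S. c i * word_act E u (\<phi> i) x)"
proof (induction u arbitrary: x)
  case (Cons g u)
  have "gen_act E g (\<lambda>x. \<Sum>i\<in>S. c i * \<psi> i x) x = (\<Sum>i\<in>S. c i * gen_act E g (\<psi> i) x)" for \<psi> x
    by (cases g) (auto split: option.splits)
  moreover have "word_act E u (\<lambda>x. \<Sum>i\<in>S. c i * \<phi> i x) = (\<lambda>x. \<Sum>i\<in>S. c i * word_act E u (\<phi> i) x)"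
    using Cons by blast
  ultimately show ?case by simp
qed simp

lemma fa_act_superset:
  "finite S \<Longrightarrow> {w. f w \<noteq> 0} \<subseteq> S \<Longrightarrow> fa_act E f \<phi> x = (\<Sum>w\<in>S. f w * word_act E w \<phi> x)"
  unfolding fa_act_def by (rule sum.mono_neutral_left) auto

lemma fa_act_add:
  assumes "finite {w. f w \<noteq> 0}" "finite {w. g w \<noteq> 0}"
  shows "fa_act E (fa_add f g) \<phi> x = fa_act E f \<phi> x + fa_act E g \<phi> x"
    "fa_act E (fa_diff f g) \<phi> x = fa_act E f \<phi> x - fa_act E g \<phi> x"
proof -
  let ?S = "{w. f w \<noteq> 0} \<union> {w. g w \<noteq> 0}"
  have S: "finite ?S" using assms by simp
  have "fa_act E f \<phi> x = (\<Sum>w\<in>?S. f w * word_act E w \<phi> x)" "fa_act E g \<phi> x = (\<Sum>w\<in>?S. g w * word_act E w \<phi> x)"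
    by (rule fa_act_superset[OF S]; blast)+
  moreover have "fa_act E (fa_add f g) \<phi> x = (\<Sum>w\<in>?S. fa_add f g w * word_act E w \<phi> x)"
    by (rule fa_act_superset[OF S]) (auto simp: fa_add_def)
  moreover have "fa_act E (fa_diff f g) \<phi> x = (\<Sum>w\<in>?S. fa_diff f g w * word_act E w \<phi> x)"
    by (rule fa_act_superset[OF S]) (auto simp: fa_diff_def)
  ultimately show "fa_act E (fa_add f g) \<phi> x = fa_act E f \<phi> x + fa_act E g \<phi> x"
    "fa_act E (fa_diff f g) \<phi> x = fa_act E f \<phi> x - fa_act E g \<phi> x"
    by (simp_all add: fa_add_def fa_diff_def distrib_right left_diff_distrib sum.distrib sum_subtractf)
qed

lemma fa_act_mono: "fa_act E (fa_mono w) \<phi> x = word_act E w \<phi> x"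
  by (subst fa_act_superset[of "{w}"]) (auto simp: fa_mono_def)

lemma fa_act_zero: "fa_act E fa_zero \<phi> x = 0"
  by (simp add: fa_act_def fa_zero_def)

lemma finite_support_mono: "finite {v. fa_mono w v \<noteq> 0}"
  by (rule finite_subset[of _ "{w}"]) (auto simp: fa_mono_def)

lemma finite_support_add: "finite {w. f w \<noteq> 0} \<Longrightarrow> finite {w. g w \<noteq> 0} \<Longrightarrow> finite {w. fa_add f g w \<noteq> 0}"
  by (rule finite_subset[of _ "{w. f w \<noteq> 0} \<union> {w. g w \<noteq> 0}"]) (auto simp: fa_add_def)

lemma finite_support_diff: "finite {w. f w \<noteq> 0} \<Longrightarrow> finite {w. g w \<noteq> 0} \<Longrightarrow> finite {w. fa_diff f g w \<noteq> 0}"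
  by (rule finite_subset[of _ "{w. f w \<noteq> 0} \<union> {w. g w \<noteq> 0}"]) (auto simp: fa_diff_def)

lemma fa_act_mono_sum:
  fixes \<phi> :: "('v,'e,'k::comm_ring_1) state_fun" and F :: "'i \<Rightarrow> ('v,'e) gen list"
  assumes "finite S"
  defines "f \<equiv> (\<lambda>S w. \<Sum>e\<in>S. (fa_mono (F e) :: ('v,'e,'k) fa) w)"
  shows "finite {w. f S w \<noteq> 0}" "fa_act E (f S) \<phi> x = (\<Sum>e\<in>S. word_act E (F e) \<phi> x)"
proof -
  have "finite {w. f S w \<noteq> 0} \<and> fa_act E (f S) \<phi> x = (\<Sum>e\<in>S. word_act E (F e) \<phi> x)"
    using assms(1)
  proof (induction S rule: finite_induct)
    case empty
    have "f {} = fa_zero" by (simp add: f_def fa_zero_def)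
    thus ?case by (simp add: fa_act_zero) (simp add: fa_zero_def)
  next
    case (insert e S)
    have eq: "f (insert e S) = fa_add (fa_mono (F e)) (f S)"
      using insert by (auto simp: fa_add_def f_def)
    show ?case unfolding eq using insert
      by (simp add: fa_act_add fa_act_mono finite_support_add finite_support_mono)
  qed
  thus "finite {w. f S w \<noteq> 0}" "fa_act E (f S) \<phi> x = (\<Sum>e\<in>S. word_act E (F e) \<phi> x)" by auto
qed

lemma fa_act_lrels:
  assumes "\<rho> \<in> lrels E" shows "finite {w. \<rho> w \<noteq> 0} \<and> fa_act E \<rho> \<phi> x = 0"
proof -
  have diff: "finite {w. fa_diff f g w \<noteq> 0} \<and> fa_act E (fa_diff f g) \<phi> x = fa_act E f \<phi> x - fa_act E g \<phi> x"
    if "finite {w. f w \<noteq> 0}" "finite {w. g w \<noteq> 0}" for f g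
    using fa_act_add(2)[OF that] finite_support_diff[OF that] by blast
  have fz: "finite {w. fa_zero w \<noteq> 0}" by (simp add: fa_zero_def)
  note simps = fa_act_mono fa_act_zero finite_support_mono fz
  from assms show ?thesis
  proof (cases rule: lrels_cases)
    case (vert v w)
    show ?thesis unfolding vert(1) by (cases "v = w") (simp_all add: diff simps)
  next
    case (src e)
    show ?thesis unfolding src(1)
      by (auto simp: diff simps split: option.split dest: edge_image_preimage)
  next
    case (rng e)
    show ?thesis unfolding rng(1)
      by (auto simp: diff simps split: option.split dest: edge_image_preimage)
  next
    case (rng_gh e)
    show ?thesis unfolding rng_gh(1) by (auto simp: diff simps)
  next
    case (src_gh e)
    have "fst (edge_image E e x) = src E e" by (cases x) auto
    thus ?thesis unfolding src_gh(1) by (auto simp: diff simps)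
  next
    case (ck1 e f)
    have "edge_preimage E f (edge_image E e x) = (if e = f then Some x else None)" if "fst x = rng E e"
    proof (cases "e = f")
      case True thus ?thesis using edge_preimage_image[OF ck1(2) that] by simp
    next
      case False
      thus ?thesis using edge_preimage_disjoint[OF ck1(2,3) edge_preimage_image[OF ck1(2) that]]
        by (metis option.exhaust)
    qed
    thus ?thesis unfolding ck1(1) by (auto simp: diff simps)
  next
    case (ck2 v)
    have fin: "finite (emits E v)" using ck2(3) by (simp add: regular_vertex_def)
    \<comment> \<open>\<open>Ed e\<close> followed by \<open>Gh e\<close> in a word acts as
      restriction to the image of e. As these images partition the fibre over v, exactly one summand
      survives at each of its states.\<close>
    have loop: "word_act E [Ed e, Gh e] \<phi> x = (if edge_preimage E e x = None then 0 else \<phi> x)" for e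
      using edge_image_preimage[of E e x] by (auto split: option.split)
    have "(\<Sum>e\<in>emits E v. word_act E [Ed e, Gh e] \<phi> x) = (if fst x = v then \<phi> x else 0)"
    proof (cases "fst x = v")
      case True
      hence "regular_vertex E (fst x)" using ck2(3) by simp
      then obtain e y where "e \<in> emits E (fst x)" "edge_preimage E e x = Some y"
        by (rule edge_preimage_total)
      hence e: "e \<in> emits E v" "edge_preimage E e x = Some y" using True by simp_all
      have "edge_preimage E f x = None" if "f \<in> emits E v" "f \<noteq> e" for f
        using edge_preimage_disjoint[of e E f x y] e that
        by (cases "edge_preimage E f x") (auto simp: emits_def)
      hence "(\<Sum>f\<in>emits E v. word_act E [Ed f, Gh f] \<phi> x) = (\<Sum>f\<in>emits E v. if f = e then \<phi> x else 0)"
        unfolding loop using e by (intro sum.cong) auto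
      thus ?thesis using True e fin by simp
    next
      case False
      have "edge_preimage E e x = None" if "e \<in> emits E v" for e
        using edge_image_preimage[of E e x] that False by (cases "edge_preimage E e x") (auto simp: emits_def)
      thus ?thesis unfolding loop using False by simp
    qed
    thus ?thesis unfolding ck2(1)
      by (simp add: diff simps fa_act_mono_sum[OF fin])
  qed
qed

lemma fa_act_lideal: "a \<in> lideal E \<Longrightarrow> finite {w. a w \<noteq> 0} \<and> (\<forall>\<phi> x. fa_act E a \<phi> x = 0)"
proof (induction rule: lideal.induct)
  case zero thus ?case by (simp add: fa_act_zero) (simp add: fa_zero_def)
next
  case (add a b)
  thus ?case by (simp add: fa_act_add finite_support_add)
next
  case (gen \<rho> u v c)
  let ?S = "{w. \<rho> w \<noteq> 0}" and ?f = "fa_smult c (fa_mult (fa_mult (fa_mono u) \<rho>) (fa_mono v))"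
  have fin: "finite ?S" and z: "\<And>\<phi> x. fa_act E \<rho> \<phi> x = 0" using fa_act_lrels[OF gen(1)] by blast+
  have val: "?f (u @ w @ v) = c * \<rho> w" for w
  proof -
    have "fa_mult (fa_mult (fa_mono u) \<rho>) (fa_mono v) ((u @ w) @ v) = \<rho> w"
      by (simp only: fa_mult_mono_append fa_mono_mult_append)
    thus ?thesis by (simp add: fa_smult_def)
  qed
  have sub: "{w. ?f w \<noteq> 0} \<subseteq> (\<lambda>w. u @ w @ v) ` ?S"
  proof
    fix y assume "y \<in> {w. ?f w \<noteq> 0}"
    hence "fa_mult (fa_mult (fa_mono u) \<rho>) (fa_mono v) y \<noteq> 0" by (auto simp: fa_smult_def)
    from fa_mult_support[OF this] obtain p q where p: "y = p @ q" "fa_mult (fa_mono u) \<rho> p \<noteq> 0"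
      "(fa_mono v :: ('a,'b,'c) fa) q \<noteq> 0" by blast
    from fa_mult_support[OF p(2)] obtain r s where "p = r @ s"
      "(fa_mono u :: ('a,'b,'c) fa) r \<noteq> 0" "\<rho> s \<noteq> 0" by blast
    thus "y \<in> (\<lambda>w. u @ w @ v) ` ?S" using p by (auto simp: fa_mono_def split: if_splits)
  qed
  have "fa_act E ?f \<phi> x = 0" for \<phi> x
  proof -
    have "fa_act E ?f \<phi> x = (\<Sum>w\<in>(\<lambda>w. u @ w @ v) ` ?S. ?f w * word_act E w \<phi> x)"
      using fin sub by (intro fa_act_superset) auto
    also have "\<dots> = (\<Sum>w\<in>?S. ?f (u @ w @ v) * word_act E (u @ w @ v) \<phi> x)"
      by (subst sum.reindex) (auto simp: inj_on_def)
    also have "\<dots> = c * (\<Sum>w\<in>?S. \<rho> w * word_act E u (word_act E w (word_act E v \<phi>)) x)"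
      by (simp add: val sum_distrib_left mult.assoc)
    also have "\<dots> = c * word_act E u (\<lambda>x. \<Sum>w\<in>?S. \<rho> w * word_act E w (word_act E v \<phi>) x) x"
      by (simp only: word_act_sum)
    \<comment> \<open>The zero function is written as an empty linear combination so that
      \<open>word_act_sum\<close> applies to it.\<close>
    also have "(\<lambda>x. \<Sum>w\<in>?S. \<rho> w * word_act E w (word_act E v \<phi>) x) = (\<lambda>x. \<Sum>i\<in>({}::nat set). 0 * 0)"
      using z[of "word_act E v \<phi>"] by (simp add: fa_act_def)
    also have "word_act E u (\<lambda>x. \<Sum>i\<in>({}::nat set). 0 * 0 :: 'c) x = 0"
      using word_act_sum[where S = "{}::nat set" and c = "\<lambda>_. 0" and \<phi> = "\<lambda>_ _. 0 :: 'c", of E u x] by simp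
    finally show ?thesis by simp
  qed
  moreover have "finite {w. ?f w \<noteq> 0}" using sub fin finite_subset by blast
  ultimately show ?case by blast
qed

text \<open>Elements of the ideal act as 0, while the vertex sends the constant function 1 to a
  function with value 1 at the state \<open>(v, [], 0)\<close>.\<close>

lemma vertex_not_in_lideal: "(fa_mono [Vt v] :: ('v,'e,'k::comm_ring_1) fa) \<notin> lideal E"
proof
  assume "(fa_mono [Vt v] :: ('v,'e,'k) fa) \<in> lideal E"
  from fa_act_lideal[OF this] have "fa_act E (fa_mono [Vt v]) (\<lambda>_. 1 :: 'k) (v, [], 0) = 0" by blast
  thus False by (simp add: fa_act_mono)
qed

section \<open>The ring type and transport of the result\<close>

text \<open>Leavitt path algebras depend on the graph, which a type cannot. The product of the algebras of
  all graphs is a genuine ring type, and the algebra of \<open>E\<close> embeds as the factor at \<open>E\<close>.\<close>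

definition lp_rel :: "(('v,'e) dgraph \<Rightarrow> ('v,'e,'k::field) fa) \<Rightarrow> (('v,'e) dgraph \<Rightarrow> ('v,'e,'k) fa) \<Rightarrow> bool" where
  "lp_rel f g \<longleftrightarrow> (\<forall>E. (f E, g E) \<in> lequiv E)"

quotient_type (overloaded) ('v,'e,'k) lp = "('v,'e) dgraph \<Rightarrow> ('v,'e,'k::field) fa" / partial: lp_rel
proof (rule part_equivpI)
  show "\<exists>f :: ('v,'e) dgraph \<Rightarrow> ('v,'e,'k) fa. lp_rel f f"
    by (rule exI[of _ "\<lambda>E. fa_zero"]) (simp add: lp_rel_def lequiv_refl FA_zero)
  show "symp (lp_rel :: _ \<Rightarrow> (('v,'e) dgraph \<Rightarrow> ('v,'e,'k) fa) \<Rightarrow> _)"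
    unfolding lp_rel_def using lequiv_sym by (fastforce intro: sympI)
  show "transp (lp_rel :: _ \<Rightarrow> (('v,'e) dgraph \<Rightarrow> ('v,'e,'k) fa) \<Rightarrow> _)"
    unfolding lp_rel_def using lequiv_trans by (fastforce intro: transpI)
qed

lemma lequivD: "(f, g) \<in> lequiv E \<Longrightarrow> f \<in> FA E" "(f, g) \<in> lequiv E \<Longrightarrow> g \<in> FA E"
  by (simp_all add: lequiv_def)

lemma lp_rel_FA: "lp_rel f f \<Longrightarrow> f E \<in> FA E"
  unfolding lp_rel_def using lequivD by blast

lemma lp_relI: "(\<And>E. f E \<in> FA E) \<Longrightarrow> (\<And>E. f E = g E) \<Longrightarrow> lp_rel f g"
  unfolding lp_rel_def using lequiv_refl by metis

instantiation lp :: (type, type, field) ring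
begin

lift_definition zero_lp :: "('a,'b,'c) lp" is "\<lambda>E. fa_zero"
  by (simp add: lp_rel_def lequiv_refl FA_zero)

lift_definition plus_lp :: "('a,'b,'c) lp \<Rightarrow> ('a,'b,'c) lp \<Rightarrow> ('a,'b,'c) lp"
  is "\<lambda>f g E. fa_add (f E) (g E)"
  by (simp add: lp_rel_def lequiv_add)

lift_definition uminus_lp :: "('a,'b,'c) lp \<Rightarrow> ('a,'b,'c) lp" is "\<lambda>f E. fa_smult (- 1) (f E)"
  by (simp add: lp_rel_def lequiv_smult)

lift_definition minus_lp :: "('a,'b,'c) lp \<Rightarrow> ('a,'b,'c) lp \<Rightarrow> ('a,'b,'c) lp"
  is "\<lambda>f g E. fa_add (f E) (fa_smult (- 1) (g E))"
  by (simp add: lp_rel_def lequiv_add lequiv_smult)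

lift_definition times_lp :: "('a,'b,'c) lp \<Rightarrow> ('a,'b,'c) lp \<Rightarrow> ('a,'b,'c) lp"
  is "\<lambda>f g E. fa_mult (f E) (g E)"
  by (simp add: lp_rel_def lequiv_mult)

instance
proof
  fix a b c :: "('a,'b,'c) lp"
  note FA = FA_add FA_mult FA_smult FA_zero lp_rel_FA
  show "a + b + c = a + (b + c)"
    by transfer (rule lp_relI, simp add: FA, simp add: fa_add_def add.assoc)
  show "a + b = b + a"
    by transfer (rule lp_relI, simp add: FA, simp add: fa_add_def add.commute)
  show "0 + a = a"
    by transfer (rule lp_relI, simp add: FA, simp add: fa_add_def fa_zero_def)
  show "- a + a = 0"
    by transfer (rule lp_relI, simp add: FA, simp add: fa_simps)
  show "a - b = a + - b"
    by transfer (rule lp_relI, simp add: FA, simp)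
  show "a * b * c = a * (b * c)"
    by transfer (rule lp_relI, simp add: FA, simp add: fa_mult_assoc)
  show "(a + b) * c = a * c + b * c"
    by transfer (rule lp_relI, simp add: FA, simp add: fa_mult_add_left)
  show "a * (b + c) = a * b + a * c"
    by transfer (rule lp_relI, simp add: FA, simp add: fa_mult_add_right)
qed

end

lift_definition lp_scale :: "'k::field \<Rightarrow> ('v,'e,'k) lp \<Rightarrow> ('v,'e,'k) lp"
  is "\<lambda>c f E. fa_smult c (f E)"
  by (simp add: lp_rel_def lequiv_smult)

text \<open>Lifting requires compatibility for every \<sigma>, but only an involution preserves the
  ideal; for all other maps the operation is set to the identity.\<close>

lift_definition lp_star :: "('k::field \<Rightarrow> 'k) \<Rightarrow> ('v,'e,'k) lp \<Rightarrow> ('v,'e,'k) lp"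
  is "\<lambda>\<sigma> f E. if field_involution \<sigma> then fa_star \<sigma> (f E) else f E"
  by (simp add: lp_rel_def lequiv_star)

lift_definition lp_comp :: "int \<Rightarrow> ('v,'e,'k::field) lp \<Rightarrow> ('v,'e,'k) lp" is "\<lambda>n f E. fa_comp n (f E)"
  by (simp add: lp_rel_def lequiv_comp)

definition emb :: "('v,'e) dgraph \<Rightarrow> ('v,'e,'k::field) fa \<Rightarrow> ('v,'e,'k) lp" where
  "emb E f = abs_lp (\<lambda>E'. if E' = E then f else fa_zero)"

lemma fa_comp_zero: "fa_comp n fa_zero = fa_zero"
  by (simp add: fa_comp_def fa_zero_def)

lemma fa_add_zero: "fa_add fa_zero fa_zero = fa_zero"
  and fa_smult_zero: "fa_smult c fa_zero = fa_zero"
  by (simp_all add: fa_simps)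

lemma fa_comp_star: "field_involution \<sigma> \<Longrightarrow> fa_comp n (fa_star \<sigma> f) = fa_star \<sigma> (fa_comp (- n) f)"
  by (auto simp: fa_comp_def fa_star_wstar field_involution_simps(4) fun_eq_iff)

context
  fixes E :: "('v,'e) dgraph"
begin

lemma emb_rel: "(f, g) \<in> lequiv E \<Longrightarrow>
  lp_rel (\<lambda>E'. if E' = E then f else fa_zero) (\<lambda>E'. if E' = E then g else fa_zero)"
  by (simp add: lp_rel_def lequiv_refl FA_zero)

lemma emb_eq_iff:
  assumes "f \<in> FA E" "g \<in> FA E" shows "emb E f = emb E g \<longleftrightarrow> (f, g) \<in> lequiv E"
proof -
  have "emb E f = emb E g \<longleftrightarrow>
    lp_rel (\<lambda>E'. if E' = E then f else fa_zero) (\<lambda>E'. if E' = E then g else fa_zero)"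
    unfolding emb_def
    using Quotient3_rel[OF Quotient3_lp, of "\<lambda>E'. if E' = E then f else fa_zero" "\<lambda>E'. if E' = E then g else fa_zero"]
      emb_rel[OF lequiv_refl[OF assms(1)]] emb_rel[OF lequiv_refl[OF assms(2)]] by blast
  also have "\<dots> \<longleftrightarrow> (f, g) \<in> lequiv E" using emb_rel by (auto simp: lp_rel_def lequiv_refl FA_zero split: if_splits)
  finally show ?thesis .
qed

lemma emb_cong: "f \<in> FA E \<Longrightarrow> fa_diff f g \<in> lideal E \<Longrightarrow> g \<in> FA E \<Longrightarrow> emb E f = emb E g"
  by (simp add: emb_eq_iff lequiv_def)

lemma emb_plus: "f \<in> FA E \<Longrightarrow> g \<in> FA E \<Longrightarrow> emb E f + emb E g = emb E (fa_add f g)"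
  unfolding emb_def
  by (subst plus_lp.abs_eq) (auto simp: emb_rel lequiv_refl fa_add_zero intro!: arg_cong[of _ _ abs_lp])

lemma emb_times: "f \<in> FA E \<Longrightarrow> g \<in> FA E \<Longrightarrow> emb E f * emb E g = emb E (fa_mult f g)"
  unfolding emb_def
  by (subst times_lp.abs_eq) (auto simp: emb_rel lequiv_refl fa_mult_zero intro!: arg_cong[of _ _ abs_lp])

lemma emb_scale: "f \<in> FA E \<Longrightarrow> lp_scale c (emb E f) = emb E (fa_smult c f)"
  unfolding emb_def
  by (subst lp_scale.abs_eq) (auto simp: emb_rel lequiv_refl fa_smult_zero intro!: arg_cong[of _ _ abs_lp])

lemma emb_comp: "f \<in> FA E \<Longrightarrow> lp_comp n (emb E f) = emb E (fa_comp n f)"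
  unfolding emb_def
  by (subst lp_comp.abs_eq) (auto simp: emb_rel lequiv_refl fa_comp_zero intro!: arg_cong[of _ _ abs_lp])

lemma emb_star: "field_involution \<sigma> \<Longrightarrow> f \<in> FA E \<Longrightarrow> lp_star \<sigma> (emb E f) = emb E (fa_star \<sigma> f)"
  unfolding emb_def
  by (subst lp_star.abs_eq) (auto simp: emb_rel lequiv_refl fa_star_zero intro!: arg_cong[of _ _ abs_lp])

lemma emb_zero: "emb E fa_zero = 0"
  by (simp add: emb_def zero_lp_def)

lemma emb_sum:
  assumes "finite S" "\<And>e. e \<in> S \<Longrightarrow> F e \<in> FA E"
  shows "(\<lambda>w. \<Sum>e\<in>S. F e w) \<in> FA E \<and> emb E (\<lambda>w. \<Sum>e\<in>S. F e w) = (\<Sum>e\<in>S. emb E (F e))"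
  using assms
proof (induction S rule: finite_induct)
  case empty thus ?case using FA_zero[of E] emb_zero by (simp add: fa_zero_def)
next
  case (insert e S)
  have "(\<lambda>w. \<Sum>e\<in>insert e S. F e w) = fa_add (F e) (\<lambda>w. \<Sum>e\<in>S. F e w)"
    using insert by (simp add: fa_add_def)
  thus ?case using insert by (simp add: FA_add emb_plus[symmetric])
qed

text \<open>The value 0 off the graph makes the locale axioms \<open>cmp_vt\<close> and
  \<open>st_vt\<close> true for all v of the type.\<close>

definition lp_vt :: "'v \<Rightarrow> ('v,'e,'k::field) lp" where
  "lp_vt v = (if v \<in> verts E then emb E (fa_mono [Vt v]) else 0)"

definition lp_ed :: "'e \<Rightarrow> ('v,'e,'k::field) lp" where
  "lp_ed e = (if e \<in> edges E then emb E (fa_mono [Ed e]) else 0)"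

lemma FA_gens:
  "v \<in> verts E \<Longrightarrow> fa_mono [Vt v] \<in> FA E"
  "e \<in> edges E \<Longrightarrow> fa_mono [Ed e] \<in> FA E"
  "e \<in> edges E \<Longrightarrow> fa_mono [Gh e] \<in> FA E"
  by (auto intro!: FA_mono simp: gen_ok_def)

text \<open>The empty word is allowed as context in \<open>lideal.gen\<close> and acts as a unit,
  although it is not itself in \<open>FA E\<close>.\<close>

lemma lrels_lideal: "\<rho> \<in> lrels E \<Longrightarrow> \<rho> \<in> lideal E"
proof -
  assume "\<rho> \<in> lrels E"
  from lideal.gen[OF this, of "[]" "[]" 1]
  have "fa_smult 1 \<rho> \<in> lideal E" by (simp add: fa_mono_nil_mult)
  thus ?thesis by (simp add: fa_smult_def)
qed

lemma emb_lrel: "f \<in> FA E \<Longrightarrow> g \<in> FA E \<Longrightarrow> fa_diff f g \<in> lrels E \<Longrightarrow> emb E f = emb E g"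
  using emb_cong lrels_lideal by blast

lemma leavitt_lp:
  fixes \<sigma> :: "'k::field \<Rightarrow> 'k"
  assumes wf: "wf_graph E" and inv: "field_involution \<sigma>"
  shows "leavitt E \<sigma> lp_scale (lp_star \<sigma>) lp_comp (lp_vt :: 'v \<Rightarrow> ('v,'e,'k) lp) lp_ed"
proof
  show "wf_graph E" "field_involution \<sigma>" by fact+
next
  fix c d :: 'k and x y :: "('v,'e,'k) lp" and m n k :: int
  note FA = FA_add FA_mult FA_smult FA_zero FA_comp fa_star_FA lp_rel_FA
  note star = fa_star_add fa_star_mult fa_star_star fa_star_smult fa_comp_star
  show "lp_scale c (x + y) = lp_scale c x + lp_scale c y"
    by transfer (rule lp_relI, simp add: FA, simp add: fa_simps distrib_left)
  show "lp_scale (c + d) x = lp_scale c x + lp_scale d x"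
    by transfer (rule lp_relI, simp add: FA, simp add: fa_simps distrib_right)
  show "lp_scale c (lp_scale d x) = lp_scale (c * d) x"
    by transfer (rule lp_relI, simp add: FA, simp add: fa_simps mult.assoc)
  show "lp_scale 1 x = x"
    by transfer (rule lp_relI, simp add: FA, simp add: fa_simps)
  show "lp_scale c x * y = lp_scale c (x * y)"
    by transfer (rule lp_relI, simp add: FA, simp add: fa_mult_smult_left)
  show "x * lp_scale c y = lp_scale c (x * y)"
    by transfer (rule lp_relI, simp add: FA, simp add: fa_mult_smult_right)
  show "lp_star \<sigma> (x + y) = lp_star \<sigma> x + lp_star \<sigma> y"
    using inv by transfer (rule lp_relI, simp add: FA, simp add: star)
  show "lp_star \<sigma> (x * y) = lp_star \<sigma> y * lp_star \<sigma> x"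
    using inv by transfer (rule lp_relI, simp add: FA, simp add: star)
  show "lp_star \<sigma> (lp_star \<sigma> x) = x"
    using inv by transfer (rule lp_relI, simp add: FA, simp add: star)
  show "lp_star \<sigma> (lp_scale c x) = lp_scale (\<sigma> c) (lp_star \<sigma> x)"
    using inv by transfer (rule lp_relI, simp add: FA, simp add: star)
  show "lp_comp n (x + y) = lp_comp n x + lp_comp n y"
    by transfer (rule lp_relI, simp add: FA, simp add: fun_eq_iff fa_comp_def fa_add_def)
  show "lp_comp n (lp_scale c x) = lp_scale c (lp_comp n x)"
    by transfer (rule lp_relI, simp add: FA, simp add: fun_eq_iff fa_comp_def fa_smult_def)
  have "lp_comp n (lp_comp n x) = lp_comp n x"
    by transfer (rule lp_relI, simp add: FA, simp add: fun_eq_iff fa_comp_def)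
  moreover have "lp_comp m (lp_comp n x) = 0" if "m \<noteq> n"
    using that by transfer (rule lp_relI, simp add: FA, simp add: fun_eq_iff fa_comp_def fa_zero_def)
  ultimately show "lp_comp m (lp_comp n x) = (if m = n then lp_comp n x else 0)" by simp
  have "fa_comp n (fa_mult (fa_comp k f) g) = fa_mult (fa_comp k f) (fa_comp (n - k) g)"
    for f g :: "('v,'e,'k) fa"
  proof
    fix w :: "('v,'e) gen list"
    have split: "wdeg w = wdeg (take i w) + wdeg (drop i w)" for i
      using wdeg_append[of "take i w" "drop i w"] by simp
    have "fa_comp n (fa_mult (fa_comp k f) g) w =
      (\<Sum>i\<le>length w. if wdeg w = n then fa_comp k f (take i w) * g (drop i w) else 0)"
      by (simp add: fa_comp_def fa_mult_def)
    also have "\<dots> = fa_mult (fa_comp k f) (fa_comp (n - k) g) w"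
      unfolding fa_mult_def
    proof (rule sum.cong[OF refl])
      fix i
      show "(if wdeg w = n then fa_comp k f (take i w) * g (drop i w) else 0) =
        fa_comp k f (take i w) * fa_comp (n - k) g (drop i w)"
        using split[of i] by (auto simp: fa_comp_def)
    qed
    finally show "fa_comp n (fa_mult (fa_comp k f) g) w = fa_mult (fa_comp k f) (fa_comp (n - k) g) w" .
  qed
  thus "lp_comp n (lp_comp k x * y) = lp_comp k x * lp_comp (n - k) y"
    by transfer (rule lp_relI, simp add: FA, simp)
  show "lp_comp n (lp_star \<sigma> x) = lp_star \<sigma> (lp_comp (- n) x)"
    using inv by transfer (rule lp_relI, simp add: FA, simp add: star)
next
  fix v and e :: 'e
  have c: "fa_comp n (fa_mono w) = (if wdeg w = n then fa_mono w else fa_zero)" for n and w :: "('v,'e) gen list"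
    by (auto simp: fa_comp_def fa_mono_def fa_zero_def)
  have z: "lp_comp n 0 = (0 :: ('v,'e,'k) lp)" for n
    using emb_comp[OF FA_zero, of n] by (simp add: emb_zero fa_comp_zero)
  show "lp_comp 0 (lp_vt v) = (lp_vt v :: ('v,'e,'k) lp)"
    by (simp add: lp_vt_def z FA_gens emb_comp c wdeg_def)
  show "lp_comp 1 (lp_ed e) = (lp_ed e :: ('v,'e,'k) lp)"
    by (simp add: lp_ed_def z FA_gens emb_comp c wdeg_def)
  have "lp_star \<sigma> 0 = (0 :: ('v,'e,'k) lp)"
    using emb_star[OF inv FA_zero] by (simp add: emb_zero fa_star_zero[OF inv])
  thus "lp_star \<sigma> (lp_vt v) = (lp_vt v :: ('v,'e,'k) lp)"
    using emb_star[OF inv FA_gens(1), of v]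
    by (simp add: lp_vt_def fa_star_mono[OF inv] wstar_def)
next
  fix v w assume v: "v \<in> verts E" "w \<in> verts E"
  have "fa_diff (fa_mono [Vt v, Vt w] :: ('v,'e,'k) fa) (if v = w then fa_mono [Vt v] else fa_zero) \<in> lrels E"
    using v unfolding lrels_def by blast
  hence "emb E (fa_mono [Vt v, Vt w] :: ('v,'e,'k) fa) = emb E (if v = w then fa_mono [Vt v] else fa_zero)"
    using v by (intro emb_lrel) (auto intro!: FA_mono FA_zero simp: gen_ok_def)
  thus "lp_vt v * lp_vt w = (if v = w then lp_vt v else (0 :: ('v,'e,'k) lp))"
    using v by (simp add: lp_vt_def emb_times FA_gens fa_mult_mono_mono emb_zero split: if_splits)
next
  fix e assume e: "e \<in> edges E"
  have "fa_diff (fa_mono [Vt (src E e), Ed e] :: ('v,'e,'k) fa) (fa_mono [Ed e]) \<in> lrels E"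
    using e unfolding lrels_def by blast
  hence "emb E (fa_mono [Vt (src E e), Ed e] :: ('v,'e,'k) fa) = emb E (fa_mono [Ed e])"
    using e wf by (intro emb_lrel) (auto intro!: FA_mono simp: gen_ok_def)
  thus "lp_vt (src E e) * lp_ed e = (lp_ed e :: ('v,'e,'k) lp)"
    using e wf by (simp add: lp_vt_def lp_ed_def emb_times FA_gens fa_mult_mono_mono)
  have "fa_diff (fa_mono [Ed e, Vt (rng E e)] :: ('v,'e,'k) fa) (fa_mono [Ed e]) \<in> lrels E"
    using e unfolding lrels_def by blast
  hence "emb E (fa_mono [Ed e, Vt (rng E e)] :: ('v,'e,'k) fa) = emb E (fa_mono [Ed e])"
    using e wf by (intro emb_lrel) (auto intro!: FA_mono simp: gen_ok_def)
  thus "lp_ed e * lp_vt (rng E e) = (lp_ed e :: ('v,'e,'k) lp)"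
    using e wf by (simp add: lp_vt_def lp_ed_def emb_times FA_gens fa_mult_mono_mono)
next
  have gh: "lp_star \<sigma> (lp_ed e :: ('v,'e,'k) lp) = emb E (fa_mono [Gh e])" if "e \<in> edges E" for e
    using that by (simp add: lp_ed_def emb_star[OF inv FA_gens(2)] fa_star_mono[OF inv] wstar_def)
  {
    fix e f assume e: "e \<in> edges E" "f \<in> edges E"
    have "fa_diff (fa_mono [Gh e, Ed f] :: ('v,'e,'k) fa) (if e = f then fa_mono [Vt (rng E e)] else fa_zero) \<in> lrels E"
      using e unfolding lrels_def by blast
    hence "emb E (fa_mono [Gh e, Ed f] :: ('v,'e,'k) fa) = emb E (if e = f then fa_mono [Vt (rng E e)] else fa_zero)"
      using e wf by (intro emb_lrel) (auto intro!: FA_mono FA_zero simp: gen_ok_def)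
    thus "lp_star \<sigma> (lp_ed e) * lp_ed f = (if e = f then lp_vt (rng E e) else (0 :: ('v,'e,'k) lp))"
      using e wf unfolding gh[OF e(1)]
      by (simp add: lp_ed_def lp_vt_def emb_times FA_gens fa_mult_mono_mono emb_zero split: if_splits)
  next
    fix v assume v: "v \<in> verts E" "regular_vertex E v"
    have fin: "finite (emits E v)" using v by (simp add: regular_vertex_def)
    have FAe: "(fa_mono [Ed e, Gh e] :: ('v,'e,'k) fa) \<in> FA E" if "e \<in> emits E v" for e
      using that by (auto intro!: FA_mono simp: gen_ok_def emits_def)
    let ?loops = "\<lambda>w. \<Sum>e\<in>emits E v. (fa_mono [Ed e, Gh e] :: ('v,'e,'k) fa) w"
    have s: "?loops \<in> FA E" "emb E ?loops = (\<Sum>e\<in>emits E v. emb E (fa_mono [Ed e, Gh e]))"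
      using emb_sum[OF fin, of "\<lambda>e. fa_mono [Ed e, Gh e] :: ('v,'e,'k) fa"] FAe by simp_all
    have "fa_diff (fa_mono [Vt v] :: ('v,'e,'k) fa) (\<lambda>w. \<Sum>e\<in>emits E v. fa_mono [Ed e, Gh e] w) \<in> lrels E"
      using v unfolding lrels_def by blast
    hence "emb E (fa_mono [Vt v] :: ('v,'e,'k) fa) = emb E (\<lambda>w. \<Sum>e\<in>emits E v. fa_mono [Ed e, Gh e] w)"
      by (intro emb_lrel FA_gens(1)[OF v(1)] s(1))
    also have "\<dots> = (\<Sum>e\<in>emits E v. emb E (fa_mono [Ed e, Gh e]))" by (rule s(2))
    also have "\<dots> = (\<Sum>e\<in>emits E v. lp_ed e * lp_star \<sigma> (lp_ed e))"
    proof (rule sum.cong[OF refl])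
      fix e assume "e \<in> emits E v"
      hence "e \<in> edges E" by (simp add: emits_def)
      thus "emb E (fa_mono [Ed e, Gh e] :: ('v,'e,'k) fa) = lp_ed e * lp_star \<sigma> (lp_ed e)"
        unfolding gh[OF \<open>e \<in> edges E\<close>] by (simp add: lp_ed_def emb_times FA_gens fa_mult_mono_mono)
    qed
    finally show "lp_vt v = (\<Sum>e\<in>emits E v. lp_ed e * lp_star \<sigma> (lp_ed e) :: ('v,'e,'k) lp)"
      using v by (simp add: lp_vt_def)
  }
next
  fix v assume v: "v \<in> verts E"
  have "fa_diff (fa_mono [Vt v] :: ('v,'e,'k) fa) fa_zero \<notin> lideal E"
    by (simp add: fa_diff_def fa_zero_def vertex_not_in_lideal)
  hence "(fa_mono [Vt v] :: ('v,'e,'k) fa, fa_zero) \<notin> lequiv E" by (simp add: lequiv_def)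
  thus "lp_vt v \<noteq> (0 :: ('v,'e,'k) lp)"
    using v by (simp add: lp_vt_def emb_zero[symmetric] emb_eq_iff FA_gens FA_zero)
qed

end

lemma annihilator_transport:
  fixes J :: "'x \<Rightarrow> 'a::ring"
  assumes inj: "inj_on J U"
    and m: "\<And>x y. x \<in> U \<Longrightarrow> y \<in> U \<Longrightarrow> m x y \<in> U \<and> J (m x y) = J x * J y"
    and z: "z \<in> U" "J z = 0" and C: "C \<subseteq> U"
    and H: "\<And>x. x \<in> U \<Longrightarrow> H x \<longleftrightarrow> H' (J x)" and Q: "\<And>x. x \<in> U \<Longrightarrow> Q x \<longleftrightarrow> Q' (J x)"
  shows "(\<forall>S\<subseteq>C. (\<forall>x\<in>S. H x) \<longrightarrow> (\<exists>p\<in>C. Q p \<and> rann C m z S = m p ` C)) \<longleftrightarrow>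
    (\<forall>S\<subseteq>J ` C. (\<forall>x\<in>S. H' x) \<longrightarrow> (\<exists>p\<in>J ` C. Q' p \<and> rann (J ` C) (*) 0 S = (*) p ` (J ` C)))"
proof -
  have 1: "(\<exists>p\<in>C. Q p \<and> rann C m z S = m p ` C) \<longleftrightarrow>
      (\<exists>p\<in>J ` C. Q' p \<and> rann (J ` C) (*) 0 (J ` S) = (*) p ` (J ` C))"
    and 2: "(\<forall>x\<in>S. H x) \<longleftrightarrow> (\<forall>x\<in>J ` S. H' x)" if S: "S \<subseteq> C" for S
  proof -
    have z0: "m x y = z \<longleftrightarrow> J x * J y = 0" if "x \<in> U" "y \<in> U" for x y
      using inj_on_eq_iff[OF inj, of "m x y" z] m[OF that] z by simp
    have r: "J ` rann C m z S = rann (J ` C) (*) 0 (J ` S)"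
      using z0 S C by (auto simp: rann_def subset_iff)
    have "rann C m z S = m p ` C \<longleftrightarrow> rann (J ` C) (*) 0 (J ` S) = (*) (J p) ` (J ` C)" if p: "p \<in> C" for p
    proof -
      have "J ` (m p ` C) = (*) (J p) ` (J ` C)"
        unfolding image_image using m p C by (intro image_cong refl) auto
      moreover have "rann C m z S \<subseteq> U" "m p ` C \<subseteq> U" using C m p by (auto simp: rann_def)
      ultimately show ?thesis using inj_on_image_eq_iff[OF inj, of "rann C m z S" "m p ` C"] r by simp
    qed
    hence "\<forall>p\<in>C. (Q p \<and> rann C m z S = m p ` C) \<longleftrightarrow>
      (Q' (J p) \<and> rann (J ` C) (*) 0 (J ` S) = (*) (J p) ` (J ` C))"
      using Q C by blast
    thus "(\<exists>p\<in>C. Q p \<and> rann C m z S = m p ` C) \<longleftrightarrow>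
      (\<exists>p\<in>J ` C. Q' p \<and> rann (J ` C) (*) 0 (J ` S) = (*) p ` (J ` C))"
      by blast
    show "(\<forall>x\<in>S. H x) \<longleftrightarrow> (\<forall>x\<in>J ` S. H' x)" using H S C by auto
  qed
  show ?thesis unfolding all_subset_image by (rule all_cong) (simp only: 1 2)
qed

context
  fixes J :: "'x \<Rightarrow> 'a::ring" and U m z st st' H H'
  assumes inj: "inj_on J U"
    and m: "\<And>x y. x \<in> U \<Longrightarrow> y \<in> U \<Longrightarrow> m x y \<in> U \<and> J (m x y) = J x * J y"
    and z: "z \<in> U" "J z = 0"
    and st: "\<And>x. x \<in> U \<Longrightarrow> st x \<in> U \<and> J (st x) = st' (J x)"
    and H: "\<And>x. x \<in> U \<Longrightarrow> H x \<longleftrightarrow> H' (J x)"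
begin

lemma transport_idem: "x \<in> U \<Longrightarrow> m x x = x \<longleftrightarrow> J x * J x = J x"
  using inj_on_eq_iff[OF inj, of "m x x" x] m[of x x] by simp

lemma transport_st: "x \<in> U \<Longrightarrow> st x = x \<longleftrightarrow> st' (J x) = J x"
  using inj_on_eq_iff[OF inj, of "st x" x] st[of x] by simp

lemma transport_unit:
  assumes C: "C \<subseteq> U" shows "has_unit C m \<longleftrightarrow> has_unit (J ` C) (*)"
proof -
  have "m u x = x \<and> m x u = x \<longleftrightarrow> J u * J x = J x \<and> J x * J u = J x" if "u \<in> C" "x \<in> C" for u x
    using inj_on_eq_iff[OF inj, of "m u x" x] inj_on_eq_iff[OF inj, of "m x u" x] m[of u x] m[of x u] that C
    by (metis subsetD)
  thus ?thesis unfolding has_unit_def by simp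
qed

lemma transport_baer: "C \<subseteq> U \<Longrightarrow> baer C m z \<longleftrightarrow> baer (J ` C) (*) 0"
  using annihilator_transport[OF inj m z, of C "\<lambda>_. True" "\<lambda>_. True" "\<lambda>p. m p p = p" "\<lambda>p. p * p = p"]
    transport_idem transport_unit[of C]
  unfolding baer_def by simp

lemma transport_gr_baer: "C \<subseteq> U \<Longrightarrow> gr_baer C m z H \<longleftrightarrow> gr_baer (J ` C) (*) 0 H'"
  using annihilator_transport[OF inj m z, of C H H' "\<lambda>p. H p \<and> m p p = p" "\<lambda>p. H' p \<and> p * p = p"]
    transport_idem H transport_unit[of C]
  unfolding gr_baer_def by (simp add: conj_assoc)

lemma transport_gr_baer_star: "C \<subseteq> U \<Longrightarrow> gr_baer_star C m z st H \<longleftrightarrow> gr_baer_star (J ` C) (*) 0 st' H'"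
  using annihilator_transport[OF inj m z, of C H H' "\<lambda>p. H p \<and> m p p = p \<and> st p = p" "\<lambda>p. H' p \<and> p * p = p \<and> st' p = p"]
    transport_idem H transport_st
  unfolding gr_baer_star_def by (simp add: conj_assoc)

lemma transport_corner: "e \<in> U \<Longrightarrow> corner U m e \<subseteq> U \<and> J ` corner U m e = corner (J ` U) (*) (J e)"
proof -
  assume e: "e \<in> U"
  have "J ` corner U m e = (\<lambda>x. J e * J x * J e) ` U"
    unfolding corner_def image_image using m e by (intro image_cong refl) auto
  thus ?thesis using m e by (auto simp: corner_def image_image)
qed

lemma transport_locally:
  "locally_baer U m z \<longleftrightarrow> locally_baer (J ` U) (*) 0"
  "gr_locally_baer U m z H \<longleftrightarrow> gr_locally_baer (J ` U) (*) 0 H'"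
  "gr_locally_baer_star U m z st H \<longleftrightarrow> gr_locally_baer_star (J ` U) (*) 0 st' H'"
  unfolding locally_baer_def gr_locally_baer_def gr_locally_baer_star_def
  using transport_corner transport_baer transport_gr_baer transport_gr_baer_star transport_idem transport_st H
  by simp_all

lemmas transport = transport_locally transport_baer[OF subset_refl] transport_gr_baer[OF subset_refl]
  transport_gr_baer_star[OF subset_refl]

end

definition lp_of :: "('v,'e) dgraph \<Rightarrow> ('v,'e,'k::field) fa set \<Rightarrow> ('v,'e,'k) lp" where
  "lp_of E X = emb E (SOME f. f \<in> X)"

lemma lclass_eq: "f \<in> FA E \<Longrightarrow> g \<in> lclass E f \<longleftrightarrow> (f, g) \<in> lequiv E"
  by (simp add: lclass_def)

text \<open>The representative picked by \<open>lp_of\<close> is irrelevant, as equivalent elements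
  have the same image under \<open>emb\<close>.\<close>

lemma lp_of_lclass: "f \<in> FA E \<Longrightarrow> lp_of E (lclass E f) = emb E f"
proof -
  assume f: "f \<in> FA E"
  hence "f \<in> lclass E f" by (simp add: lclass_def lequiv_refl)
  hence "(SOME g. g \<in> lclass E f) \<in> lclass E f"
    by (rule someI[where P = "\<lambda>g. g \<in> lclass E f"])
  hence "(f, SOME g. g \<in> lclass E f) \<in> lequiv E" by (simp add: lclass_def)
  thus ?thesis using f lequivD emb_eq_iff[of f E] unfolding lp_of_def by metis
qed

lemma lclass_cong: "(f, g) \<in> lequiv E \<Longrightarrow> lclass E f = lclass E g"
  unfolding lclass_def using lequiv_sym lequiv_trans by (auto, blast+)

lemma LPA_eq: "LPA E = lclass E ` FA E"
  by (auto simp: LPA_def quotient_def lclass_def)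

lemma lclass_UN:
  assumes "f \<in> FA E" "\<And>g. (f, g) \<in> lequiv E \<Longrightarrow> X g = Y" shows "(\<Union>g\<in>lclass E f. X g) = Y"
  using assms lequiv_refl[OF assms(1)] by (auto simp: lclass_eq)

lemma lmult_lclass: "f \<in> FA E \<Longrightarrow> g \<in> FA E \<Longrightarrow> lmult E (lclass E f) (lclass E g) = lclass E (fa_mult f g)"
  unfolding lmult_def
  by (intro lclass_UN lclass_cong lequiv_sym[OF lequiv_mult]) auto

lemma lstar_lclass: "field_involution \<sigma> \<Longrightarrow> f \<in> FA E \<Longrightarrow> lstar E \<sigma> (lclass E f) = lclass E (fa_star \<sigma> f)"
  unfolding lstar_def by (intro lclass_UN lclass_cong lequiv_sym[OF lequiv_star]) auto

text \<open>A homogeneous representative is fixed by \<open>fa_comp n\<close>; conversely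
  \<open>fa_comp n f\<close> is such a representative once the class is fixed by the
  projection.\<close>

lemma lhomog_lclass:
  assumes f: "f \<in> FA E" shows "lhomog E (lclass E f) \<longleftrightarrow> (\<exists>n. lp_comp n (emb E f) = emb E f)"
proof
  assume "lhomog E (lclass E f)"
  then obtain n g where g: "(f, g) \<in> lequiv E" "\<And>w. g w \<noteq> 0 \<Longrightarrow> wdeg w = n"
    using f by (auto simp: lhomog_def lclass_eq)
  have "fa_comp n g = g" using g(2) by (auto simp: fa_comp_def fun_eq_iff)
  moreover have "g \<in> FA E" using lequivD g by blast
  moreover from this have "emb E f = emb E g" using g f by (simp add: emb_eq_iff)
  ultimately show "\<exists>n. lp_comp n (emb E f) = emb E f" using emb_comp[of g E n] by metis
next
  assume "\<exists>n. lp_comp n (emb E f) = emb E f"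
  then obtain n where "emb E (fa_comp n f) = emb E f" using emb_comp[OF f] by metis
  hence "fa_comp n f \<in> lclass E f" using f FA_comp[OF f, of n] emb_eq_iff lequiv_sym by (metis lclass_eq)
  thus "lhomog E (lclass E f)" unfolding lhomog_def by (intro exI[of _ n] bexI) (auto simp: fa_comp_def)
qed

theorem mainTheorem14:
  fixes E :: "('v,'e) dgraph" and \<sigma> :: "'k::field \<Rightarrow> 'k"
  assumes "wf_graph E" and "field_involution \<sigma>"
  shows "(graph_cond E \<longleftrightarrow> locally_baer (LPA E :: ('v,'e,'k) fa set set) (lmult E) (lzero E))
       \<and> (graph_cond E \<longleftrightarrow> gr_locally_baer (LPA E :: ('v,'e,'k) fa set set) (lmult E) (lzero E) (lhomog E))
       \<and> (positive_definite \<sigma> \<longrightarrow>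
            (graph_cond E \<longleftrightarrow> gr_locally_baer_star (LPA E) (lmult E) (lzero E) (lstar E \<sigma>) (lhomog E)))
       \<and> (finite_graph E \<and> no_exit E \<longleftrightarrow> baer (LPA E :: ('v,'e,'k) fa set set) (lmult E) (lzero E))
       \<and> (finite_graph E \<and> no_exit E \<longleftrightarrow> gr_baer (LPA E :: ('v,'e,'k) fa set set) (lmult E) (lzero E) (lhomog E))
       \<and> (positive_definite \<sigma> \<longrightarrow>
            (finite_graph E \<and> no_exit E \<longleftrightarrow> gr_baer_star (LPA E) (lmult E) (lzero E) (lstar E \<sigma>) (lhomog E)))"
proof -
  interpret leavitt E \<sigma> lp_scale "lp_star \<sigma>" lp_comp "lp_vt E :: 'v \<Rightarrow> ('v,'e,'k) lp" "lp_ed E"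
    by (rule leavitt_lp[OF assms])
  let ?U = "LPA E :: ('v,'e,'k) fa set set" and ?H = "\<lambda>x :: ('v,'e,'k) lp. \<exists>n. lp_comp n x = x"
  \<comment> \<open>The image of the free algebra lies in \<open>A\<close>: words are built from the
    left, and \<open>A\<close> is closed under left multiplication by each generator.\<close>
  have gen: "emb E (fa_mono [g]) \<in> A \<and> (\<forall>x\<in>A. emb E (fa_mono [g]) * x \<in> A)" if "gen_ok E g" for g
  proof (cases g)
    case (Vt v)
    thus ?thesis using that A_vt[of v] A_vt_mult[of _ v] by (simp add: gen_ok_def lp_vt_def)
  next
    case (Ed e)
    thus ?thesis using that A_ed[of e] A_ed_mult[of _ e] by (simp add: gen_ok_def lp_ed_def)
  next
    case (Gh e)
    hence "e \<in> edges E" using that by (simp add: gen_ok_def)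
    moreover from this have "lp_star \<sigma> (lp_ed E e) = (emb E (fa_mono [g]) :: ('v,'e,'k) lp)"
      by (simp add: Gh lp_ed_def emb_star[OF assms(2) FA_gens(2)] fa_star_mono[OF assms(2)] wstar_def)
    ultimately show ?thesis using A_st[OF A_ed[of e]] A_ghost_mult[of _ e] by simp
  qed
  have word: "emb E (fa_mono w) \<in> A" if "w \<noteq> []" "set w \<subseteq> Collect (gen_ok E)" for w
    using that
  proof (induction w)
    case (Cons g w)
    show ?case
    proof (cases "w = []")
      case False
      have "emb E (fa_mono [g]) * emb E (fa_mono w) = (emb E (fa_mono (g # w)) :: ('v,'e,'k) lp)"
        using Cons.prems False by (subst emb_times) (auto intro!: FA_mono simp: fa_mult_mono_mono)
      thus ?thesis using Cons False gen[of g] by auto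
    qed (use Cons gen in auto)
  qed simp
  have "emb E f \<in> A" if "f \<in> FA E" for f
    using that
  proof (induction rule: FA_induct)
    case (mono c w)
    thus ?case using A_sc[OF word[OF mono], of c] emb_scale[OF FA_mono, of w E c] by simp
  qed (auto simp: emb_zero emb_plus[symmetric] intro: A.intros)
  \<comment> \<open>Conversely the image contains all monomials and is closed under sums and
    scalars, so it is all of \<open>A\<close>.\<close>
  moreover have "x \<in> emb E ` FA E" if "x \<in> A" for x
  proof -
    have plus: "x + y \<in> emb E ` FA E" and mult: "x * y \<in> emb E ` FA E"
      if "x \<in> emb E ` FA E" "y \<in> emb E ` FA E" for x y :: "('v,'e,'k) lp"
      using that by (auto simp: emb_plus emb_times intro!: imageI FA_add FA_mult)
    have sc: "lp_scale c x \<in> emb E ` FA E" and star: "lp_star \<sigma> x \<in> emb E ` FA E"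
      if "x \<in> emb E ` FA E" for x :: "('v,'e,'k) lp" and c
      using that assms(2) by (auto simp: emb_scale emb_star intro!: imageI FA_smult fa_star_FA)
    have vt: "lp_vt E v \<in> emb E ` FA E" if "v \<in> verts E" for v
      using that by (auto simp: lp_vt_def FA_gens)
    have ed: "lp_ed E e \<in> emb E ` FA E" if "e \<in> edges E" for e
      using that by (auto simp: lp_ed_def FA_gens)
    have pth: "pth v a \<in> emb E ` FA E" if "vpath E v a" for v a
      using that by (induction a arbitrary: v) (auto intro!: vt ed mult)
    show ?thesis using that
    proof (induction rule: A.induct)
      case zero thus ?case using emb_zero FA_zero by (metis imageI)
    qed (auto intro!: plus sc mult star pth)
  qed
  ultimately have A: "A = lp_of E ` ?U"
    by (auto simp: LPA_eq image_image lp_of_lclass)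
  have inj: "inj_on (lp_of E) ?U"
  proof (rule inj_onI)
    fix X Y assume "X \<in> ?U" "Y \<in> ?U" and eq: "lp_of E X = lp_of E Y"
    then obtain f g where fg: "f \<in> FA E" "g \<in> FA E" "X = lclass E f" "Y = lclass E g"
      by (auto simp: LPA_eq)
    hence "(f, g) \<in> lequiv E" using eq by (simp add: lp_of_lclass emb_eq_iff)
    thus "X = Y" using fg lclass_cong by metis
  qed
  have m: "lmult E X Y \<in> ?U \<and> lp_of E (lmult E X Y) = lp_of E X * lp_of E Y" if "X \<in> ?U" "Y \<in> ?U" for X Y
    using that by (auto simp: LPA_eq lmult_lclass lp_of_lclass FA_mult emb_times)
  have z: "lzero E \<in> ?U" "lp_of E (lzero E :: ('v,'e,'k) fa set) = 0"
    by (auto simp: LPA_eq lzero_def lp_of_lclass FA_zero emb_zero)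
  have st: "lstar E \<sigma> X \<in> ?U \<and> lp_of E (lstar E \<sigma> X) = lp_star \<sigma> (lp_of E X)" if "X \<in> ?U" for X
    using that assms(2) by (auto simp: LPA_eq lstar_lclass lp_of_lclass fa_star_FA emb_star)
  have H: "lhomog E X \<longleftrightarrow> ?H (lp_of E X)" if "X \<in> ?U" for X
    using that by (auto simp: LPA_eq lp_of_lclass lhomog_lclass)
  note T = transport[where U = ?U and J = "lp_of E" and m = "lmult E" and z = "lzero E" and st = "lstar E \<sigma>"
      and st' = "lp_star \<sigma>" and H = "lhomog E" and H' = ?H, OF inj m z st H]
  show ?thesis
    using baer_characterizations[unfolded A] by (simp add: T)
qed

end
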